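(* Let $V$ be a vector space over a field $\mathbb F$ of characteristic $0$. If $(S(V)[[h]],\star)$ is a balanced deformation of $S(V)$, then the $\mathbb F[[h]]$-algebra homomorphism $$F:(T(V)[[h]],\otimes)\to(S(V)[[h]],\star)$$ which is induced by the natural inclusion $V\to S(V)$ induces an $\mathbb F[[h]]$-algebra isomorphism $$f:(U^h_\star,\odot)\to(S(V)[[h]],\star).$$ When $\star$ is moreover bracket-exact (with respect to a Poisson bracket $\{\cdot,\cdot\}$ on $S(V)$ of which $\star$ is a deformation), then $U^h_\star=U^h$ and we have an isomorphism $f:(U^h,\odot)\to(S(V)[[h]],\star)$. The corresponding statements for $n$-th order deformations, obtained by replacing all objects by their quotients modulo $h^{n+1}$, also hold.
   Context: $T(V)=\bigoplus_{n\ge0}V^{\otimes n}$ is the tensor algebra and $S(V)$ the symmetric algebra (a polynomial algebra). $T(V)[[h]]$ and $S(V)[[h]]$ are the formal power series in $h$ with coefficients in $T(V)$ and $S(V)$. The symmetrization map $\sigma:S(V)\to T(V)$, $\sigma(\prod_{i=1}^na_i)=\frac1{n!}\sum_{p\in S_n}a_{p(1)}\otimes\cdots\otimes a_{p(n)}$ ($a_i\in V$), is extended $\mathbb F[[h]]$-linearly to $S(V)[[h]]\to T(V)[[h]]$. A Poisson bracket is an antisymmetric biderivation satisfying the Jacobi identity. A (formal) deformation $\star$ of $S(V)$ is an associative $\mathbb F[[h]]$-bilinear product on $S(V)[[h]]$ with $p\star q=pq\bmod h$ for $p,q\in S(V)$; write $p\star q=pq+h\pi_1(p,q)+h^2\pi_2(p,q)+\cdots$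 for $p,q\in S(V)$. An $n$-th order deformation is one for which associativity holds modulo $h^{n+1}$. It is a deformation of $(S(V),\{\cdot,\cdot\})$ if $\pi_1=\frac12\{\cdot,\cdot\}$. Put $[p,q]_\star=p\star q-q\star p$. $\star$ is bracket-exact if $[x,y]_\star=h\{x,y\}$ for all $x,y\in V$. The $\star$-symmetrization is the $\mathbb F[[h]]$-linear map $\sigma_\star:S(V)[[h]]\to S(V)[[h]]$ with $\sigma_\star(\prod_{i=1}^na_i)=\frac1{n!}\sum_{p\in S_n}a_{p(1)}\star\cdots\star a_{p(n)}$ for $a_i\in V$ (the empty $\star$-product being the unit of $\star$). $\star$ is $s$-balanced if $\sigma_\star$ is the identity on elements of $S(V)$ of degree $\le s$; it is balanced if it is $s$-balanced, where $s\in\{0,1,\dots,\infty\}$ is the supremum of the degrees of all coefficients (in powers of $h$) of $[x,y]_\star$, $x,y\in V$. $U^h_\star=T(V)[[h]]/J^h_\star$, where $J^h_\star$ is the two-sided ideal of $T(V)[[h]]$ generated by all $a\otimes b-b\otimes a-\sigma[a,b]_\star$ ($a,b\in V$). $U^h=T(V)[[h]]/J^h$, where $J^h$ is the two-sided ideal of $T(V)[[h]]$ generated by all $x\otimes y-y\otimes x-h\sigma\{x,y\}$ ($x,y\in V$). In both cases $\odot$ is the induced product. For $n$-th order statements one uses $T(V)[[h]]/(h^{n+1})$, $S(V)[[h]]/(h^{n+1})$ and the quotients of the former by the two-sided ideals generated by the same elements.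
   Formalization: The two-sided ideals J of T(V)[[h]] are taken as the h-adic closures of the ideals generated by the stated elements, since with the algebraically generated ideals f can fail to be injective (e.g. dim V = 2, undeformed product); modulo h^{n+1} they are the generated ideals. *)

theory Defs
  imports
    "HOL-Algebra.QuotRing"
    "HOL-Algebra.Module"
    "HOL-Library.Poly_Mapping"
    "HOL-Library.Multiset"
    "HOL-Library.Extended_Nat"
    "HOL-Library.FuncSet"
    "HOL-Combinatorics.Permutations"
    "HOL-Computational_Algebra.Formal_Power_Series"
begin

section \<open>Algebras\<close>

text \<open>
  Algebras over a commutative ring, not necessarily commutative, are carried by the record
  type \<^type>\<open>module\<close> (a ring record with a scalar multiplication). The scalars form a type:
  a field \<^typ>\<open>'f\<close>, or its power series ring \<^typ>\<open>'f fps\<close>.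
\<close>

definition linear_maps :: "('k, 'a) module \<Rightarrow> ('k, 'b) module \<Rightarrow> ('a \<Rightarrow> 'b) set" where
  "linear_maps A B = {\<phi>. \<phi> \<in> carrier A \<rightarrow> carrier B
     \<and> (\<forall>x\<in>carrier A. \<forall>y\<in>carrier A. \<phi> (x \<oplus>\<^bsub>A\<^esub> y) = \<phi> x \<oplus>\<^bsub>B\<^esub> \<phi> y)
     \<and> (\<forall>c. \<forall>x\<in>carrier A. \<phi> (c \<odot>\<^bsub>A\<^esub> x) = c \<odot>\<^bsub>B\<^esub> \<phi> x)}"

definition alg_hom :: "('k, 'a) module \<Rightarrow> ('k, 'b) module \<Rightarrow> ('a \<Rightarrow> 'b) set" where
  "alg_hom A B = ring_hom A B \<inter> linear_maps A B"

definition alg_iso :: "('k, 'a) module \<Rightarrow> ('k, 'b) module \<Rightarrow> ('a \<Rightarrow> 'b) set" where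
  "alg_iso A B = ring_iso A B \<inter> linear_maps A B"

definition alg_quot :: "('k, 'a) module \<Rightarrow> 'a set \<Rightarrow> ('k, 'a set) module" where
  "alg_quot A I = ring.extend (A Quot I)
     (module.fields (\<lambda>c X. \<Union>x\<in>X. I +>\<^bsub>A\<^esub> (c \<odot>\<^bsub>A\<^esub> x)))"

definition list_mult :: "('a, 'm) monoid_scheme \<Rightarrow> 'a list \<Rightarrow> 'a" where
  "list_mult A xs = foldr (\<lambda>x y. x \<otimes>\<^bsub>A\<^esub> y) xs \<one>\<^bsub>A\<^esub>"

definition commutator :: "('a, 'm) ring_scheme \<Rightarrow> 'a \<Rightarrow> 'a \<Rightarrow> 'a" where
  "commutator A x y = (x \<otimes>\<^bsub>A\<^esub> y) \<ominus>\<^bsub>A\<^esub> (y \<otimes>\<^bsub>A\<^esub> x)"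

section \<open>Tensor algebra and symmetric algebra\<close>

text \<open>Words under concatenation, so that \<^typ>\<open>'v list \<Rightarrow>\<^sub>0 'f\<close> is the free associative algebra
  on the set \<^typ>\<open>'v\<close>; likewise \<^typ>\<open>'v multiset \<Rightarrow>\<^sub>0 'f\<close> is the polynomial ring on \<^typ>\<open>'v\<close>.\<close>

instantiation list :: (type) monoid_add
begin
definition zero_list :: "'a list" where "zero_list = []"
definition plus_list :: "'a list \<Rightarrow> 'a list \<Rightarrow> 'a list" where "plus_list xs ys = xs @ ys"
instance by standard (simp_all add: zero_list_def plus_list_def)
end

definition monoid_algebra :: "('f::field, 'm::monoid_add \<Rightarrow>\<^sub>0 'f) module" where
  "monoid_algebra = \<lparr>carrier = UNIV, monoid.mult = (*), one = 1, zero = 0, add = (+),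
     smult = (\<lambda>c p. Poly_Mapping.single 0 c * p)\<rparr>"

text \<open>
  For a vector space \<open>V\<close> (a whole type \<^typ>\<open>'v\<close> with scalar multiplication \<open>scale\<close>),
  \<open>T(V)\<close> is the free associative and \<open>S(V)\<close> the free commutative algebra on the elements of
  \<open>V\<close>, each divided by the relations saying that \<open>V\<close> is mapped linearly. In degree \<open>n\<close> the
  former is the free vector space on \<open>V\<^sup>n\<close> modulo the multilinearity relations, i.e.
  the \<open>n\<close>-th tensor power. \<open>l x\<close> is the letter \<open>x\<close>, as a word or as a multiset.
\<close>

definition linearity_relations ::
  "('f::field \<Rightarrow> 'v::ab_group_add \<Rightarrow> 'v) \<Rightarrow> ('v \<Rightarrow> 'm::monoid_add) \<Rightarrow> ('m \<Rightarrow>\<^sub>0 'f) set" where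
  "linearity_relations scale l =
     {Poly_Mapping.single (l (x + y)) 1 - Poly_Mapping.single (l x) 1
        - Poly_Mapping.single (l y) 1 | x y. True}
   \<union> {Poly_Mapping.single (l (scale c x)) 1 - Poly_Mapping.single (l x) c | c x. True}"

definition linearity_ideal ::
  "('f::field \<Rightarrow> 'v::ab_group_add \<Rightarrow> 'v) \<Rightarrow> ('v \<Rightarrow> 'm::monoid_add) \<Rightarrow> ('m \<Rightarrow>\<^sub>0 'f) set" where
  "linearity_ideal scale l =
     Idl\<^bsub>monoid_algebra :: ('f, 'm \<Rightarrow>\<^sub>0 'f) module\<^esub> (linearity_relations scale l)"

type_synonym ('f, 'v) tensor = "('v list \<Rightarrow>\<^sub>0 'f) set"
type_synonym ('f, 'v) sym = "('v multiset \<Rightarrow>\<^sub>0 'f) set"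

definition tensor_alg ::
  "('f::field \<Rightarrow> 'v::ab_group_add \<Rightarrow> 'v) \<Rightarrow> ('f, ('f, 'v) tensor) module" where
  "tensor_alg scale = alg_quot monoid_algebra (linearity_ideal scale (\<lambda>x. [x]))"

definition sym_alg ::
  "('f::field \<Rightarrow> 'v::ab_group_add \<Rightarrow> 'v) \<Rightarrow> ('f, ('f, 'v) sym) module" where
  "sym_alg scale = alg_quot monoid_algebra (linearity_ideal scale (\<lambda>x. {#x#}))"

definition tensor_incl ::
  "('f::field \<Rightarrow> 'v::ab_group_add \<Rightarrow> 'v) \<Rightarrow> 'v \<Rightarrow> ('f, 'v) tensor" where
  "tensor_incl scale x = linearity_ideal scale (\<lambda>x. [x])
     +>\<^bsub>monoid_algebra :: ('f, 'v list \<Rightarrow>\<^sub>0 'f) module\<^esub> Poly_Mapping.single [x] 1"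

definition sym_incl ::
  "('f::field \<Rightarrow> 'v::ab_group_add \<Rightarrow> 'v) \<Rightarrow> 'v \<Rightarrow> ('f, 'v) sym" where
  "sym_incl scale x = linearity_ideal scale (\<lambda>x. {#x#})
     +>\<^bsub>monoid_algebra :: ('f, 'v multiset \<Rightarrow>\<^sub>0 'f) module\<^esub> Poly_Mapping.single {#x#} 1"

text \<open>An element of \<open>S(V)\<close> is the set of the polynomials in elements of \<open>V\<close> that represent it;
  its degree is the smallest degree of such a polynomial. The zero element gets degree \<open>0\<close>.\<close>

definition sym_degree :: "('f::zero, 'v) sym \<Rightarrow> nat" where
  "sym_degree p = (LEAST d. \<exists>r\<in>p. \<forall>M\<in>Poly_Mapping.keys r. size M \<le> d)"

section \<open>Power series modulo a power of \<open>h\<close>\<close>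

text \<open>
  \<open>pseries N A\<close> is \<open>A[[h]]\<close> for \<open>N = \<infinity>\<close> and \<open>A[[h]]/(h\<^sup>N)\<close> for finite \<open>N \<ge> 1\<close>, a class of the
  latter being represented by its unique member with no terms of order \<open>\<ge> N\<close>. A series is
  the sequence of its coefficients, and the scalars are \<open>F[[h]]\<close>, with \<open>h\<close> being
  \<^const>\<open>fps_X\<close>.
\<close>

definition trunc :: "enat \<Rightarrow> ('f, 'a) module \<Rightarrow> (nat \<Rightarrow> 'a) \<Rightarrow> nat \<Rightarrow> 'a" where
  "trunc N A x = (\<lambda>n. if enat n < N then x n else \<zero>\<^bsub>A\<^esub>)"

definition const :: "('f, 'a) module \<Rightarrow> 'a \<Rightarrow> nat \<Rightarrow> 'a" where
  "const A a = (\<lambda>n. if n = 0 then a else \<zero>\<^bsub>A\<^esub>)"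

definition pseries :: "enat \<Rightarrow> ('f::field, 'a) module \<Rightarrow> ('f fps, nat \<Rightarrow> 'a) module" where
  "pseries N A = \<lparr>
     carrier = {x. (\<forall>n. x n \<in> carrier A) \<and> (\<forall>n. N \<le> enat n \<longrightarrow> x n = \<zero>\<^bsub>A\<^esub>)},
     monoid.mult = (\<lambda>x y. trunc N A (\<lambda>n. \<Oplus>\<^bsub>A\<^esub>k\<in>{..n}. x k \<otimes>\<^bsub>A\<^esub> y (n - k))),
     one = const A \<one>\<^bsub>A\<^esub>,
     zero = (\<lambda>n. \<zero>\<^bsub>A\<^esub>),
     add = (\<lambda>x y n. x n \<oplus>\<^bsub>A\<^esub> y n),
     smult = (\<lambda>c x. trunc N A (\<lambda>n. \<Oplus>\<^bsub>A\<^esub>k\<in>{..n}. fps_nth c k \<odot>\<^bsub>A\<^esub> x (n - k)))\<rparr>"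

abbreviation tensor_series ::
  "('f::field \<Rightarrow> 'v::ab_group_add \<Rightarrow> 'v) \<Rightarrow> enat \<Rightarrow> ('f fps, nat \<Rightarrow> ('f, 'v) tensor) module" where
  "tensor_series scale N \<equiv> pseries N (tensor_alg scale)"

abbreviation sym_series ::
  "('f::field \<Rightarrow> 'v::ab_group_add \<Rightarrow> 'v) \<Rightarrow> enat \<Rightarrow> ('f fps, nat \<Rightarrow> ('f, 'v) sym) module" where
  "sym_series scale N \<equiv> pseries N (sym_alg scale)"

definition tensor_gen ::
  "('f::field \<Rightarrow> 'v::ab_group_add \<Rightarrow> 'v) \<Rightarrow> 'v \<Rightarrow> nat \<Rightarrow> ('f, 'v) tensor" where
  "tensor_gen scale x = const (tensor_alg scale) (tensor_incl scale x)"

definition sym_gen ::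
  "('f::field \<Rightarrow> 'v::ab_group_add \<Rightarrow> 'v) \<Rightarrow> 'v \<Rightarrow> nat \<Rightarrow> ('f, 'v) sym" where
  "sym_gen scale x = const (sym_alg scale) (sym_incl scale x)"

text \<open>
  Two-sided ideals of \<open>T(V)[[h]]\<close> are generated in the sense of the \<open>h\<close>-adic topology: the
  closure of the ideal of finite sums is taken, i.e. the intersection of the sets
  \<open>I + h\<^sup>m T(V)[[h]]\<close>. Without it the quotients need not be \<open>h\<close>-adically separated: if
  \<open>V\<close> has a basis \<open>x, y\<close>, then the series with coefficients \<open>x\<^sup>n [x, y] x\<^sup>n\<close> vanishes in
  \<open>S(V)[[h]]\<close>, but it is no finite sum of elements \<open>u [a, b] v\<close> with \<open>u, v\<close> in
  \<open>T(V)[[h]]\<close>. Modulo \<open>h\<^sup>n\<close> the closure adds nothing, as the lemma below shows.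
\<close>

definition hadic_closure :: "('k, nat \<Rightarrow> 'a) module \<Rightarrow> (nat \<Rightarrow> 'a) set \<Rightarrow> (nat \<Rightarrow> 'a) set" where
  "hadic_closure B I = {x \<in> carrier B. \<forall>m. \<exists>y\<in>I. \<forall>n<m. x n = y n}"

lemma hadic_closure_truncated:
  assumes "I \<subseteq> carrier (pseries (enat k) A)"
  shows "hadic_closure (pseries (enat k) A) I = I"
proof
  show "I \<subseteq> hadic_closure (pseries (enat k) A) I"
    using assms by (auto simp: hadic_closure_def)
  show "hadic_closure (pseries (enat k) A) I \<subseteq> I"
  proof
    fix x assume x: "x \<in> hadic_closure (pseries (enat k) A) I"
    then obtain y where y: "y \<in> I" "\<forall>n<k. x n = y n"
      by (auto simp: hadic_closure_def)
    have "x n = y n" for n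
    proof (cases "n < k")
      case False
      then show ?thesis
        using x y(1) assms by (force simp: hadic_closure_def pseries_def)
    qed (use y(2) in simp)
    then show "x \<in> I"
      using y(1) by (metis ext)
  qed
qed

section \<open>Deformations of \<open>S(V)\<close>\<close>

text \<open>The product \<open>star\<close> is one on \<open>S(V)[[h]]\<close>, associative modulo \<open>h\<^sup>N\<close>: \<open>N = \<infinity>\<close> gives formal
  deformations, \<open>N = n + 1\<close> gives \<open>n\<close>-th order deformations. Only its values on
  \<open>S(V)[[h]]\<close> matter.\<close>

type_synonym ('f, 'v) star = "(nat \<Rightarrow> ('f, 'v) sym) \<Rightarrow> (nat \<Rightarrow> ('f, 'v) sym) \<Rightarrow> nat \<Rightarrow> ('f, 'v) sym"

definition deformation ::
  "('f::field \<Rightarrow> 'v::ab_group_add \<Rightarrow> 'v) \<Rightarrow> enat \<Rightarrow> ('f, 'v) star \<Rightarrow> bool" where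
  "deformation scale N star \<longleftrightarrow>
     (\<forall>y\<in>carrier (sym_series scale \<infinity>).
        (\<lambda>x. star x y) \<in> linear_maps (sym_series scale \<infinity>) (sym_series scale \<infinity>)
      \<and> (\<lambda>x. star y x) \<in> linear_maps (sym_series scale \<infinity>) (sym_series scale \<infinity>))
   \<and> (\<forall>x\<in>carrier (sym_series scale \<infinity>). \<forall>y\<in>carrier (sym_series scale \<infinity>).
        \<forall>z\<in>carrier (sym_series scale \<infinity>).
          trunc N (sym_alg scale) (star (star x y) z) = trunc N (sym_alg scale) (star x (star y z)))
   \<and> (\<forall>p\<in>carrier (sym_alg scale). \<forall>q\<in>carrier (sym_alg scale).
        star (const (sym_alg scale) p) (const (sym_alg scale) q) 0 = p \<otimes>\<^bsub>sym_alg scale\<^esub> q)"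

text \<open>\<open>(S(V)[[h]], \<star>)\<close>, resp. its quotient modulo \<open>h\<^sup>N\<close>. Its unit exists for every deformation
  but need not be that of \<open>S(V)\<close>.\<close>

definition star_alg ::
  "('f::field \<Rightarrow> 'v::ab_group_add \<Rightarrow> 'v) \<Rightarrow> enat \<Rightarrow> ('f, 'v) star
     \<Rightarrow> ('f fps, nat \<Rightarrow> ('f, 'v) sym) module" where
  "star_alg scale N star = (sym_series scale N)\<lparr>
     monoid.mult := (\<lambda>x y. trunc N (sym_alg scale) (star x y)),
     one := (THE u. u \<in> carrier (sym_series scale N) \<and>
               (\<forall>x\<in>carrier (sym_series scale N). trunc N (sym_alg scale) (star u x) = x
                  \<and> trunc N (sym_alg scale) (star x u) = x))\<rparr>"

text \<open>
  The \<open>F[[h]]\<close>-linear map from \<open>S(V)[[h]]\<close> to an \<open>F[[h]]\<close>-algebra \<open>B\<close> that sends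
  \<open>a\<^sub>1 \<cdots> a\<^sub>n\<close> to the average of the products in \<open>B\<close> of the images \<open>j a\<^sub>i\<close> in all orders. For
  \<open>B = T(V)[[h]]\<close> this is \<open>\<sigma>\<close>, for \<open>B = (S(V)[[h]], \<star>)\<close> it is \<open>\<sigma>\<^sub>\<star>\<close>.
\<close>

definition symmetrization ::
  "('f::field_char_0 \<Rightarrow> 'v::ab_group_add \<Rightarrow> 'v) \<Rightarrow> enat \<Rightarrow> ('f fps, 'b) module \<Rightarrow> ('v \<Rightarrow> 'b)
     \<Rightarrow> (nat \<Rightarrow> ('f, 'v) sym) \<Rightarrow> 'b" where
  "symmetrization scale N B j = (THE \<phi>.
     \<phi> \<in> extensional (carrier (sym_series scale N))
     \<and> \<phi> \<in> linear_maps (sym_series scale N) B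
     \<and> (\<forall>as. \<phi> (const (sym_alg scale) (list_mult (sym_alg scale) (map (sym_incl scale) as))) =
          fps_const (inverse (fact (length as))) \<odot>\<^bsub>B\<^esub>
            (\<Oplus>\<^bsub>B\<^esub>p\<in>{p. p permutes {..<length as}}.
               list_mult B (map (\<lambda>i. j (as ! p i)) [0..<length as]))))"

definition tensor_symm ::
  "('f::field_char_0 \<Rightarrow> 'v::ab_group_add \<Rightarrow> 'v) \<Rightarrow> enat
     \<Rightarrow> (nat \<Rightarrow> ('f, 'v) sym) \<Rightarrow> nat \<Rightarrow> ('f, 'v) tensor" where
  "tensor_symm scale N = symmetrization scale N (tensor_series scale N) (tensor_gen scale)"

definition star_symm ::
  "('f::field_char_0 \<Rightarrow> 'v::ab_group_add \<Rightarrow> 'v) \<Rightarrow> enat \<Rightarrow> ('f, 'v) star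
     \<Rightarrow> (nat \<Rightarrow> ('f, 'v) sym) \<Rightarrow> nat \<Rightarrow> ('f, 'v) sym" where
  "star_symm scale N star = symmetrization scale N (star_alg scale N star) (sym_gen scale)"

definition star_bracket ::
  "('f::field \<Rightarrow> 'v::ab_group_add \<Rightarrow> 'v) \<Rightarrow> enat \<Rightarrow> ('f, 'v) star
     \<Rightarrow> 'v \<Rightarrow> 'v \<Rightarrow> nat \<Rightarrow> ('f, 'v) sym" where
  "star_bracket scale N star x y =
     commutator (star_alg scale N star) (sym_gen scale x) (sym_gen scale y)"

definition s_balanced ::
  "('f::field_char_0 \<Rightarrow> 'v::ab_group_add \<Rightarrow> 'v) \<Rightarrow> enat \<Rightarrow> ('f, 'v) star \<Rightarrow> enat \<Rightarrow> bool" where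
  "s_balanced scale N star s \<longleftrightarrow>
     (\<forall>p\<in>carrier (sym_alg scale). enat (sym_degree p) \<le> s \<longrightarrow>
        star_symm scale N star (const (sym_alg scale) p) = const (sym_alg scale) p)"

definition balanced ::
  "('f::field_char_0 \<Rightarrow> 'v::ab_group_add \<Rightarrow> 'v) \<Rightarrow> enat \<Rightarrow> ('f, 'v) star \<Rightarrow> bool" where
  "balanced scale N star \<longleftrightarrow>
     s_balanced scale N star
       (SUP (x, y, n)\<in>UNIV. enat (sym_degree (star_bracket scale N star x y n)))"

section \<open>Poisson brackets\<close>

definition poisson_bracket :: "('f::field, 'a) module \<Rightarrow> ('a \<Rightarrow> 'a \<Rightarrow> 'a) \<Rightarrow> bool" where
  "poisson_bracket A br \<longleftrightarrow>
     (\<forall>q\<in>carrier A. (\<lambda>p. br p q) \<in> linear_maps A A \<and> (\<lambda>p. br q p) \<in> linear_maps A A)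
   \<and> (\<forall>p\<in>carrier A. \<forall>q\<in>carrier A. br p q = \<ominus>\<^bsub>A\<^esub> br q p)
   \<and> (\<forall>p\<in>carrier A. \<forall>q\<in>carrier A. \<forall>r\<in>carrier A.
        br (p \<otimes>\<^bsub>A\<^esub> q) r = (p \<otimes>\<^bsub>A\<^esub> br q r) \<oplus>\<^bsub>A\<^esub> (br p r \<otimes>\<^bsub>A\<^esub> q)
      \<and> br r (p \<otimes>\<^bsub>A\<^esub> q) = (p \<otimes>\<^bsub>A\<^esub> br r q) \<oplus>\<^bsub>A\<^esub> (br r p \<otimes>\<^bsub>A\<^esub> q))
   \<and> (\<forall>p\<in>carrier A. \<forall>q\<in>carrier A. \<forall>r\<in>carrier A.
        br p (br q r) \<oplus>\<^bsub>A\<^esub> br q (br r p) \<oplus>\<^bsub>A\<^esub> br r (br p q) = \<zero>\<^bsub>A\<^esub>)"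

text \<open>The condition on the coefficient of \<open>h\<close> is void modulo \<open>h\<close> (order \<open>0\<close>).\<close>

definition deforms_bracket ::
  "('f::field_char_0 \<Rightarrow> 'v::ab_group_add \<Rightarrow> 'v) \<Rightarrow> enat \<Rightarrow> ('f, 'v) star
     \<Rightarrow> (('f, 'v) sym \<Rightarrow> ('f, 'v) sym \<Rightarrow> ('f, 'v) sym) \<Rightarrow> bool" where
  "deforms_bracket scale N star br \<longleftrightarrow>
     (1 < N \<longrightarrow> (\<forall>p\<in>carrier (sym_alg scale). \<forall>q\<in>carrier (sym_alg scale).
        star (const (sym_alg scale) p) (const (sym_alg scale) q) 1
          = (1 / 2) \<odot>\<^bsub>sym_alg scale\<^esub> br p q))"

definition bracket_exact ::
  "('f::field_char_0 \<Rightarrow> 'v::ab_group_add \<Rightarrow> 'v) \<Rightarrow> enat \<Rightarrow> ('f, 'v) star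
     \<Rightarrow> (('f, 'v) sym \<Rightarrow> ('f, 'v) sym \<Rightarrow> ('f, 'v) sym) \<Rightarrow> bool" where
  "bracket_exact scale N star br \<longleftrightarrow>
     (\<forall>x y. star_bracket scale N star x y =
        fps_X \<odot>\<^bsub>sym_series scale N\<^esub>
          const (sym_alg scale) (br (sym_incl scale x) (sym_incl scale y)))"

section \<open>The algebras \<open>U\<^sub>\<star>\<close> and \<open>U\<close>\<close>

definition J_star ::
  "('f::field_char_0 \<Rightarrow> 'v::ab_group_add \<Rightarrow> 'v) \<Rightarrow> enat \<Rightarrow> ('f, 'v) star
     \<Rightarrow> (nat \<Rightarrow> ('f, 'v) tensor) set" where
  "J_star scale N star = hadic_closure (tensor_series scale N)
     (Idl\<^bsub>tensor_series scale N\<^esub>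
       {commutator (tensor_series scale N) (tensor_gen scale a) (tensor_gen scale b)
          \<ominus>\<^bsub>tensor_series scale N\<^esub> tensor_symm scale N (star_bracket scale N star a b) | a b. True})"

definition J_bracket ::
  "('f::field_char_0 \<Rightarrow> 'v::ab_group_add \<Rightarrow> 'v) \<Rightarrow> enat
     \<Rightarrow> (('f, 'v) sym \<Rightarrow> ('f, 'v) sym \<Rightarrow> ('f, 'v) sym) \<Rightarrow> (nat \<Rightarrow> ('f, 'v) tensor) set" where
  "J_bracket scale N br = hadic_closure (tensor_series scale N)
     (Idl\<^bsub>tensor_series scale N\<^esub>
       {commutator (tensor_series scale N) (tensor_gen scale x) (tensor_gen scale y)
          \<ominus>\<^bsub>tensor_series scale N\<^esub> (fps_X \<odot>\<^bsub>tensor_series scale N\<^esub>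
             tensor_symm scale N
               (const (sym_alg scale) (br (sym_incl scale x) (sym_incl scale y)))) | x y. True})"

definition U_star ::
  "('f::field_char_0 \<Rightarrow> 'v::ab_group_add \<Rightarrow> 'v) \<Rightarrow> enat \<Rightarrow> ('f, 'v) star
     \<Rightarrow> ('f fps, (nat \<Rightarrow> ('f, 'v) tensor) set) module" where
  "U_star scale N star = alg_quot (tensor_series scale N) (J_star scale N star)"

definition U_bracket ::
  "('f::field_char_0 \<Rightarrow> 'v::ab_group_add \<Rightarrow> 'v) \<Rightarrow> enat
     \<Rightarrow> (('f, 'v) sym \<Rightarrow> ('f, 'v) sym \<Rightarrow> ('f, 'v) sym)
     \<Rightarrow> ('f fps, (nat \<Rightarrow> ('f, 'v) tensor) set) module" where
  "U_bracket scale N br = alg_quot (tensor_series scale N) (J_bracket scale N br)"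

end

theory Submission
  imports Defs
begin

text \<open>
  Symmetrization turns into \<open>\<star>\<close>-symmetrization under \<open>F\<close>: \<open>F \<circ> \<sigma> = \<sigma>\<^sub>\<star>\<close>. If \<open>\<star>\<close> is balanced, \<open>\<sigma>\<^sub>\<star>\<close>
  fixes the brackets \<open>[a, b]\<^sub>\<star>\<close>, so the generators of \<open>J\<^sup>h\<^sub>\<star>\<close> lie in the kernel of \<open>F\<close>, and so does the
  \<open>h\<close>-adic closure of the ideal they generate. Modulo \<open>h\<close>, \<open>F\<close> is the projection of \<open>T(V)\<close> onto \<open>S(V)\<close>,
  so it is surjective by successive approximation. Conversely, the kernel of that projection is
  the commutator ideal, which consists of the constant terms of elements of \<open>J\<^sup>h\<^sub>\<star>\<close>, since
  \<open>[a, b]\<^sub>\<star>\<close> vanishes modulo \<open>h\<close>. An element \<open>t\<close> with \<open>F t = 0\<close> is therefore \<open>j + h t'\<close> with \<open>j\<close> in the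
  ideal and \<open>F t' = 0\<close> (modulo one power of \<open>h\<close> less), and iterating this puts \<open>t\<close> into the closure of the ideal.
  No Poincare-Birkhoff-Witt theorem is needed: the product \<open>\<star>\<close> is given.
\<close>

section \<open>Algebras and linear maps\<close>

text \<open>Linearity over \<open>F[[h]]\<close> already forces h-adic continuity: writing a series
  as its constant term plus h times its shift, and iterating, shows that coefficient n of the image
  depends only on the images of the constants x 0, ..., x n (\<open>coeff_formula\<close>). Hence
  homomorphisms need no topological hypothesis, maps of series are compared on words in V, and
  injectivity and surjectivity are tested modulo h. Two obstacles shape the preparations. T(V) and
  S(V) are quotients of free algebras, and no basis of V is chosen, so a linear map out of them is
  prescribed on words or multisets and must be shown to be linear in each letter; for symmetrization
  this is a statement about sums over permutations. Moreover \<open>star\<close> is given on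
  untruncated series, with associativity only modulo h^N and no unit. It is shown to descend to the
  truncation, where a unit exists because star-multiplication by the constant 1 is the identity
  modulo h. Everything is done for arbitrary N > 0, which covers formal and finite order
  deformations at once.\<close>

lemma list_mult_Nil [simp]: "list_mult A [] = \<one>\<^bsub>A\<^esub>"
  and list_mult_Cons [simp]: "list_mult A (x # xs) = x \<otimes>\<^bsub>A\<^esub> list_mult A xs"
  by (simp_all add: list_mult_def)

text \<open>The scalars form a whole type, so algebras over the field and algebras over its power
  series ring are instances of one locale.\<close>

locale assoc_algebra = ring A for A :: "('k::comm_ring_1, 'a) module" (structure) +
  assumes smult_closed [simp, intro]: "x \<in> carrier A \<Longrightarrow> c \<odot> x \<in> carrier A"
    and smult_l_distr: "x \<in> carrier A \<Longrightarrow> (c + d) \<odot> x = c \<odot> x \<oplus> d \<odot> x"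
    and smult_r_distr: "x \<in> carrier A \<Longrightarrow> y \<in> carrier A \<Longrightarrow> c \<odot> (x \<oplus> y) = c \<odot> x \<oplus> c \<odot> y"
    and smult_smult: "x \<in> carrier A \<Longrightarrow> c \<odot> (d \<odot> x) = (c * d) \<odot> x"
    and smult_one [simp]: "x \<in> carrier A \<Longrightarrow> 1 \<odot> x = x"
    and smult_mult_l: "x \<in> carrier A \<Longrightarrow> y \<in> carrier A \<Longrightarrow> (c \<odot> x) \<otimes> y = c \<odot> (x \<otimes> y)"
    and smult_mult_r: "x \<in> carrier A \<Longrightarrow> y \<in> carrier A \<Longrightarrow> x \<otimes> (c \<odot> y) = c \<odot> (x \<otimes> y)"
begin

lemma smult_0 [simp]: "x \<in> carrier A \<Longrightarrow> 0 \<odot> x = \<zero>"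
  using smult_l_distr[of x 0 0] by (metis add.l_cancel_one add_0 smult_closed)

lemma smult_zero [simp]: "c \<odot> \<zero> = \<zero>"
  using smult_r_distr[of \<zero> \<zero> c] by (metis add.l_cancel_one r_zero smult_closed zero_closed)

lemma smult_a_inv: "x \<in> carrier A \<Longrightarrow> c \<odot> (\<ominus> x) = \<ominus> (c \<odot> x)"
  using smult_r_distr[of x "\<ominus> x" c] 
  by (metis a_inv_closed add.inv_equality l_neg smult_closed smult_r_distr smult_zero)

lemma smult_diff: "x \<in> carrier A \<Longrightarrow> y \<in> carrier A \<Longrightarrow> c \<odot> (x \<ominus> y) = c \<odot> x \<ominus> c \<odot> y"
  by (simp add: minus_eq smult_r_distr smult_a_inv)

lemma smult_sum_left: "finite I \<Longrightarrow> x \<in> carrier A \<Longrightarrow> sum f I \<odot> x = (\<Oplus>i\<in>I. f i \<odot> x)"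
  by (induction I rule: finite_induct) (auto simp: smult_l_distr)

lemma smult_finsum:
  assumes "f \<in> I \<rightarrow> carrier A"
  shows "c \<odot> (\<Oplus>i\<in>I. f i) = (\<Oplus>i\<in>I. c \<odot> f i)"
  using assms by (induction I rule: infinite_finite_induct) (auto simp: smult_r_distr Pi_iff)

lemma list_mult_closed [simp, intro]: "set xs \<subseteq> carrier A \<Longrightarrow> list_mult A xs \<in> carrier A"
  by (induction xs) auto

lemma list_mult_append:
  "set xs \<subseteq> carrier A \<Longrightarrow> set ys \<subseteq> carrier A \<Longrightarrow>
     list_mult A (xs @ ys) = list_mult A xs \<otimes> list_mult A ys"
  by (induction xs) (auto simp: m_assoc)

lemma commutator_closed [simp, intro]:
  "x \<in> carrier A \<Longrightarrow> y \<in> carrier A \<Longrightarrow> commutator A x y \<in> carrier A"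
  by (simp add: commutator_def)

end

lemma (in abelian_group) minus_eq_zero_iff:
  "x \<in> carrier G \<Longrightarrow> y \<in> carrier G \<Longrightarrow> x \<ominus> y = \<zero> \<longleftrightarrow> x = y"
  by (metis a_inv_closed add.inv_equality minus_eq minus_minus r_neg)

lemma (in abelian_group) add_minus_cancel:
  "x \<in> carrier G \<Longrightarrow> y \<in> carrier G \<Longrightarrow> y \<oplus> (x \<ominus> y) = x"
  by (simp add: minus_eq a_ac r_neg2 r_neg1 r_neg)

lemma linear_mapsI:
  assumes "\<And>x. x \<in> carrier A \<Longrightarrow> \<phi> x \<in> carrier B"
    and "\<And>x y. x \<in> carrier A \<Longrightarrow> y \<in> carrier A \<Longrightarrow> \<phi> (x \<oplus>\<^bsub>A\<^esub> y) = \<phi> x \<oplus>\<^bsub>B\<^esub> \<phi> y"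
    and "\<And>c x. x \<in> carrier A \<Longrightarrow> \<phi> (c \<odot>\<^bsub>A\<^esub> x) = c \<odot>\<^bsub>B\<^esub> \<phi> x"
  shows "\<phi> \<in> linear_maps A B"
  using assms by (auto simp: linear_maps_def)

lemma linear_maps_comp:
  "\<phi> \<in> linear_maps A B \<Longrightarrow> \<psi> \<in> linear_maps B C \<Longrightarrow> (\<lambda>x. \<psi> (\<phi> x)) \<in> linear_maps A C"
  by (auto simp: linear_maps_def Pi_iff)

locale linear_map = A: assoc_algebra A + B: assoc_algebra B
  for A :: "('k::comm_ring_1, 'a) module" and B :: "('k, 'b) module" +
  fixes \<phi> :: "'a \<Rightarrow> 'b"
  assumes linear: "\<phi> \<in> linear_maps A B"
begin

lemma closed [simp, intro]: "x \<in> carrier A \<Longrightarrow> \<phi> x \<in> carrier B"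
  using linear by (auto simp: linear_maps_def)

lemma add: "x \<in> carrier A \<Longrightarrow> y \<in> carrier A \<Longrightarrow> \<phi> (x \<oplus>\<^bsub>A\<^esub> y) = \<phi> x \<oplus>\<^bsub>B\<^esub> \<phi> y"
  using linear by (auto simp: linear_maps_def)

lemma smult: "x \<in> carrier A \<Longrightarrow> \<phi> (c \<odot>\<^bsub>A\<^esub> x) = c \<odot>\<^bsub>B\<^esub> \<phi> x"
  using linear by (auto simp: linear_maps_def)

lemma zero [simp]: "\<phi> \<zero>\<^bsub>A\<^esub> = \<zero>\<^bsub>B\<^esub>"
  using smult[of "\<zero>\<^bsub>A\<^esub>" 0] by simp

lemma a_inv: "x \<in> carrier A \<Longrightarrow> \<phi> (\<ominus>\<^bsub>A\<^esub> x) = \<ominus>\<^bsub>B\<^esub> \<phi> x"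
  by (metis A.add.inv_closed A.l_neg B.add.inv_equality add closed zero)

lemma diff: "x \<in> carrier A \<Longrightarrow> y \<in> carrier A \<Longrightarrow> \<phi> (x \<ominus>\<^bsub>A\<^esub> y) = \<phi> x \<ominus>\<^bsub>B\<^esub> \<phi> y"
  by (simp add: A.minus_eq B.minus_eq add a_inv)

lemma finsum:
  assumes "f \<in> I \<rightarrow> carrier A"
  shows "\<phi> (finsum A f I) = (\<Oplus>\<^bsub>B\<^esub>i\<in>I. \<phi> (f i))"
  using assms by (induction I rule: infinite_finite_induct) (auto simp: add Pi_iff)

end

text \<open>The series algebras and the \<open>\<star>\<close>-algebras differ only in multiplication and unit.\<close>

lemma linear_maps_cong:
  assumes "carrier B = carrier B'" "add B = add B'" "module.smult B = module.smult B'"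
  shows "linear_maps A B = linear_maps A B'" "linear_maps B A = linear_maps B' A"
  using assms by (auto simp: linear_maps_def)

section \<open>Quotients\<close>

lemma alg_quot_sel:
  "carrier (alg_quot A I) = a_rcosets\<^bsub>A\<^esub> I"
  "monoid.mult (alg_quot A I) = rcoset_mult A I"
  "one (alg_quot A I) = I +>\<^bsub>A\<^esub> \<one>\<^bsub>A\<^esub>"
  "zero (alg_quot A I) = I"
  "add (alg_quot A I) = set_add A"
  "module.smult (alg_quot A I) = (\<lambda>c X. \<Union>x\<in>X. I +>\<^bsub>A\<^esub> (c \<odot>\<^bsub>A\<^esub> x))"
  by (simp_all add: alg_quot_def FactRing_def ring.defs module.defs)

locale algebra_ideal = assoc_algebra A + ideal I A for A :: "('k::comm_ring_1, 'a) module" (structure) and I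
begin

text \<open>In a unital algebra c x = (c 1) x, so a ring ideal is automatically a submodule and the
  quotient inherits the scalar action.\<close>

lemma smult_ideal: "x \<in> I \<Longrightarrow> c \<odot> x \<in> I"
  by (metis I_l_closed a_Hcarr l_one one_closed smult_closed smult_mult_l)

lemma mem_coset_iff: "x \<in> carrier A \<Longrightarrow> y \<in> carrier A \<Longrightarrow> y \<in> I +> x \<longleftrightarrow> y \<ominus> x \<in> I"
  using a_rcos_module_minus[OF ring_axioms] by simp

lemma coset_eq_iff: "x \<in> carrier A \<Longrightarrow> y \<in> carrier A \<Longrightarrow> I +> x = I +> y \<longleftrightarrow> x \<ominus> y \<in> I"
  by (metis a_rcos_self a_repr_independence' mem_coset_iff)

lemma coset_closed: "x \<in> carrier A \<Longrightarrow> I +> x \<in> carrier (alg_quot A I)"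
  by (simp add: alg_quot_sel a_rcosetsI[OF a_subset])

lemma coset_cases:
  assumes "X \<in> carrier (alg_quot A I)"
  obtains x where "x \<in> carrier A" "X = I +> x"
  using assms by (auto simp: alg_quot_sel A_RCOSETS_def' a_r_coset_def')

lemma coset_add: "x \<in> carrier A \<Longrightarrow> y \<in> carrier A \<Longrightarrow>
    (I +> x) \<oplus>\<^bsub>alg_quot A I\<^esub> (I +> y) = I +> (x \<oplus> y)"
  by (simp add: alg_quot_sel a_rcos_sum)

lemma coset_mult: "x \<in> carrier A \<Longrightarrow> y \<in> carrier A \<Longrightarrow>
    (I +> x) \<otimes>\<^bsub>alg_quot A I\<^esub> (I +> y) = I +> (x \<otimes> y)"
  by (simp add: alg_quot_sel rcoset_mult_add)

lemma coset_one: "\<one>\<^bsub>alg_quot A I\<^esub> = I +> \<one>"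
  by (simp add: alg_quot_sel)

lemma coset_zero: "\<zero>\<^bsub>alg_quot A I\<^esub> = I +> \<zero>"
  by (simp add: alg_quot_sel a_coset_add_zero a_subset)

lemma coset_smult:
  assumes "x \<in> carrier A"
  shows "c \<odot>\<^bsub>alg_quot A I\<^esub> (I +> x) = I +> (c \<odot> x)"
proof -
  have "I +> (c \<odot> y) = I +> (c \<odot> x)" if "y \<in> I +> x" for y
  proof -
    have y: "y \<in> carrier A" using that assms a_r_coset_subset_G a_subset by blast
    then have "y \<ominus> x \<in> I" using that assms mem_coset_iff by simp
    then have "c \<odot> y \<ominus> c \<odot> x \<in> I"
      using smult_ideal[of "y \<ominus> x" c] y assms by (simp add: smult_diff)
    then show ?thesis using y assms coset_eq_iff by simp
  qed
  moreover have "x \<in> I +> x" using assms a_rcos_self by simp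
  ultimately have "(\<Union>y\<in>I +> x. I +> (c \<odot> y)) = I +> (c \<odot> x)" by blast
  then show ?thesis by (simp add: alg_quot_sel)
qed

lemmas coset_simps = coset_add coset_mult coset_one coset_zero coset_smult

lemma algebra_alg_quot: "assoc_algebra (alg_quot A I)"
proof -
  have "ring (alg_quot A I)"
  proof (rule ringI)
    show "abelian_group (alg_quot A I)"
    proof (rule abelian_groupI)
      fix X assume "X \<in> carrier (alg_quot A I)"
      then obtain x where x: "x \<in> carrier A" "X = I +> x" by (rule coset_cases)
      then show "\<exists>Y\<in>carrier (alg_quot A I). Y \<oplus>\<^bsub>alg_quot A I\<^esub> X = \<zero>\<^bsub>alg_quot A I\<^esub>"
        by (intro bexI[of _ "I +> \<ominus> x"]) (auto simp: coset_simps l_neg coset_closed)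
    qed (auto elim!: coset_cases simp: coset_simps coset_closed a_ac)
    show "monoid (alg_quot A I)"
      by (rule monoidI) (auto elim!: coset_cases simp: coset_simps coset_closed m_assoc)
  qed (auto elim!: coset_cases simp: coset_simps l_distr r_distr)
  then show ?thesis
    by (intro assoc_algebra.intro assoc_algebra_axioms.intro)
       (auto elim!: coset_cases simp: coset_simps coset_closed smult_l_distr smult_r_distr smult_smult
          smult_mult_l smult_mult_r)
qed

lemma coset_linear: "(\<lambda>x. I +> x) \<in> linear_maps A (alg_quot A I)"
  by (intro linear_mapsI) (auto simp: coset_closed coset_simps)

lemma linear_map_factors:
  assumes B: "assoc_algebra B" and \<phi>: "\<phi> \<in> linear_maps A B"
    and I: "\<And>x. x \<in> I \<Longrightarrow> \<phi> x = \<zero>\<^bsub>B\<^esub>"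
  obtains \<psi> where "\<psi> \<in> linear_maps (alg_quot A I) B" "\<And>x. x \<in> carrier A \<Longrightarrow> \<psi> (I +> x) = \<phi> x"
proof -
  interpret \<phi>: linear_map A B \<phi>
    using B \<phi> assoc_algebra_axioms by (intro linear_map.intro linear_map_axioms.intro)
  \<comment> \<open>Any representative will do: two of them differ by an element of I, on which
    \<phi> vanishes.\<close>
  define \<psi> where "\<psi> X = \<phi> (SOME x. x \<in> X)" for X
  have \<psi>: "\<psi> (I +> x) = \<phi> x" if x: "x \<in> carrier A" for x
  proof -
    define y where "y = (SOME y. y \<in> I +> x)"
    have "y \<in> I +> x" unfolding y_def using a_rcos_self[OF x] by (rule someI)
    then have "y \<in> carrier A" "y \<ominus> x \<in> I"
      using x a_r_coset_subset_G a_subset mem_coset_iff by blast+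
    then have "\<phi> y = \<phi> x"
      using I[of "y \<ominus> x"] \<phi>.diff[of y x] x \<phi>.B.minus_eq_zero_iff by auto
    then show ?thesis by (simp add: \<psi>_def y_def)
  qed
  moreover have "\<psi> \<in> linear_maps (alg_quot A I) B"
    by (intro linear_mapsI) (auto elim!: coset_cases simp: coset_simps \<psi> \<phi>.add \<phi>.smult)
  ultimately show thesis using that by blast
qed

end

section \<open>Monoid algebras\<close>

lemma monoid_algebra_sel [simp]:
  "carrier monoid_algebra = UNIV" "monoid.mult monoid_algebra = (*)"
  "one monoid_algebra = 1" "zero monoid_algebra = 0" "add monoid_algebra = (+)"
  "module.smult monoid_algebra = (\<lambda>c p. Poly_Mapping.single 0 c * p)"
  by (simp_all add: monoid_algebra_def)

lemma poly_mapping_induct [case_names zero add]: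
  fixes p :: "'m \<Rightarrow>\<^sub>0 'a::monoid_add"
  assumes "P 0" and "\<And>m c p. P p \<Longrightarrow> P (Poly_Mapping.single m c + p)"
  shows "P p"
proof (induction p rule: Poly_Mapping.update_induct)
  case (update p m c)
  have "Poly_Mapping.update m c p = Poly_Mapping.single m c + p"
    using update(1) by (intro poly_mapping_eqI)
      (auto simp: lookup_update lookup_add lookup_single in_keys_iff when_def)
  then show ?case using update assms(2) by simp
qed (use assms in simp)

text \<open>Scalars act as left multiplication by \<open>single 0 c\<close>. Centrality of these
  elements is what lets scalars move past a left factor although words do not commute.\<close>

lemma single_0_commute:
  fixes p :: "'m::monoid_add \<Rightarrow>\<^sub>0 'f::comm_semiring_1"
  shows "Poly_Mapping.single 0 c * p = p * Poly_Mapping.single 0 c"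
  by (induction p rule: poly_mapping_induct) (auto simp: algebra_simps mult_single)

lemma ring_monoid_algebra: "ring (monoid_algebra :: ('f::field, 'm::monoid_add \<Rightarrow>\<^sub>0 'f) module)"
proof (rule ringI)
  show "abelian_group (monoid_algebra :: ('f, 'm \<Rightarrow>\<^sub>0 'f) module)"
    by (rule abelian_groupI) (auto simp: algebra_simps intro: exI[of _ "- _"])
  show "monoid (monoid_algebra :: ('f, 'm \<Rightarrow>\<^sub>0 'f) module)"
    by (rule monoidI) (auto simp: algebra_simps)
qed (auto simp: algebra_simps)

lemma algebra_monoid_algebra:
  "assoc_algebra (monoid_algebra :: ('f::field, 'm::monoid_add \<Rightarrow>\<^sub>0 'f) module)"
proof -
  have "x * (Poly_Mapping.single 0 c * y) = Poly_Mapping.single 0 c * (x * y)"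
    for x y :: "'m \<Rightarrow>\<^sub>0 'f" and c
    by (metis mult.assoc single_0_commute)
  then show ?thesis
    by (intro assoc_algebra.intro assoc_algebra_axioms.intro ring_monoid_algebra)
       (auto simp: algebra_simps single_add mult_single simp flip: mult.assoc)
qed

global_interpretation monoid_algebra: assoc_algebra "monoid_algebra :: ('f::field, 'm::monoid_add \<Rightarrow>\<^sub>0 'f) module"
  by (rule algebra_monoid_algebra)

lemma monoid_algebra_a_inv [simp]: "\<ominus>\<^bsub>monoid_algebra\<^esub> p = - (p :: 'm::monoid_add \<Rightarrow>\<^sub>0 'f::field)"
  using monoid_algebra.minus_equality[of "- p" p] by simp

lemma monoid_algebra_minus [simp]: "p \<ominus>\<^bsub>monoid_algebra\<^esub> q = p - (q :: 'm::monoid_add \<Rightarrow>\<^sub>0 'f::field)"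
  by (simp add: monoid_algebra.minus_eq)

definition monomial_ext :: "('f::field, 'b) module \<Rightarrow> ('m::monoid_add \<Rightarrow> 'b) \<Rightarrow> ('m \<Rightarrow>\<^sub>0 'f) \<Rightarrow> 'b" where
  "monomial_ext B f p = (\<Oplus>\<^bsub>B\<^esub>m\<in>Poly_Mapping.keys p. Poly_Mapping.lookup p m \<odot>\<^bsub>B\<^esub> f m)"

lemma monomial_ext_superset:
  assumes "assoc_algebra B" "finite M" "Poly_Mapping.keys p \<subseteq> M" "range f \<subseteq> carrier B"
  shows "monomial_ext B f p = (\<Oplus>\<^bsub>B\<^esub>m\<in>M. Poly_Mapping.lookup p m \<odot>\<^bsub>B\<^esub> f m)"
proof -
  interpret B: assoc_algebra B by fact
  show ?thesis
    unfolding monomial_ext_def using assms(2-)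
    by (intro B.add.finprod_mono_neutral_cong_left) (auto simp: in_keys_iff image_subset_iff)
qed

lemma monomial_ext_linear:
  fixes B :: "('f::field, 'b) module" and f :: "'m::monoid_add \<Rightarrow> 'b"
  assumes B: "assoc_algebra B" and f: "range f \<subseteq> carrier B"
  shows "monomial_ext B f \<in> linear_maps monoid_algebra B"
proof -
  interpret B: assoc_algebra B by fact
  note [simp] = subsetD[OF f, OF rangeI]
  show ?thesis
  proof (intro linear_mapsI)
    fix p q :: "'m \<Rightarrow>\<^sub>0 'f"
    let ?M = "Poly_Mapping.keys p \<union> Poly_Mapping.keys q"
    show "monomial_ext B f p \<in> carrier B" by (simp add: monomial_ext_def)
    have "monomial_ext B f (p + q) = (\<Oplus>\<^bsub>B\<^esub>m\<in>?M. Poly_Mapping.lookup (p + q) m \<odot>\<^bsub>B\<^esub> f m)"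
      using Poly_Mapping.keys_add[of p q] f by (intro monomial_ext_superset[OF B]) auto
    also have "\<dots> = monomial_ext B f p \<oplus>\<^bsub>B\<^esub> monomial_ext B f q"
      using f by (simp add: monomial_ext_superset[OF B, where M = ?M] lookup_add B.smult_l_distr)
    finally show "monomial_ext B f (p \<oplus>\<^bsub>monoid_algebra\<^esub> q) = monomial_ext B f p \<oplus>\<^bsub>B\<^esub> monomial_ext B f q"
      by simp
  next
    fix c and p :: "'m \<Rightarrow>\<^sub>0 'f"
    have l: "Poly_Mapping.lookup (Poly_Mapping.single 0 c * p) m = c * Poly_Mapping.lookup p m" for m
      by (induction p rule: poly_mapping_induct)
         (auto simp: algebra_simps mult_single lookup_add lookup_single when_def)
    have "monomial_ext B f (Poly_Mapping.single 0 c * p) =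
        (\<Oplus>\<^bsub>B\<^esub>m\<in>Poly_Mapping.keys p. Poly_Mapping.lookup (Poly_Mapping.single 0 c * p) m \<odot>\<^bsub>B\<^esub> f m)"
      using f by (intro monomial_ext_superset[OF B]) (auto simp: in_keys_iff l)
    also have "\<dots> = c \<odot>\<^bsub>B\<^esub> monomial_ext B f p"
      by (simp add: l monomial_ext_def B.smult_finsum B.smult_smult)
    finally show "monomial_ext B f (c \<odot>\<^bsub>monoid_algebra\<^esub> p) = c \<odot>\<^bsub>B\<^esub> monomial_ext B f p" by simp
  qed
qed

lemma monomial_ext_single:
  assumes "assoc_algebra B" "range f \<subseteq> carrier B"
  shows "monomial_ext B f (Poly_Mapping.single m c) = c \<odot>\<^bsub>B\<^esub> f m"
proof -
  interpret B: assoc_algebra B by fact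
  note [simp] = subsetD[OF assms(2), OF rangeI]
  show ?thesis
    using monomial_ext_superset[OF assms(1) _ _ assms(2), of "{m}" "Poly_Mapping.single m c"] by simp
qed

lemma monoid_algebra_linear_eqI:
  assumes B: "assoc_algebra B" and "\<phi> \<in> linear_maps monoid_algebra B" "\<psi> \<in> linear_maps monoid_algebra B"
    and eq: "\<And>m. \<phi> (Poly_Mapping.single m 1) = \<psi> (Poly_Mapping.single m 1)"
  shows "\<phi> p = \<psi> p"
proof -
  interpret \<phi>: linear_map monoid_algebra B \<phi>
    using assms algebra_monoid_algebra by (intro linear_map.intro linear_map_axioms.intro)
  interpret \<psi>: linear_map monoid_algebra B \<psi>
    using assms algebra_monoid_algebra by (intro linear_map.intro linear_map_axioms.intro)
  have "\<phi> (Poly_Mapping.single m c) = \<psi> (Poly_Mapping.single m c)" for m c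
    using \<phi>.smult[of "Poly_Mapping.single m 1" c] \<psi>.smult[of "Poly_Mapping.single m 1" c] eq[of m]
    by (simp add: mult_single)
  then show ?thesis
    using \<phi>.add \<psi>.add \<phi>.zero \<psi>.zero by (induction p rule: poly_mapping_induct) auto
qed

section \<open>Linear maps out of the tensor and the symmetric algebra\<close>

text \<open>The letter map \<open>l\<close> is \<open>\<lambda>x. [x]\<close> for T(V) and
  \<open>\<lambda>x. {#x#}\<close> for S(V), so that the universal property is proved once for
  both.\<close>

definition free_quot ::
  "('f::field \<Rightarrow> 'v::ab_group_add \<Rightarrow> 'v) \<Rightarrow> ('v \<Rightarrow> 'm::monoid_add) \<Rightarrow> ('f, ('m \<Rightarrow>\<^sub>0 'f) set) module" where
  "free_quot scale l = alg_quot monoid_algebra (linearity_ideal scale l)"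

definition monomial_class ::
  "('f::field \<Rightarrow> 'v::ab_group_add \<Rightarrow> 'v) \<Rightarrow> ('v \<Rightarrow> 'm::monoid_add) \<Rightarrow> 'm \<Rightarrow> ('m \<Rightarrow>\<^sub>0 'f) set" where
  "monomial_class scale l m = linearity_ideal scale l
     +>\<^bsub>monoid_algebra :: ('f, 'm \<Rightarrow>\<^sub>0 'f) module\<^esub> Poly_Mapping.single m 1"

lemma algebra_ideal_linearity:
  "algebra_ideal (monoid_algebra :: ('f::field, 'm::monoid_add \<Rightarrow>\<^sub>0 'f) module) (linearity_ideal scale l)"
  unfolding linearity_ideal_def
  by (intro algebra_ideal.intro algebra_monoid_algebra monoid_algebra.genideal_ideal) simp

lemma algebra_free_quot: "assoc_algebra (free_quot scale l)"
  unfolding free_quot_def by (rule algebra_ideal.algebra_alg_quot[OF algebra_ideal_linearity])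

context
  fixes scale :: "'f::field \<Rightarrow> 'v::ab_group_add \<Rightarrow> 'v" and l :: "'v \<Rightarrow> 'm::monoid_add"
begin

interpretation L: algebra_ideal monoid_algebra "linearity_ideal scale l"
  by (rule algebra_ideal_linearity)

lemma monomial_class_closed [simp, intro]: "monomial_class scale l m \<in> carrier (free_quot scale l)"
  by (simp add: monomial_class_def free_quot_def L.coset_closed)

lemma monomial_class_mult:
  "monomial_class scale l m \<otimes>\<^bsub>free_quot scale l\<^esub> monomial_class scale l n = monomial_class scale l (m + n)"
  by (simp add: monomial_class_def free_quot_def L.coset_simps mult_single)

lemma monomial_class_zero: "monomial_class scale l 0 = \<one>\<^bsub>free_quot scale l\<^esub>"
  by (simp add: monomial_class_def free_quot_def L.coset_simps)

lemma linearity_relations_subset: "linearity_relations scale l \<subseteq> linearity_ideal scale l"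
  unfolding linearity_ideal_def by (rule monoid_algebra.genideal_self) simp

lemma monomial_class_add:
  "monomial_class scale l (l (x + y)) =
     monomial_class scale l (l x) \<oplus>\<^bsub>free_quot scale l\<^esub> monomial_class scale l (l y)"
proof -
  have "Poly_Mapping.single (l (x + y)) 1 - (Poly_Mapping.single (l x) 1 + Poly_Mapping.single (l y) 1)
      \<in> linearity_ideal scale l"
    using linearity_relations_subset
    by (force simp: linearity_relations_def algebra_simps)
  then show ?thesis
    by (simp add: monomial_class_def free_quot_def L.coset_simps L.coset_eq_iff)
qed

lemma monomial_class_smult:
  "monomial_class scale l (l (scale c x)) = c \<odot>\<^bsub>free_quot scale l\<^esub> monomial_class scale l (l x)"
proof -
  have "Poly_Mapping.single (l (scale c x)) 1 - Poly_Mapping.single (l x) c \<in> linearity_ideal scale l"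
    using linearity_relations_subset by (force simp: linearity_relations_def)
  then show ?thesis
    by (simp add: monomial_class_def free_quot_def L.coset_simps L.coset_eq_iff mult_single)
qed

lemma free_quot_linear_eqI:
  assumes B: "assoc_algebra B" and \<phi>: "\<phi> \<in> linear_maps (free_quot scale l) B"
    and \<psi>: "\<psi> \<in> linear_maps (free_quot scale l) B"
    and eq: "\<And>m. \<phi> (monomial_class scale l m) = \<psi> (monomial_class scale l m)"
    and t: "t \<in> carrier (free_quot scale l)"
  shows "\<phi> t = \<psi> t"
proof -
  obtain p where p: "t = linearity_ideal scale l +>\<^bsub>monoid_algebra :: ('f, 'm \<Rightarrow>\<^sub>0 'f) module\<^esub> p"
    using t unfolding free_quot_def by (rule L.coset_cases)
  have "(\<lambda>p. \<phi> (linearity_ideal scale l +>\<^bsub>monoid_algebra :: ('f, 'm \<Rightarrow>\<^sub>0 'f) module\<^esub> p)) p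
      = (\<lambda>p. \<psi> (linearity_ideal scale l +>\<^bsub>monoid_algebra :: ('f, 'm \<Rightarrow>\<^sub>0 'f) module\<^esub> p)) p"
    using linear_maps_comp[OF L.coset_linear \<phi>[unfolded free_quot_def]]
      linear_maps_comp[OF L.coset_linear \<psi>[unfolded free_quot_def]]
    by (rule monoid_algebra_linear_eqI[OF B]) (use eq in \<open>simp add: monomial_class_def\<close>)
  then show ?thesis by (simp add: p)
qed

text \<open>Only a linear map is produced, and f need not be multiplicative; what is required is
  linearity in each single letter of a monomial. This covers products of letters on T(V) as well as
  averages over all orders on S(V).\<close>

lemma free_quot_linear_ext:
  assumes B: "assoc_algebra B" and f: "range f \<subseteq> carrier B"
    and f_add: "\<And>m n x y. f (m + l (x + y) + n) = f (m + l x + n) \<oplus>\<^bsub>B\<^esub> f (m + l y + n)"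
    and f_smult: "\<And>m n c x. f (m + l (scale c x) + n) = c \<odot>\<^bsub>B\<^esub> f (m + l x + n)"
  obtains \<psi> where "\<psi> \<in> linear_maps (free_quot scale l) B" "\<And>m. \<psi> (monomial_class scale l m) = f m"
proof -
  note [simp] = subsetD[OF f, OF rangeI]
  define \<phi> where "\<phi> = monomial_ext B f"
  have \<phi>: "\<phi> \<in> linear_maps monoid_algebra B"
    unfolding \<phi>_def using B f by (rule monomial_ext_linear)
  interpret \<phi>: linear_map monoid_algebra B \<phi>
    using B \<phi> algebra_monoid_algebra by (intro linear_map.intro linear_map_axioms.intro)
  have \<phi>_simps: "\<phi> 0 = \<zero>\<^bsub>B\<^esub>" "\<phi> (p + q) = \<phi> p \<oplus>\<^bsub>B\<^esub> \<phi> q" "\<phi> (p - q) = \<phi> p \<ominus>\<^bsub>B\<^esub> \<phi> q"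
     "\<phi> p \<in> carrier B" "\<phi> (- p) = \<ominus>\<^bsub>B\<^esub> \<phi> p" for p q
    using \<phi>.zero \<phi>.add[of p q] \<phi>.diff[of p q] \<phi>.closed[of p] \<phi>.a_inv[of p] by auto
  have \<phi>_single: "\<phi> (Poly_Mapping.single m c) = c \<odot>\<^bsub>B\<^esub> f m" for m c
    unfolding \<phi>_def using B f by (rule monomial_ext_single)
  \<comment> \<open>As \<phi> is not multiplicative, its kernel need not be an ideal. Z is the
    largest two-sided ideal inside the kernel, so it is enough to put the linearity relations into
    Z.\<close>
  define Z where "Z = {p. \<forall>a b. \<phi> (a * p * b) = \<zero>\<^bsub>B\<^esub>}"
  \<comment> \<open>By additivity of \<phi> the outer factors may be taken to be monomials, where
    the hypotheses on f apply directly.\<close>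
  have Z_induct: "r \<in> Z"
    if "\<And>m c n d. \<phi> (Poly_Mapping.single m c * r * Poly_Mapping.single n d) = \<zero>\<^bsub>B\<^esub>" for r
  proof -
    have "\<phi> (a * r * Poly_Mapping.single n d) = \<zero>\<^bsub>B\<^esub>" for a n d
      by (induction a rule: poly_mapping_induct) (auto simp: \<phi>_simps that distrib_right)
    then have "\<phi> (a * r * b) = \<zero>\<^bsub>B\<^esub>" for a b
      by (induction b rule: poly_mapping_induct) (auto simp: \<phi>_simps distrib_left)
    then show ?thesis by (simp add: Z_def)
  qed
  have "ideal Z monoid_algebra"
  proof (rule idealI)
    show "subgroup Z (add_monoid monoid_algebra)"
    proof (rule monoid_algebra.add.subgroupI)
      show "\<ominus>\<^bsub>monoid_algebra\<^esub> p \<in> Z" if "p \<in> Z" for p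
        using that by (simp add: Z_def \<phi>_simps)
    qed (auto simp: Z_def \<phi>_simps distrib_left distrib_right intro: exI[of _ 0])
  qed (auto simp: Z_def ring_monoid_algebra simp flip: mult.assoc, auto simp: mult.assoc)
  moreover have "linearity_relations scale l \<subseteq> Z"
  proof -
    have "Poly_Mapping.single (l (x + y)) 1 - Poly_Mapping.single (l x) 1 - Poly_Mapping.single (l y) 1 \<in> Z"
      for x y
      by (rule Z_induct)
         (simp add: algebra_simps mult_single \<phi>_simps \<phi>_single f_add[unfolded add.assoc]
            \<phi>.B.smult_r_distr, simp add: \<phi>.B.minus_eq \<phi>.B.minus_add \<phi>.B.r_neg \<phi>.B.a_ac)
    moreover have "Poly_Mapping.single (l (scale c x)) 1 - Poly_Mapping.single (l x) c \<in> Z" for c x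
      by (rule Z_induct)
         (simp add: algebra_simps mult_single \<phi>_simps \<phi>_single f_smult[unfolded add.assoc]
            \<phi>.B.smult_smult \<phi>.B.minus_eq \<phi>.B.r_neg)
    ultimately show ?thesis by (auto simp: linearity_relations_def)
  qed
  ultimately have "linearity_ideal scale l \<subseteq> Z"
    unfolding linearity_ideal_def by (rule monoid_algebra.genideal_minimal)
  moreover have "\<phi> p = \<zero>\<^bsub>B\<^esub>" if "p \<in> Z" for p
    using that mult_1_left mult_1_right unfolding Z_def by (metis (mono_tags, lifting) mem_Collect_eq)
  ultimately have "\<phi> p = \<zero>\<^bsub>B\<^esub>" if "p \<in> linearity_ideal scale l" for p
    using that by blast
  then show thesis
  proof (rule L.linear_map_factors[OF B \<phi>])
    fix \<psi> assume "\<psi> \<in> linear_maps (alg_quot monoid_algebra (linearity_ideal scale l)) B"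
      "\<And>p. p \<in> carrier monoid_algebra \<Longrightarrow>
        \<psi> (linearity_ideal scale l +>\<^bsub>monoid_algebra :: ('f, 'm \<Rightarrow>\<^sub>0 'f) module\<^esub> p) = \<phi> p"
    then show thesis
      by (intro that[of \<psi>]) (simp_all add: free_quot_def monomial_class_def \<phi>_single)
  qed
qed

end

lemma tensor_alg_eq: "tensor_alg scale = free_quot scale (\<lambda>x. [x])"
  and sym_alg_eq: "sym_alg scale = free_quot scale (\<lambda>x. {#x#})"
  and tensor_incl_eq: "tensor_incl scale x = monomial_class scale (\<lambda>x. [x]) [x]"
  and sym_incl_eq: "sym_incl scale x = monomial_class scale (\<lambda>x. {#x#}) {#x#}"
  by (simp_all add: tensor_alg_def sym_alg_def free_quot_def tensor_incl_def sym_incl_def monomial_class_def)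

lemma algebra_tensor_alg: "assoc_algebra (tensor_alg scale)"
  and algebra_sym_alg: "assoc_algebra (sym_alg scale)"
  by (simp_all add: tensor_alg_eq sym_alg_eq algebra_free_quot)

lemma tensor_incl_closed [simp, intro]: "tensor_incl scale x \<in> carrier (tensor_alg scale)"
  and sym_incl_closed [simp, intro]: "sym_incl scale x \<in> carrier (sym_alg scale)"
  by (simp_all add: tensor_alg_eq sym_alg_eq tensor_incl_eq sym_incl_eq)

lemma tensor_incl_add: "tensor_incl scale (x + y) = tensor_incl scale x \<oplus>\<^bsub>tensor_alg scale\<^esub> tensor_incl scale y"
  and tensor_incl_smult: "tensor_incl scale (scale c x) = c \<odot>\<^bsub>tensor_alg scale\<^esub> tensor_incl scale x"
  and sym_incl_add: "sym_incl scale (x + y) = sym_incl scale x \<oplus>\<^bsub>sym_alg scale\<^esub> sym_incl scale y"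
  and sym_incl_smult: "sym_incl scale (scale c x) = c \<odot>\<^bsub>sym_alg scale\<^esub> sym_incl scale x"
  using monomial_class_add[of scale "\<lambda>x. [x]"] monomial_class_smult[of scale "\<lambda>x. [x]"]
    monomial_class_add[of scale "\<lambda>x. {#x#}"] monomial_class_smult[of scale "\<lambda>x. {#x#}"]
  by (simp_all add: tensor_alg_eq sym_alg_eq tensor_incl_eq sym_incl_eq)

abbreviation tensor_word where
  "tensor_word scale as \<equiv> list_mult (tensor_alg scale) (map (tensor_incl scale) as)"

abbreviation sym_word where
  "sym_word scale as \<equiv> list_mult (sym_alg scale) (map (sym_incl scale) as)"

lemma tensor_word_eq: "tensor_word scale as = monomial_class scale (\<lambda>x. [x]) as"
proof -
  interpret assoc_algebra "tensor_alg scale" by (rule algebra_tensor_alg)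
  show ?thesis
    by (induction as)
       (use monomial_class_zero[of scale "\<lambda>x. [x]"] in
         \<open>simp_all add: tensor_alg_eq tensor_incl_eq monomial_class_mult zero_list_def plus_list_def\<close>)
qed

lemma sym_word_eq: "sym_word scale as = monomial_class scale (\<lambda>x. {#x#}) (mset as)"
proof -
  interpret assoc_algebra "sym_alg scale" by (rule algebra_sym_alg)
  show ?thesis
    by (induction as)
       (use monomial_class_zero[of scale "\<lambda>x. {#x#}"] in
         \<open>simp_all add: sym_alg_eq sym_incl_eq monomial_class_mult\<close>)
qed

lemma tensor_linear_eqI:
  assumes "assoc_algebra B" "\<phi> \<in> linear_maps (tensor_alg scale) B" "\<psi> \<in> linear_maps (tensor_alg scale) B"
    and "\<And>as. \<phi> (tensor_word scale as) = \<psi> (tensor_word scale as)"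
    and "t \<in> carrier (tensor_alg scale)"
  shows "\<phi> t = \<psi> t"
proof (rule free_quot_linear_eqI[OF assms(1) assms(2,3)[unfolded tensor_alg_eq]])
  show "\<phi> (monomial_class scale (\<lambda>x. [x]) m) = \<psi> (monomial_class scale (\<lambda>x. [x]) m)" for m
    using assms(4) by (metis tensor_word_eq)
qed (use assms(5) in \<open>simp add: tensor_alg_eq\<close>)

lemma sym_linear_eqI:
  assumes "assoc_algebra B" "\<phi> \<in> linear_maps (sym_alg scale) B" "\<psi> \<in> linear_maps (sym_alg scale) B"
    and "\<And>as. \<phi> (sym_word scale as) = \<psi> (sym_word scale as)"
    and "p \<in> carrier (sym_alg scale)"
  shows "\<phi> p = \<psi> p"
proof (rule free_quot_linear_eqI[OF assms(1) assms(2,3)[unfolded sym_alg_eq]])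
  show "\<phi> (monomial_class scale (\<lambda>x. {#x#}) m) = \<psi> (monomial_class scale (\<lambda>x. {#x#}) m)" for m
    using assms(4) ex_mset[of m] by (metis sym_word_eq)
qed (use assms(5) in \<open>simp add: sym_alg_eq\<close>)

lemma sym_alg_commute:
  fixes scale :: "'f::field \<Rightarrow> 'v::ab_group_add \<Rightarrow> 'v"
  assumes "p \<in> carrier (sym_alg scale)" "q \<in> carrier (sym_alg scale)"
  shows "p \<otimes>\<^bsub>sym_alg scale\<^esub> q = q \<otimes>\<^bsub>sym_alg scale\<^esub> p"
proof -
  interpret L: algebra_ideal monoid_algebra "linearity_ideal scale (\<lambda>x. {#x#})"
    by (rule algebra_ideal_linearity)
  have "a * b = b * a" for a b :: "'v multiset \<Rightarrow>\<^sub>0 'f"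
    by (rule mult.commute)
  then show ?thesis
    using assms unfolding sym_alg_def
    by (elim L.coset_cases) (simp only: L.coset_mult monoid_algebra_sel UNIV_I)
qed

lemma tensor_linear_ext:
  assumes B: "assoc_algebra B" and j: "\<And>x. j x \<in> carrier B"
    and j_add: "\<And>x y. j (x + y) = j x \<oplus>\<^bsub>B\<^esub> j y"
    and j_smult: "\<And>c x. j (scale c x) = c \<odot>\<^bsub>B\<^esub> j x"
  obtains \<psi> where "\<psi> \<in> linear_maps (tensor_alg scale) B"
    "\<And>as. \<psi> (tensor_word scale as) = list_mult B (map j as)"
proof -
  interpret B: assoc_algebra B by fact
  have [simp]: "list_mult B (map j as) \<in> carrier B" for as
    using j by (intro B.list_mult_closed) auto
  have app: "list_mult B (map j as @ u # map j bs) = list_mult B (map j as) \<otimes>\<^bsub>B\<^esub> (u \<otimes>\<^bsub>B\<^esub> list_mult B (map j bs))"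
    if "u \<in> carrier B" for as bs u
    using j that by (subst B.list_mult_append) auto
  show thesis
  proof (rule free_quot_linear_ext[OF B, of "\<lambda>as. list_mult B (map j as)" "\<lambda>x. [x]" scale])
    fix \<psi> assume "\<psi> \<in> linear_maps (free_quot scale (\<lambda>x. [x])) B"
      "\<And>m. \<psi> (monomial_class scale (\<lambda>x. [x]) m) = list_mult B (map j m)"
    then show thesis by (intro that[of \<psi>]) (simp_all add: tensor_alg_eq[symmetric] tensor_word_eq)
  qed (use j in \<open>auto simp: plus_list_def app j_add j_smult B.l_distr B.r_distr B.smult_mult_l B.smult_mult_r\<close>)
qed

section \<open>Symmetrization\<close>

text \<open>Stated over the field. For the series algebras it is applied to
  \<open>restrict_scalars\<close>, where 1/n! acts through \<open>fps_const\<close>; this gives the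
  expression inside \<open>symmetrization\<close>.\<close>

definition sym_average :: "('f::field_char_0, 'b) module \<Rightarrow> ('v \<Rightarrow> 'b) \<Rightarrow> 'v list \<Rightarrow> 'b" where
  "sym_average B j as = inverse (fact (length as)) \<odot>\<^bsub>B\<^esub>
     (\<Oplus>\<^bsub>B\<^esub>p\<in>{p. p permutes {..<length as}}. list_mult B (map (\<lambda>i. j (as ! p i)) [0..<length as]))"

text \<open>Isolating one factor makes linearity of a product in that factor a matter of
  distributivity.\<close>

lemma (in assoc_algebra) list_mult_update_index:
  assumes i: "i < n" and f: "\<And>k. f k \<in> carrier A"
    and u: "u \<in> carrier A"
  shows "list_mult A (map (f(i := u)) [0..<n]) =
    list_mult A (map f [0..<i]) \<otimes> (u \<otimes> list_mult A (map f [Suc i..<n]))"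
proof -
  have "[0..<n] = [0..<i] @ i # [Suc i..<n]"
    using i upt_add_eq_append[of 0 i "n - i"] by (simp add: upt_conv_Cons)
  moreover have "map (f(i := u)) [0..<i] = map f [0..<i]"
    "map (f(i := u)) [Suc i..<n] = map f [Suc i..<n]" by auto
  moreover have "set (map f ks) \<subseteq> carrier A" for ks using f by auto
  ultimately show ?thesis
    using u by (simp add: list_mult_append del: set_map)
qed

context
  fixes B :: "('f::field_char_0, 'b) module" and j :: "'v::ab_group_add \<Rightarrow> 'b" and scale
  assumes B: "assoc_algebra B" and j: "\<And>x. j x \<in> carrier B"
    and j_add: "\<And>x y. j (x + y) = j x \<oplus>\<^bsub>B\<^esub> j y"
    and j_smult: "\<And>c x. j (scale c x) = c \<odot>\<^bsub>B\<^esub> j x"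
begin

interpretation B: assoc_algebra B by (rule B)

lemma sym_average_terms: "list_mult B (map (\<lambda>i. j (as ! p i)) ks) \<in> carrier B"
  using j by (intro B.list_mult_closed) auto

lemma sym_average_closed: "sym_average B j as \<in> carrier B"
  unfolding sym_average_def using sym_average_terms by (intro B.smult_closed B.finsum_closed) auto

text \<open>If q rearranges bs into as, then composing with q permutes the set of summands. Hence
  the average is a function of the commutative monomial.\<close>

lemma sym_average_mset_cong:
  assumes "mset as = mset bs"
  shows "sym_average B j as = sym_average B j bs"
proof -
  define n where "n = length bs"
  have n: "length as = n" using assms by (metis mset_eq_length n_def)
  obtain q where q: "q permutes {..<n}" "permute_list q bs = as"
    using assms unfolding n_def by (rule mset_eq_permutation)
  let ?P = "{p. p permutes {..<n}}"
  have "(\<Oplus>\<^bsub>B\<^esub>p\<in>?P. list_mult B (map (\<lambda>i. j (as ! p i)) [0..<n]))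
      = (\<Oplus>\<^bsub>B\<^esub>p\<in>?P. list_mult B (map (\<lambda>i. j (bs ! (q \<circ> p) i)) [0..<n]))"
  proof (intro B.finsum_cong' refl arg_cong[of _ _ "list_mult B"] map_cong)
    fix p i assume "p \<in> ?P" "i \<in> set [0..<n]"
    then have "p i < n" by (metis (no_types) atLeastLessThan_iff atLeast_upt lessThan_iff mem_Collect_eq permutes_in_image set_upt)
    then show "j (as ! p i) = j (bs ! (q \<circ> p) i)"
      using q by (auto simp: permute_list_nth n_def)
  qed (use sym_average_terms in auto)
  also have "\<dots> = (\<Oplus>\<^bsub>B\<^esub>p\<in>(\<lambda>p. q \<circ> p) ` ?P. list_mult B (map (\<lambda>i. j (bs ! p i)) [0..<n]))"
  proof (rule B.finsum_reindex[symmetric])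
    show "inj_on (\<lambda>p. q \<circ> p) ?P"
      using permutes_inj[OF q(1)] by (auto simp: inj_on_def fun.inj_map_strong fun_eq_iff dest: injD)
  qed (use sym_average_terms in auto)
  also have "(\<lambda>p. q \<circ> p) ` ?P = ?P"
    using image_compose_permutations_left[OF q(1)] by (simp add: setcompr_eq_image)
  finally show ?thesis by (simp add: sym_average_def n flip: n_def)
qed

text \<open>In each summand the head letter occurs exactly once, at the position that p sends to 0.
  The cofactors a and b do not depend on x, so each summand is linear in x.\<close>

lemma sym_average_update_head:
  assumes p: "p permutes {..<Suc (length as)}"
  obtains a b where "a \<in> carrier B" "b \<in> carrier B"
    "\<And>x. list_mult B (map (\<lambda>i. j ((x # as) ! p i)) [0..<Suc (length as)]) = a \<otimes>\<^bsub>B\<^esub> (j x \<otimes>\<^bsub>B\<^esub> b)"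
proof -
  obtain i where i: "p i = 0" "i < Suc (length as)"
    by (metis lessThan_iff p permutes_in_image permutes_surj surjD zero_less_Suc)
  \<comment> \<open>The head 0 is a dummy: it only affects position i, where the factor is
    overwritten by \<open>j x\<close>.\<close>
  define f where "f k = j ((0 # as) ! p k)" for k
  have "(\<lambda>k. j ((x # as) ! p k)) = f(i := j x)" for x
  proof
    fix k show "j ((x # as) ! p k) = (f(i := j x)) k"
      using i(1) inj_eq[OF permutes_inj[OF p], of k i] by (auto simp: f_def nth_Cons')
  qed
  then have "list_mult B (map (\<lambda>i. j ((x # as) ! p i)) [0..<Suc (length as)]) =
      list_mult B (map f [0..<i]) \<otimes>\<^bsub>B\<^esub> (j x \<otimes>\<^bsub>B\<^esub> list_mult B (map f [Suc i..<Suc (length as)]))" for x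
    using B.list_mult_update_index[OF i(2), of f "j x"] j by (simp add: f_def)
  moreover have "list_mult B (map f ks) \<in> carrier B" for ks
    using j by (intro B.list_mult_closed) (auto simp: f_def)
  ultimately show thesis using that by blast
qed

lemma sym_average_add:
  "sym_average B j ((x + y) # as) = sym_average B j (x # as) \<oplus>\<^bsub>B\<^esub> sym_average B j (y # as)"
proof -
  let ?t = "\<lambda>x p. list_mult B (map (\<lambda>i. j ((x # as) ! p i)) [0..<Suc (length as)])"
  let ?P = "{p. p permutes {..<Suc (length as)}}"
  have [simp]: "?t x p \<in> carrier B" for x p by (rule sym_average_terms)
  have "(\<Oplus>\<^bsub>B\<^esub>p\<in>?P. ?t (x + y) p) = (\<Oplus>\<^bsub>B\<^esub>p\<in>?P. ?t x p \<oplus>\<^bsub>B\<^esub> ?t y p)"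
  proof (intro B.finsum_cong' refl)
    fix p assume "p \<in> ?P"
    then obtain a b where "a \<in> carrier B" "b \<in> carrier B" "\<And>x. ?t x p = a \<otimes>\<^bsub>B\<^esub> (j x \<otimes>\<^bsub>B\<^esub> b)"
      using sym_average_update_head[of p as] by blast
    then show "?t (x + y) p = ?t x p \<oplus>\<^bsub>B\<^esub> ?t y p"
      using j by (simp only: j_add) (simp add: B.l_distr B.r_distr)
  qed (auto simp del: upt_Suc)
  also have "\<dots> = (\<Oplus>\<^bsub>B\<^esub>p\<in>?P. ?t x p) \<oplus>\<^bsub>B\<^esub> (\<Oplus>\<^bsub>B\<^esub>p\<in>?P. ?t y p)"
    by (rule B.finsum_addf) (auto simp del: upt_Suc)
  finally show ?thesis
    by (simp add: sym_average_def B.smult_r_distr del: upt_Suc fact_Suc)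
qed

lemma sym_average_smult:
  "sym_average B j (scale c x # as) = c \<odot>\<^bsub>B\<^esub> sym_average B j (x # as)"
proof -
  let ?t = "\<lambda>x p. list_mult B (map (\<lambda>i. j ((x # as) ! p i)) [0..<Suc (length as)])"
  let ?P = "{p. p permutes {..<Suc (length as)}}"
  have [simp]: "?t x p \<in> carrier B" for x p by (rule sym_average_terms)
  have "(\<Oplus>\<^bsub>B\<^esub>p\<in>?P. ?t (scale c x) p) = (\<Oplus>\<^bsub>B\<^esub>p\<in>?P. c \<odot>\<^bsub>B\<^esub> ?t x p)"
  proof (intro B.finsum_cong' refl)
    fix p assume "p \<in> ?P"
    then obtain a b where "a \<in> carrier B" "b \<in> carrier B" "\<And>x. ?t x p = a \<otimes>\<^bsub>B\<^esub> (j x \<otimes>\<^bsub>B\<^esub> b)"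
      using sym_average_update_head[of p as] by blast
    then show "?t (scale c x) p = c \<odot>\<^bsub>B\<^esub> ?t x p"
      using j by (simp only: j_smult) (simp add: B.smult_mult_l B.smult_mult_r)
  qed (auto simp del: upt_Suc)
  also have "\<dots> = c \<odot>\<^bsub>B\<^esub> (\<Oplus>\<^bsub>B\<^esub>p\<in>?P. ?t x p)"
    by (rule B.smult_finsum[symmetric]) (auto simp del: upt_Suc)
  finally show ?thesis
    by (simp add: sym_average_def B.smult_smult mult.commute del: upt_Suc fact_Suc)
qed

text \<open>Linearity in the head gives linearity in every letter, because the average depends only
  on the multiset and any letter may be moved to the front.\<close>

lemma sym_average_ext:
  obtains \<psi> where "\<psi> \<in> linear_maps (sym_alg scale) B"
    "\<And>as. \<psi> (sym_word scale as) = sym_average B j as"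
proof -
  \<comment> \<open>The chosen ordering of M is immaterial by
    \<open>sym_average_mset_cong\<close>.\<close>
  define f where "f M = sym_average B j (SOME as. mset as = M)" for M
  have f: "f (mset as) = sym_average B j as" for as
    unfolding f_def by (rule sym_average_mset_cong, rule someI) (rule refl)
  have f': "f (M + {#x#} + N) = sym_average B j (x # as)" if "mset as = M + N" for M N x as
    using f[of "x # as"] that by simp
  show thesis
  proof (rule free_quot_linear_ext[OF B, of f "\<lambda>x. {#x#}" scale])
    show "range f \<subseteq> carrier B" by (auto simp: f_def sym_average_closed)
    fix M N :: "'v multiset" and x y c
    obtain as where "mset as = M + N" using ex_mset by blast
    then show "f (M + {#x + y#} + N) = f (M + {#x#} + N) \<oplus>\<^bsub>B\<^esub> f (M + {#y#} + N)"
      "f (M + {#scale c x#} + N) = c \<odot>\<^bsub>B\<^esub> f (M + {#x#} + N)"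
      using f' sym_average_add sym_average_smult by metis+
  next
    fix \<psi> assume "\<psi> \<in> linear_maps (free_quot scale (\<lambda>x. {#x#})) B"
      "\<And>m. \<psi> (monomial_class scale (\<lambda>x. {#x#}) m) = f m"
    then show thesis by (intro that[of \<psi>]) (simp_all add: sym_alg_eq[symmetric] sym_word_eq f)
  qed
qed

end

section \<open>Power series over an algebra\<close>

lemma (in abelian_monoid) finsum_triangle:
  fixes n :: nat
  assumes "\<And>i j. u i j \<in> carrier G"
  shows "(\<Oplus>k\<in>{..n}. \<Oplus>i\<in>{..k}. u i (k - i)) = (\<Oplus>i\<in>{..n}. \<Oplus>j\<in>{..n - i}. u i j)"
proof (induction n)
  case (Suc n)
  have "(\<Oplus>i\<in>{..Suc n}. \<Oplus>j\<in>{..Suc n - i}. u i j)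
      = u (Suc n) 0 \<oplus> (\<Oplus>i\<in>{..n}. u i (Suc n - i) \<oplus> (\<Oplus>j\<in>{..n - i}. u i j))"
    using assms by (simp add: Suc_diff_le cong: finsum_cong)
  also have "\<dots> = (\<Oplus>i\<in>{..Suc n}. u i (Suc n - i)) \<oplus> (\<Oplus>i\<in>{..n}. \<Oplus>j\<in>{..n - i}. u i j)"
    using assms by (simp add: finsum_addf a_assoc)
  also have "\<dots> = (\<Oplus>k\<in>{..Suc n}. \<Oplus>i\<in>{..k}. u i (k - i))"
    using assms Suc finsum_Suc[of "\<lambda>k. \<Oplus>i\<in>{..k}. u i (k - i)" n] by (simp add: Pi_def del: finsum_Suc)
  finally show ?case by simp
qed (use assms in simp)

lemma (in abelian_monoid) finsum_single_index:
  assumes "i \<in> I" "finite I" "f i \<in> carrier G" "\<And>j. j \<in> I \<Longrightarrow> j \<noteq> i \<Longrightarrow> f j = \<zero>"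
  shows "finsum G f I = f i"
proof -
  have "finsum G f I = (\<Oplus>j\<in>I. if i = j then f i else \<zero>)"
    using assms by (intro finsum_cong') auto
  then show ?thesis
    using finsum_singleton[of i I "\<lambda>_. f i"] assms by simp
qed

lemma (in abelian_monoid) finsum_reflect:
  fixes n :: nat
  assumes "\<And>k. f k \<in> carrier G"
  shows "(\<Oplus>k\<in>{..n}. f (n - k)) = (\<Oplus>k\<in>{..n}. f k)"
proof -
  have "(\<lambda>k. n - k) ` {..n} = {..n}"
  proof -
    have "k \<in> (\<lambda>k. n - k) ` {..n}" if "k \<le> n" for k
      using that by (intro image_eqI[of _ _ "n - k"]) auto
    then show ?thesis by auto
  qed
  moreover have "inj_on (\<lambda>k. n - k) {..n}"
    by (auto simp: inj_on_def)
  ultimately show ?thesis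
    using finsum_reindex[of f "\<lambda>k. n - k" "{..n}"] assms by simp
qed

lemma pseries_sel:
  "carrier (pseries N A) = {x. (\<forall>n. x n \<in> carrier A) \<and> (\<forall>n. N \<le> enat n \<longrightarrow> x n = \<zero>\<^bsub>A\<^esub>)}"
  "monoid.mult (pseries N A) = (\<lambda>x y. trunc N A (\<lambda>n. \<Oplus>\<^bsub>A\<^esub>k\<in>{..n}. x k \<otimes>\<^bsub>A\<^esub> y (n - k)))"
  "one (pseries N A) = const A \<one>\<^bsub>A\<^esub>"
  "zero (pseries N A) = (\<lambda>n. \<zero>\<^bsub>A\<^esub>)"
  "add (pseries N A) = (\<lambda>x y n. x n \<oplus>\<^bsub>A\<^esub> y n)"
  "module.smult (pseries N A) = (\<lambda>c x. trunc N A (\<lambda>n. \<Oplus>\<^bsub>A\<^esub>k\<in>{..n}. fps_nth c k \<odot>\<^bsub>A\<^esub> x (n - k)))"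
  by (simp_all add: pseries_def)

lemma trunc_nth: "trunc N A x n = (if enat n < N then x n else \<zero>\<^bsub>A\<^esub>)"
  by (simp add: trunc_def)

text \<open>The product before truncation. Ring laws are proved here, free of case distinctions on
  N, and carried over to \<open>pseries\<close> by \<open>trunc_convolution_trunc\<close>.\<close>

definition convolution :: "('k, 'a) module \<Rightarrow> (nat \<Rightarrow> 'a) \<Rightarrow> (nat \<Rightarrow> 'a) \<Rightarrow> nat \<Rightarrow> 'a" where
  "convolution A x y n = (\<Oplus>\<^bsub>A\<^esub>k\<in>{..n}. x k \<otimes>\<^bsub>A\<^esub> y (n - k))"

text \<open>The image of a scalar series in A[[h]]. The action of \<open>F[[h]]\<close> becomes
  convolution with it, and since it commutes with every series, the module laws become laws of
  convolution.\<close>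

definition scalar_series :: "('k::comm_ring_1, 'a) module \<Rightarrow> 'k fps \<Rightarrow> nat \<Rightarrow> 'a" where
  "scalar_series A c n = fps_nth c n \<odot>\<^bsub>A\<^esub> \<one>\<^bsub>A\<^esub>"

context assoc_algebra
begin

lemma convolution_closed [simp, intro]:
  "x \<in> UNIV \<rightarrow> carrier A \<Longrightarrow> y \<in> UNIV \<rightarrow> carrier A \<Longrightarrow> convolution A x y n \<in> carrier A"
  unfolding convolution_def by (intro finsum_closed) auto

lemma convolution_assoc:
  assumes "x \<in> UNIV \<rightarrow> carrier A" "y \<in> UNIV \<rightarrow> carrier A" "z \<in> UNIV \<rightarrow> carrier A"
  shows "convolution A (convolution A x y) z = convolution A x (convolution A y z)"
proof
  fix n
  have [simp]: "x k \<in> carrier A" "y k \<in> carrier A" "z k \<in> carrier A" for k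
    using assms by auto
  have "convolution A (convolution A x y) z n =
      (\<Oplus>k\<in>{..n}. \<Oplus>i\<in>{..k}. x i \<otimes> y (k - i) \<otimes> z (n - i - (k - i)))"
    unfolding convolution_def by (intro finsum_cong' refl) (auto simp: finsum_ldistr Pi_def cong: finsum_cong)
  also have "\<dots> = (\<Oplus>i\<in>{..n}. \<Oplus>j\<in>{..n - i}. x i \<otimes> y j \<otimes> z (n - i - j))"
    by (rule finsum_triangle) auto
  also have "\<dots> = convolution A x (convolution A y z) n"
    unfolding convolution_def by (intro finsum_cong' refl) (auto simp: finsum_rdistr Pi_def m_assoc)
  finally show "convolution A (convolution A x y) z n = convolution A x (convolution A y z) n" .
qed

lemma convolution_add_left:
  assumes "x \<in> UNIV \<rightarrow> carrier A" "y \<in> UNIV \<rightarrow> carrier A" "z \<in> UNIV \<rightarrow> carrier A"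
  shows "convolution A (\<lambda>n. x n \<oplus> y n) z = (\<lambda>n. convolution A x z n \<oplus> convolution A y z n)"
proof
  have [simp]: "x k \<in> carrier A" "y k \<in> carrier A" "z k \<in> carrier A" for k
    using assms by auto
  show "convolution A (\<lambda>n. x n \<oplus> y n) z n = convolution A x z n \<oplus> convolution A y z n" for n
    by (simp add: convolution_def l_distr finsum_addf)
qed

lemma convolution_add_right:
  assumes "x \<in> UNIV \<rightarrow> carrier A" "y \<in> UNIV \<rightarrow> carrier A" "z \<in> UNIV \<rightarrow> carrier A"
  shows "convolution A x (\<lambda>n. y n \<oplus> z n) = (\<lambda>n. convolution A x y n \<oplus> convolution A x z n)"
proof
  have [simp]: "x k \<in> carrier A" "y k \<in> carrier A" "z k \<in> carrier A" for k
    using assms by auto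
  show "convolution A x (\<lambda>n. y n \<oplus> z n) n = convolution A x y n \<oplus> convolution A x z n" for n
    by (simp add: convolution_def r_distr finsum_addf)
qed

lemma convolution_const_left:
  assumes "a \<in> carrier A" "x \<in> UNIV \<rightarrow> carrier A"
  shows "convolution A (const A a) x n = a \<otimes> x n"
  unfolding convolution_def using assms
  by (subst finsum_single_index[where i = 0]) (auto simp: const_def Pi_iff)

lemma convolution_const_right:
  assumes "a \<in> carrier A" "x \<in> UNIV \<rightarrow> carrier A"
  shows "convolution A x (const A a) n = x n \<otimes> a"
  unfolding convolution_def using assms
  by (subst finsum_single_index[where i = n]) (auto simp: const_def Pi_iff)

lemma convolution_cong:
  assumes "\<And>k. k \<le> n \<Longrightarrow> x k = x' k" "\<And>k. k \<le> n \<Longrightarrow> y k = y' k"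
    "x' \<in> UNIV \<rightarrow> carrier A" "y' \<in> UNIV \<rightarrow> carrier A"
  shows "convolution A x y n = convolution A x' y' n"
  unfolding convolution_def using assms by (intro finsum_cong') (auto simp: Pi_iff)

lemma scalar_series_closed [simp, intro]: "scalar_series A c n \<in> carrier A"
  by (simp add: scalar_series_def)

lemma convolution_scalar_left:
  "x \<in> UNIV \<rightarrow> carrier A \<Longrightarrow>
     convolution A (scalar_series A c) x n = (\<Oplus>k\<in>{..n}. fps_nth c k \<odot> x (n - k))"
  unfolding convolution_def scalar_series_def
  by (intro finsum_cong') (auto simp: smult_mult_l Pi_iff)

lemma convolution_scalar_commute:
  assumes "x \<in> UNIV \<rightarrow> carrier A"
  shows "convolution A x (scalar_series A c) = convolution A (scalar_series A c) x"
proof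
  fix n
  have [simp]: "x k \<in> carrier A" for k using assms by auto
  have "convolution A x (scalar_series A c) n = (\<Oplus>k\<in>{..n}. fps_nth c (n - k) \<odot> x (n - (n - k)))"
    unfolding convolution_def scalar_series_def by (intro finsum_cong') (auto simp: smult_mult_r)
  also have "\<dots> = (\<Oplus>k\<in>{..n}. fps_nth c k \<odot> x (n - k))"
    by (rule finsum_reflect) simp
  finally show "convolution A x (scalar_series A c) n = convolution A (scalar_series A c) x n"
    by (simp only: convolution_scalar_left[OF assms])
qed

lemma scalar_series_add: "scalar_series A (c + d) = (\<lambda>n. scalar_series A c n \<oplus> scalar_series A d n)"
  by (auto simp: scalar_series_def smult_l_distr)

lemma scalar_series_mult:
  "scalar_series A (c * d) = convolution A (scalar_series A c) (scalar_series A d)"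
  by (rule ext)
     (simp add: convolution_scalar_left Pi_iff, simp add: scalar_series_def fps_mult_nth atLeast0AtMost
       smult_sum_left smult_smult)

lemma scalar_series_one: "scalar_series A 1 = const A \<one>"
  by (auto simp: scalar_series_def const_def)

end

locale series_algebra = A: assoc_algebra A for A :: "('f::field, 'a) module" (structure) +
  fixes N :: enat
  assumes N_pos: "0 < N"
begin

abbreviation P where "P \<equiv> pseries N A"

lemma coeff_closed [simp]: "x \<in> carrier P \<Longrightarrow> x n \<in> carrier A"
  unfolding pseries_sel(1) by blast

lemma coeffs_closed [simp]: "x \<in> carrier P \<Longrightarrow> x \<in> UNIV \<rightarrow> carrier A"
  using coeff_closed by blast

lemma coeff_eq_zero: "x \<in> carrier P \<Longrightarrow> \<not> enat n < N \<Longrightarrow> x n = \<zero>"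
  unfolding pseries_sel(1) not_less by blast

lemma series_closedI:
  "(\<And>n. x n \<in> carrier A) \<Longrightarrow> (\<And>n. \<not> enat n < N \<Longrightarrow> x n = \<zero>) \<Longrightarrow> x \<in> carrier P"
  unfolding pseries_sel(1) not_less by blast

lemma series_eqI:
  "x \<in> carrier P \<Longrightarrow> y \<in> carrier P \<Longrightarrow> (\<And>n. enat n < N \<Longrightarrow> x n = y n) \<Longrightarrow> x = y"
  by (rule ext) (metis coeff_eq_zero)

lemma trunc_closed [simp, intro]: "x \<in> UNIV \<rightarrow> carrier A \<Longrightarrow> trunc N A x \<in> carrier P"
  by (rule series_closedI) (auto simp: trunc_nth)

lemma trunc_eq [simp]: "x \<in> carrier P \<Longrightarrow> trunc N A x = x"
  by (auto simp: trunc_nth coeff_eq_zero)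

text \<open>Coefficient n of a product involves only coefficients of index at most n, so terms of
  order N and above cannot influence the truncated product.\<close>

lemma trunc_convolution_trunc [simp]:
  assumes "x \<in> UNIV \<rightarrow> carrier A" "y \<in> UNIV \<rightarrow> carrier A"
  shows "trunc N A (convolution A (trunc N A x) y) = trunc N A (convolution A x y)"
    and "trunc N A (convolution A x (trunc N A y)) = trunc N A (convolution A x y)"
proof -
  have "trunc N A x k = x k" "trunc N A y k = y k" if "enat n < N" "k \<le> n" for n k
    using that order.strict_trans1[of "enat k" "enat n" N] by (simp_all add: trunc_nth)
  with assms have "convolution A (trunc N A x) y n = convolution A x y n"
    "convolution A x (trunc N A y) n = convolution A x y n" if "enat n < N" for n
    using that by (auto intro!: A.convolution_cong)
  then have "trunc N A (convolution A (trunc N A x) y) n = trunc N A (convolution A x y) n"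
    "trunc N A (convolution A x (trunc N A y)) n = trunc N A (convolution A x y) n" for n
    unfolding trunc_nth by metis+
  then show "trunc N A (convolution A (trunc N A x) y) = trunc N A (convolution A x y)"
    "trunc N A (convolution A x (trunc N A y)) = trunc N A (convolution A x y)"
    by (simp_all only: fun_eq_iff simp_thms)
qed

lemma mult_eq: "x \<otimes>\<^bsub>P\<^esub> y = trunc N A (convolution A x y)"
  by (simp add: pseries_sel(2) trunc_def convolution_def cong: if_cong)

lemma smult_eq: "x \<in> carrier P \<Longrightarrow> c \<odot>\<^bsub>P\<^esub> x = trunc N A (convolution A (scalar_series A c) x)"
  by (simp add: pseries_sel(6) trunc_def A.convolution_scalar_left cong: if_cong)

lemma const_closed [simp, intro]: "a \<in> carrier A \<Longrightarrow> const A a \<in> carrier P"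
  using N_pos by (intro series_closedI) (auto simp: const_def zero_enat_def)

lemma const_0 [simp]: "const A a 0 = a"
  by (simp add: const_def)

lemma add_nth: "(x \<oplus>\<^bsub>P\<^esub> y) n = x n \<oplus> y n"
  and zero_nth: "\<zero>\<^bsub>P\<^esub> n = \<zero>"
  and mult_nth: "(x \<otimes>\<^bsub>P\<^esub> y) n = (if enat n < N then convolution A x y n else \<zero>)"
  by (simp_all only: pseries_sel(2,4,5) trunc_nth convolution_def)

lemma add_closed: "x \<in> carrier P \<Longrightarrow> y \<in> carrier P \<Longrightarrow> x \<oplus>\<^bsub>P\<^esub> y \<in> carrier P"
  by (rule series_closedI) (auto simp: add_nth coeff_eq_zero)

lemma zero_closed: "\<zero>\<^bsub>P\<^esub> \<in> carrier P"
  by (rule series_closedI) (auto simp: zero_nth)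

lemma algebra_pseries: "assoc_algebra P"
proof -
  have conv: "x \<in> UNIV \<rightarrow> carrier A \<Longrightarrow> y \<in> UNIV \<rightarrow> carrier A \<Longrightarrow> convolution A x y \<in> UNIV \<rightarrow> carrier A"
    and sc: "scalar_series A c \<in> UNIV \<rightarrow> carrier A" for x y c by auto
  have conv_add: "convolution A (x \<oplus>\<^bsub>P\<^esub> y) z n = convolution A x z n \<oplus> convolution A y z n"
    "convolution A z (x \<oplus>\<^bsub>P\<^esub> y) n = convolution A z x n \<oplus> convolution A z y n"
    if "x \<in> UNIV \<rightarrow> carrier A" "y \<in> UNIV \<rightarrow> carrier A" "z \<in> UNIV \<rightarrow> carrier A" for x y z n
    using that by (simp_all add: pseries_sel(5) A.convolution_add_left A.convolution_add_right)
  have ring: "ring P"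
  proof (rule ringI)
    show "abelian_group P"
    proof (rule abelian_groupI)
      show "\<exists>y\<in>carrier P. y \<oplus>\<^bsub>P\<^esub> x = \<zero>\<^bsub>P\<^esub>" if "x \<in> carrier P" for x
        using that
        by (intro bexI[of _ "\<lambda>n. \<ominus> x n"] series_closedI ext)
           (auto simp: add_nth zero_nth A.l_neg coeff_eq_zero)
    qed (auto simp: add_nth zero_nth A.a_ac add_closed zero_closed intro!: ext)
    show "monoid P"
    proof (rule monoidI)
      show "\<one>\<^bsub>P\<^esub> \<otimes>\<^bsub>P\<^esub> x = x" "x \<otimes>\<^bsub>P\<^esub> \<one>\<^bsub>P\<^esub> = x" if "x \<in> carrier P" for x
        using that
        by (auto simp: mult_nth pseries_sel(3) A.convolution_const_left A.convolution_const_right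
             coeff_eq_zero intro!: ext)
    qed (auto simp: mult_eq conv A.convolution_assoc pseries_sel(3))
    show "(x \<oplus>\<^bsub>P\<^esub> y) \<otimes>\<^bsub>P\<^esub> z = x \<otimes>\<^bsub>P\<^esub> z \<oplus>\<^bsub>P\<^esub> y \<otimes>\<^bsub>P\<^esub> z"
      "z \<otimes>\<^bsub>P\<^esub> (x \<oplus>\<^bsub>P\<^esub> y) = z \<otimes>\<^bsub>P\<^esub> x \<oplus>\<^bsub>P\<^esub> z \<otimes>\<^bsub>P\<^esub> y"
      if "x \<in> carrier P" "y \<in> carrier P" "z \<in> carrier P" for x y z
      using that by (auto simp: mult_nth add_nth conv_add intro!: ext)
  qed
  have smult_nth: "(c \<odot>\<^bsub>P\<^esub> x) n = (if enat n < N then convolution A (scalar_series A c) x n else \<zero>)"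
    if "x \<in> carrier P" for c x n
    using that by (simp add: smult_eq trunc_nth)
  show ?thesis
  proof (intro assoc_algebra.intro assoc_algebra_axioms.intro ring)
    fix x y c d assume xy [simp]: "x \<in> carrier P" "y \<in> carrier P"
    have convs [simp]: "convolution A x' y' \<in> UNIV \<rightarrow> carrier A"
      if "x' \<in> UNIV \<rightarrow> carrier A" "y' \<in> UNIV \<rightarrow> carrier A" for x' y' using that by auto
    show closed [simp]: "c \<odot>\<^bsub>P\<^esub> x \<in> carrier P" for c by (simp add: smult_eq)
    show "(c + d) \<odot>\<^bsub>P\<^esub> x = c \<odot>\<^bsub>P\<^esub> x \<oplus>\<^bsub>P\<^esub> d \<odot>\<^bsub>P\<^esub> x"
      by (rule ext) (simp add: smult_nth add_nth A.scalar_series_add A.convolution_add_left sc)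
    show "c \<odot>\<^bsub>P\<^esub> (x \<oplus>\<^bsub>P\<^esub> y) = c \<odot>\<^bsub>P\<^esub> x \<oplus>\<^bsub>P\<^esub> c \<odot>\<^bsub>P\<^esub> y"
      by (rule ext) (simp add: smult_nth add_nth add_closed conv_add sc)
    show "c \<odot>\<^bsub>P\<^esub> (d \<odot>\<^bsub>P\<^esub> x) = (c * d) \<odot>\<^bsub>P\<^esub> x"
      by (simp add: smult_eq[OF closed], simp add: smult_eq sc A.scalar_series_mult A.convolution_assoc)
    show "1 \<odot>\<^bsub>P\<^esub> x = x"
      by (rule ext) (simp add: smult_nth A.scalar_series_one A.convolution_const_left coeff_eq_zero)
    have m: "x \<otimes>\<^bsub>P\<^esub> y \<in> carrier P" by (simp add: mult_eq)
    show "c \<odot>\<^bsub>P\<^esub> x \<otimes>\<^bsub>P\<^esub> y = c \<odot>\<^bsub>P\<^esub> (x \<otimes>\<^bsub>P\<^esub> y)"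
      by (simp add: smult_eq[OF m], simp add: smult_eq mult_eq sc A.convolution_assoc)
    show "x \<otimes>\<^bsub>P\<^esub> (c \<odot>\<^bsub>P\<^esub> y) = c \<odot>\<^bsub>P\<^esub> (x \<otimes>\<^bsub>P\<^esub> y)"
      by (simp add: smult_eq[OF m], simp add: smult_eq mult_eq sc A.convolution_scalar_commute
            flip: A.convolution_assoc)
  qed
qed

end

section \<open>Linear maps between power series\<close>

text \<open>T(V) and S(V) are algebras over the field while their targets are algebras over
  \<open>F[[h]]\<close>. Embedding the field as constant series makes the universal properties
  applicable to such targets.\<close>

definition restrict_scalars :: "('f::field fps, 'b) module \<Rightarrow> ('f, 'b) module" where
  "restrict_scalars B = \<lparr>carrier = carrier B, monoid.mult = monoid.mult B, one = one B,
     zero = zero B, add = add B, smult = (\<lambda>c. module.smult B (fps_const c))\<rparr>"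

lemma restrict_scalars_sel [simp]:
  "carrier (restrict_scalars B) = carrier B" "monoid.mult (restrict_scalars B) = monoid.mult B"
  "one (restrict_scalars B) = one B" "zero (restrict_scalars B) = zero B"
  "add (restrict_scalars B) = add B"
  "module.smult (restrict_scalars B) = (\<lambda>c. module.smult B (fps_const c))"
  by (simp_all add: restrict_scalars_def)

lemma list_mult_restrict_scalars [simp]: "list_mult (restrict_scalars B) = list_mult B"
  by (simp add: list_mult_def fun_eq_iff)

lemma finsum_restrict_scalars [simp]: "finsum (restrict_scalars B) = finsum B"
  by (simp add: finsum_def fun_eq_iff finprod_def)

lemma algebra_restrict_scalars:
  assumes "assoc_algebra B"
  shows "assoc_algebra (restrict_scalars B)"
proof -
  interpret B: assoc_algebra B by fact
  have "ring (restrict_scalars B)"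
  proof (rule ringI)
    show "abelian_group (restrict_scalars B)"
      by (rule abelian_groupI) (auto simp: B.a_ac intro: bexI[of _ "\<ominus>\<^bsub>B\<^esub> _"] B.l_neg)
    show "monoid (restrict_scalars B)"
      by (rule monoidI) (auto simp: B.m_assoc)
  qed (auto simp: B.l_distr B.r_distr)
  then show ?thesis
    by (intro assoc_algebra.intro assoc_algebra_axioms.intro)
       (auto simp: B.smult_l_distr B.smult_r_distr B.smult_smult B.smult_mult_l B.smult_mult_r
         simp flip: fps_const_add fps_const_mult)
qed

text \<open>Division by h after dropping the constant term. For finite N the quotient is determined
  only up to its top coefficient, index N - 1, which becomes 0 here when the series is truncated at
  N.\<close>

definition series_shift :: "(nat \<Rightarrow> 'a) \<Rightarrow> nat \<Rightarrow> 'a" where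
  "series_shift x n = x (Suc n)"

context series_algebra
begin

sublocale P: assoc_algebra P by (rule algebra_pseries)

lemma smult_nth:
  "(c \<odot>\<^bsub>P\<^esub> x) n = (if enat n < N then \<Oplus>k\<in>{..n}. fps_nth c k \<odot> x (n - k) else \<zero>)"
  by (simp add: pseries_sel(6) trunc_nth)

lemma smult_X_nth:
  assumes "x \<in> carrier P"
  shows "(fps_X \<odot>\<^bsub>P\<^esub> x) n = (if enat n < N \<and> n > 0 then x (n - 1) else \<zero>)"
proof (cases n)
  case 0
  then show ?thesis using assms by (simp add: smult_nth)
next
  case (Suc m)
  then have "(\<Oplus>k\<in>{..n}. fps_nth fps_X k \<odot> x (n - k)) = fps_nth fps_X 1 \<odot> x (n - 1)"
    using assms by (intro A.finsum_single_index) auto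
  then show ?thesis using Suc assms by (simp add: smult_nth)
qed

lemma smult_const_nth:
  assumes "x \<in> carrier P"
  shows "(fps_const c \<odot>\<^bsub>P\<^esub> x) n = c \<odot> x n"
proof (cases "enat n < N")
  case True
  have "(\<Oplus>k\<in>{..n}. fps_nth (fps_const c) k \<odot> x (n - k)) = fps_nth (fps_const c) 0 \<odot> x (n - 0)"
    using assms by (intro A.finsum_single_index) auto
  then show ?thesis using True by (simp add: smult_nth)
qed (use assms in \<open>simp add: smult_nth coeff_eq_zero\<close>)

lemma a_inv_nth: "x \<in> carrier P \<Longrightarrow> (\<ominus>\<^bsub>P\<^esub> x) n = \<ominus> x n"
  by (metis A.minus_equality P.a_inv_closed P.l_neg add_nth coeff_closed zero_nth)

lemma minus_nth: "x \<in> carrier P \<Longrightarrow> y \<in> carrier P \<Longrightarrow> (x \<ominus>\<^bsub>P\<^esub> y) n = x n \<ominus> y n"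
  by (simp add: A.minus_eq P.minus_eq add_nth a_inv_nth)

lemma shift_closed: "x \<in> carrier P \<Longrightarrow> series_shift x \<in> carrier P"
proof (rule series_closedI)
  fix n assume "x \<in> carrier P" "\<not> enat n < N"
  then show "series_shift x n = \<zero>"
    by (metis coeff_eq_zero Suc_ile_eq order_less_imp_le series_shift_def)
qed (simp add: series_shift_def)

lemma decompose:
  assumes x: "x \<in> carrier P"
  shows "x = const A (x 0) \<oplus>\<^bsub>P\<^esub> (fps_X \<odot>\<^bsub>P\<^esub> series_shift x)"
proof (rule series_eqI)
  fix n assume "enat n < N"
  then show "x n = (const A (x 0) \<oplus>\<^bsub>P\<^esub> (fps_X \<odot>\<^bsub>P\<^esub> series_shift x)) n"
    using x by (cases n) (auto simp: add_nth smult_X_nth shift_closed const_def, simp add: series_shift_def)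
qed (use x shift_closed in auto)

lemma const_add: "a \<in> carrier A \<Longrightarrow> b \<in> carrier A \<Longrightarrow> const A (a \<oplus> b) = const A a \<oplus>\<^bsub>P\<^esub> const A b"
  by (rule ext) (simp add: add_nth const_def)

lemma const_smult: "a \<in> carrier A \<Longrightarrow> const A (c \<odot> a) = fps_const c \<odot>\<^bsub>P\<^esub> const A a"
  by (rule ext) (simp add: smult_const_nth, simp add: const_def)

lemma const_mult:
  "a \<in> carrier A \<Longrightarrow> b \<in> carrier A \<Longrightarrow> const A (a \<otimes> b) = const A a \<otimes>\<^bsub>P\<^esub> const A b"
  using N_pos[unfolded zero_enat_def]
  by (intro ext) (simp add: mult_nth A.convolution_const_left, auto simp: const_def)

lemma const_linear: "const A \<in> linear_maps A (restrict_scalars P)"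
  by (intro linear_mapsI) (auto simp: const_add const_smult)

lemma coeff_linear: "(\<lambda>x. x n) \<in> linear_maps (restrict_scalars P) A"
  by (intro linear_mapsI) (auto simp: add_nth smult_const_nth)

lemma list_mult_const:
  "set xs \<subseteq> carrier A \<Longrightarrow> list_mult P (map (const A) xs) = const A (list_mult A xs)"
  by (induction xs) (auto simp: const_mult pseries_sel(3))

end

locale series_linear_map = A: series_algebra A N + C: series_algebra C N
  for A :: "('f::field, 'a) module" and C :: "('f, 'c) module" and N +
  fixes \<phi>
  assumes linear: "\<phi> \<in> linear_maps (pseries N A) (pseries N C)"
begin

sublocale linear_map "pseries N A" "pseries N C" \<phi>
  using A.algebra_pseries C.algebra_pseries linear by (intro linear_map.intro linear_map_axioms.intro)

text \<open>Since \<phi> commutes with multiplication by h, coefficient n + 1 of the image of x is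
  that of the image of the constant x 0 plus coefficient n of the image of the shift. Induction on n
  unrolls this into a finite sum.\<close>

lemma coeff_formula:
  assumes "x \<in> carrier (pseries N A)" "enat n < N"
  shows "\<phi> x n = (\<Oplus>\<^bsub>C\<^esub>k\<in>{..n}. \<phi> (const A (x k)) (n - k))"
  using assms
proof (induction n arbitrary: x)
  case (0 x)
  then have "\<phi> x = \<phi> (const A (x 0) \<oplus>\<^bsub>A.P\<^esub> (fps_X \<odot>\<^bsub>A.P\<^esub> series_shift x))"
    using A.decompose by simp
  then show ?case
    using 0 by (simp add: add smult A.shift_closed C.add_nth C.smult_X_nth)
next
  case (Suc n x)
  have n: "enat n < N" using Suc.prems(2) Suc_ile_eq less_imp_le by blast
  have "\<phi> x = \<phi> (const A (x 0) \<oplus>\<^bsub>A.P\<^esub> (fps_X \<odot>\<^bsub>A.P\<^esub> series_shift x))"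
    using A.decompose Suc.prems(1) by simp
  then have "\<phi> x (Suc n) = \<phi> (const A (x 0)) (Suc n) \<oplus>\<^bsub>C\<^esub> \<phi> (series_shift x) n"
    using Suc.prems by (simp add: add smult A.shift_closed C.add_nth C.smult_X_nth)
  also have "\<phi> (series_shift x) n = (\<Oplus>\<^bsub>C\<^esub>k\<in>{..n}. \<phi> (const A (x (Suc k))) (n - k))"
    unfolding Suc.IH[OF A.shift_closed[OF Suc.prems(1)] n] by (simp only: series_shift_def)
  finally show ?case
    using Suc.prems by (subst C.A.finsum_Suc2) (auto simp: C.A.a_comm)
qed

lemma coeff_0: "x \<in> carrier (pseries N A) \<Longrightarrow> \<phi> x 0 = \<phi> (const A (x 0)) 0"
  using coeff_formula[of x 0] C.N_pos by (simp add: zero_enat_def)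

lemma coeff_cong:
  assumes "x \<in> carrier (pseries N A)" "y \<in> carrier (pseries N A)" "\<And>k. k \<le> n \<Longrightarrow> x k = y k"
  shows "\<phi> x n = \<phi> y n"
proof (cases "enat n < N")
  case True
  then show ?thesis
    using assms by (auto simp: coeff_formula intro!: C.A.finsum_cong')
qed (use assms in \<open>simp add: C.coeff_eq_zero\<close>)

text \<open>Once the coefficients below n vanish, \<open>coeff_formula\<close> leaves only the term
  k = n, so x n lies in the kernel of \<phi> modulo h.\<close>

lemma kernel_trivial:
  assumes "\<And>a. a \<in> carrier A \<Longrightarrow> \<phi> (const A a) 0 = \<zero>\<^bsub>C\<^esub> \<Longrightarrow> a = \<zero>\<^bsub>A\<^esub>"
    and x: "x \<in> carrier (pseries N A)" "\<phi> x = \<zero>\<^bsub>pseries N C\<^esub>"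
  shows "x = \<zero>\<^bsub>pseries N A\<^esub>"
proof (rule A.series_eqI)
  fix n show "enat n < N \<Longrightarrow> x n = \<zero>\<^bsub>A.P\<^esub> n"
  proof (induction n rule: less_induct)
    case (less n)
    have "\<phi> (const A (x k)) (n - k) = \<zero>\<^bsub>C\<^esub>" if "k < n" for k
    proof -
      have "x k = \<zero>\<^bsub>A\<^esub>" using less that A.zero_nth by (metis enat_ord_simps(2) order.strict_trans)
      moreover have "const A \<zero>\<^bsub>A\<^esub> = \<zero>\<^bsub>A.P\<^esub>" by (auto simp: const_def A.zero_nth)
      ultimately show ?thesis by (simp add: C.zero_nth)
    qed
    then have "\<phi> x n = \<phi> (const A (x n)) (n - n)"
      unfolding coeff_formula[OF x(1) less.prems]
      using x by (intro C.A.finsum_single_index) auto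
    then have "\<phi> (const A (x n)) 0 = \<zero>\<^bsub>C\<^esub>"
      using x(2) by (simp add: C.zero_nth)
    then show ?case using assms(1) x(1) by (simp add: A.zero_nth)
  qed
qed (use x in auto)

text \<open>The coefficients of a preimage are chosen one after the other: x n corrects, by
  surjectivity modulo h, the error at order n left by the images of the earlier
  coefficients.\<close>

lemma surjective:
  assumes "\<And>c. c \<in> carrier C \<Longrightarrow> \<exists>a\<in>carrier A. \<phi> (const A a) 0 = c"
    and y: "y \<in> carrier (pseries N C)"
  shows "\<exists>x\<in>carrier (pseries N A). \<phi> x = y"
proof -
  \<comment> \<open>Recursive choice compares arbitrary functions f and g, whose values may lie
    outside the carrier; \<open>cut\<close> keeps the partial sums \<open>S\<close> inside C for all
    of them.\<close>
  define cut where "cut r = (if r \<in> carrier A then r else \<zero>\<^bsub>A\<^esub>)" for r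
  have cut [simp]: "cut r \<in> carrier A" "r \<in> carrier A \<Longrightarrow> cut r = r" for r
    by (auto simp: cut_def)
  define S where "S f n = (\<Oplus>\<^bsub>C\<^esub>k\<in>{..<n}. \<phi> (const A (cut (f k))) (n - k))" for f n
  \<comment> \<open>Beyond the truncation order nothing is to be corrected, and 0 is forced so that
    the chosen sequence lies in the truncated module.\<close>
  define R where "R f n r \<longleftrightarrow> r \<in> carrier A \<and>
      (if enat n < N then S f n \<oplus>\<^bsub>C\<^esub> \<phi> (const A r) 0 = y n else r = \<zero>\<^bsub>A\<^esub>)" for f and n :: nat and r
  have "\<exists>x. \<forall>n. R x n (x n)"
  proof (rule dependent_wellorder_choice)
    fix r and f g :: "nat \<Rightarrow> 'a" and n :: nat assume "\<And>k. k < n \<Longrightarrow> f k = g k"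
    then have "S f n = S g n" unfolding S_def by (intro C.A.finsum_cong') auto
    then show "R f n r = R g n r" by (simp add: R_def)
  next
    fix n f assume "\<And>k. k < n \<Longrightarrow> R f k (f k)"
    then have "S f n \<in> carrier C" by (auto simp: S_def R_def intro!: C.A.finsum_closed)
    then obtain a where "a \<in> carrier A" "\<phi> (const A a) 0 = y n \<ominus>\<^bsub>C\<^esub> S f n"
      using assms(1)[of "y n \<ominus>\<^bsub>C\<^esub> S f n"] y by auto
    then show "\<exists>r. R f n r"
      using y \<open>S f n \<in> carrier C\<close> C.A.add_minus_cancel[of "y n" "S f n"]
      by (intro exI[of _ "if enat n < N then a else \<zero>\<^bsub>A\<^esub>"]) (auto simp: R_def)
  qed
  then obtain x where x: "\<And>n. R x n (x n)" by blast
  have x': "x \<in> carrier A.P"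
    using x by (intro A.series_closedI) (auto simp: R_def)
  have "\<phi> x n = y n" if n: "enat n < N" for n
  proof -
    have "\<phi> x n = S x n \<oplus>\<^bsub>C\<^esub> \<phi> (const A (x n)) 0"
      unfolding coeff_formula[OF x' n] S_def lessThan_Suc_atMost[symmetric] lessThan_Suc
      using x' by (subst C.A.finsum_insert) (auto simp: C.A.a_comm)
    then show ?thesis using x[of n] n by (simp add: R_def)
  qed
  with x' y show ?thesis by (intro bexI[of _ x] C.series_eqI) auto
qed

end

section \<open>Uniqueness and existence of linear maps with given values on constants\<close>

lemma series_linear_map_eqI:
  assumes "series_linear_map A C N \<phi>" "series_linear_map A C N \<psi>"
    and "\<And>n. \<phi> (const A (x n)) = \<psi> (const A (x n))" and "x \<in> carrier (pseries N A)"
  shows "\<phi> x = \<psi> x"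
proof -
  interpret \<phi>: series_linear_map A C N \<phi> by fact
  interpret \<psi>: series_linear_map A C N \<psi> by fact
  show ?thesis
    by (rule \<phi>.C.series_eqI) (use assms(3,4) in \<open>auto simp: \<phi>.coeff_formula \<psi>.coeff_formula\<close>)
qed

text \<open>The right-hand side of \<open>coeff_formula\<close>, now taken as the definition of the
  extension of g.\<close>

definition series_ext :: "enat \<Rightarrow> ('f::field, 'a) module \<Rightarrow> ('f, 'c) module \<Rightarrow> ('a \<Rightarrow> nat \<Rightarrow> 'c) \<Rightarrow> (nat \<Rightarrow> 'a) \<Rightarrow> nat \<Rightarrow> 'c" where
  "series_ext N A C g x = trunc N C (\<lambda>n. \<Oplus>\<^bsub>C\<^esub>k\<in>{..n}. g (x k) (n - k))"

lemma series_ext_linear: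
  assumes "series_algebra A N" "series_algebra C N"
    and g: "g \<in> linear_maps A (restrict_scalars (pseries N C))"
  shows "series_linear_map A C N (series_ext N A C g)"
    and "\<And>a. a \<in> carrier A \<Longrightarrow> series_ext N A C g (const A a) = g a"
proof -
  interpret A: series_algebra A N by fact
  interpret C: series_algebra C N by fact
  have "linear_map A (restrict_scalars C.P) g"
    using A.A.assoc_algebra_axioms algebra_restrict_scalars[OF C.algebra_pseries] g
    by (intro linear_map.intro linear_map_axioms.intro)
  then interpret g: linear_map A "restrict_scalars C.P" g .
  have gP: "g a \<in> carrier C.P" if "a \<in> carrier A" for a using g.closed[OF that] by simp
  then have gC [simp]: "g a m \<in> carrier C" if "a \<in> carrier A" for a m using that by simp
  have "linear_map A C (\<lambda>a. g a m)" for m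
    using A.A.assoc_algebra_axioms C.A.assoc_algebra_axioms linear_maps_comp[OF g C.coeff_linear]
    by (intro linear_map.intro linear_map_axioms.intro)
  then interpret gm: linear_map A C "\<lambda>a. g a m" for m .
  show "series_linear_map A C N (series_ext N A C g)"
  proof (intro series_linear_map.intro series_linear_map_axioms.intro linear_mapsI assms(1,2))
    fix x y c assume x [simp]: "x \<in> carrier A.P"
    show "series_ext N A C g x \<in> carrier C.P"
      unfolding series_ext_def by (intro C.trunc_closed) auto
    show "series_ext N A C g (x \<oplus>\<^bsub>A.P\<^esub> y) = series_ext N A C g x \<oplus>\<^bsub>C.P\<^esub> series_ext N A C g y"
      if "y \<in> carrier A.P"
      using that by (intro ext) (simp add: series_ext_def trunc_nth A.add_nth C.add_nth gm.add C.A.finsum_addf)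
    show "series_ext N A C g (c \<odot>\<^bsub>A.P\<^esub> x) = c \<odot>\<^bsub>C.P\<^esub> series_ext N A C g x"
    proof (rule ext)
      fix n
      have le: "enat k < N" if "k \<le> n" "enat n < N" for k
        using that order.strict_trans1[of "enat k" "enat n" N] by simp
      show "series_ext N A C g (c \<odot>\<^bsub>A.P\<^esub> x) n = (c \<odot>\<^bsub>C.P\<^esub> series_ext N A C g x) n"
      proof (cases "enat n < N")
        case True
        have "series_ext N A C g (c \<odot>\<^bsub>A.P\<^esub> x) n = (\<Oplus>\<^bsub>C\<^esub>k\<in>{..n}. g ((c \<odot>\<^bsub>A.P\<^esub> x) k) (n - k))"
          using True by (simp add: series_ext_def trunc_nth)
        \<comment> \<open>The index n - k is rewritten as n - i - (k - i), so that the summand has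
          the form u i (k - i) and \<open>finsum_triangle\<close> can exchange the sums.\<close>
        also have "\<dots> = (\<Oplus>\<^bsub>C\<^esub>k\<in>{..n}. \<Oplus>\<^bsub>C\<^esub>i\<in>{..k}. fps_nth c i \<odot>\<^bsub>C\<^esub> g (x (k - i)) (n - i - (k - i)))"
        proof (intro C.A.finsum_cong' refl)
          fix k assume k: "k \<in> {..n}"
          have "g ((c \<odot>\<^bsub>A.P\<^esub> x) k) (n - k) = (\<Oplus>\<^bsub>C\<^esub>i\<in>{..k}. g (fps_nth c i \<odot>\<^bsub>A\<^esub> x (k - i)) (n - k))"
            using k True le by (simp add: A.smult_nth gm.finsum)
          also have "\<dots> = (\<Oplus>\<^bsub>C\<^esub>i\<in>{..k}. fps_nth c i \<odot>\<^bsub>C\<^esub> g (x (k - i)) (n - i - (k - i)))"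
            using k by (intro C.A.finsum_cong') (auto simp: gm.smult)
          finally show "g ((c \<odot>\<^bsub>A.P\<^esub> x) k) (n - k) =
              (\<Oplus>\<^bsub>C\<^esub>i\<in>{..k}. fps_nth c i \<odot>\<^bsub>C\<^esub> g (x (k - i)) (n - i - (k - i)))" .
        qed auto
        also have "\<dots> = (\<Oplus>\<^bsub>C\<^esub>i\<in>{..n}. \<Oplus>\<^bsub>C\<^esub>j\<in>{..n - i}. fps_nth c i \<odot>\<^bsub>C\<^esub> g (x j) (n - i - j))"
          by (rule C.A.finsum_triangle) simp
        also have "\<dots> = (\<Oplus>\<^bsub>C\<^esub>i\<in>{..n}. fps_nth c i \<odot>\<^bsub>C\<^esub> series_ext N A C g x (n - i))"
          using True le by (intro C.A.finsum_cong') (auto simp: series_ext_def trunc_nth C.A.smult_finsum)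
        also have "\<dots> = (c \<odot>\<^bsub>C.P\<^esub> series_ext N A C g x) n"
          using True by (simp add: C.smult_nth)
        finally show ?thesis .
      qed (simp add: C.smult_nth series_ext_def trunc_nth)
    qed
  qed
  show "series_ext N A C g (const A a) = g a" if a: "a \<in> carrier A" for a
  proof (rule ext)
    fix n
    have "(\<Oplus>\<^bsub>C\<^esub>k\<in>{..n}. g (const A a k) (n - k)) = g (const A a 0) (n - 0)"
      using a by (intro C.A.finsum_single_index) (auto simp: const_def C.zero_nth)
    then show "series_ext N A C g (const A a) n = g a n"
      using gP[OF a] by (simp add: series_ext_def trunc_nth C.coeff_eq_zero)
  qed
qed

lemma linear_mapI:
  "assoc_algebra A \<Longrightarrow> assoc_algebra B \<Longrightarrow> \<phi> \<in> linear_maps A B \<Longrightarrow> linear_map A B \<phi>"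
  by (intro linear_map.intro linear_map_axioms.intro)

lemma series_linear_mapI:
  "series_algebra A N \<Longrightarrow> series_algebra C N \<Longrightarrow> \<phi> \<in> linear_maps (pseries N A) (pseries N C) \<Longrightarrow>
     series_linear_map A C N \<phi>"
  by (intro series_linear_map.intro series_linear_map_axioms.intro)

lemma linear_maps_restrict_scalars:
  "\<phi> \<in> linear_maps A B \<Longrightarrow> \<phi> \<in> linear_maps (restrict_scalars A) (restrict_scalars B)"
  by (auto simp: linear_maps_def)

section \<open>The first isomorphism theorem for algebras\<close>

lemma alg_iso_quotient:
  assumes "assoc_algebra A" "assoc_algebra B" and h: "h \<in> alg_hom A B"
    and surj: "h ` carrier A = carrier B" and I: "I = {x \<in> carrier A. h x = \<zero>\<^bsub>B\<^esub>}"
  shows "\<exists>f\<in>alg_iso (alg_quot A I) B. \<forall>x\<in>carrier A. f (I +>\<^bsub>A\<^esub> x) = h x"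
proof -
  interpret h: linear_map A B h
    using assms(1,2) h by (intro linear_mapI) (auto simp: alg_hom_def)
  have hom: "h \<in> ring_hom A B" using h by (simp add: alg_hom_def)
  have "ring_hom_ring A B h"
    using hom h.A.ring_axioms h.B.ring_axioms by (rule ring_hom_ringI2[rotated 2])
  then have "ideal I A"
    using ring_hom_ring.kernel_is_ideal[of A B h] unfolding I a_kernel_def' by blast
  then interpret I: algebra_ideal A I
    using assms(1) by (intro algebra_ideal.intro)
  obtain f where f: "f \<in> linear_maps (alg_quot A I) B" "\<And>x. x \<in> carrier A \<Longrightarrow> f (I +>\<^bsub>A\<^esub> x) = h x"
  proof (rule I.linear_map_factors[OF assms(2) h.linear])
    show "h x = \<zero>\<^bsub>B\<^esub>" if "x \<in> I" for x using that unfolding I by blast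
  qed blast
  have "f \<in> ring_hom (alg_quot A I) B"
    by (rule ring_hom_memI)
       (auto elim!: I.coset_cases simp: I.coset_simps f(2) h.add ring_hom_mult[OF hom] ring_hom_one[OF hom])
  moreover have "inj_on f (carrier (alg_quot A I))"
  proof (rule inj_onI)
    fix X Y assume "X \<in> carrier (alg_quot A I)" "Y \<in> carrier (alg_quot A I)" and eq: "f X = f Y"
    then obtain x y where xy: "x \<in> carrier A" "X = I +>\<^bsub>A\<^esub> x" "y \<in> carrier A" "Y = I +>\<^bsub>A\<^esub> y"
      by (metis I.coset_cases)
    then have "h x = h y" using eq f(2) by metis
    then have "x \<ominus>\<^bsub>A\<^esub> y \<in> I"
      using xy(1,3) unfolding I by (simp add: h.diff h.B.minus_eq_zero_iff)
    then show "X = Y" using xy I.coset_eq_iff by simp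
  qed
  moreover have "f ` carrier (alg_quot A I) = carrier B"
  proof -
    have "carrier (alg_quot A I) = (\<lambda>x. I +>\<^bsub>A\<^esub> x) ` carrier A"
      using I.coset_closed by (auto elim: I.coset_cases)
    then have "f ` carrier (alg_quot A I) = h ` carrier A"
      using f(2) by (auto simp: image_iff)
    then show ?thesis using surj by simp
  qed
  ultimately have "f \<in> alg_iso (alg_quot A I) B"
    using f(1) by (auto simp: alg_iso_def ring_iso_def bij_betw_def)
  then show ?thesis using f(2) by blast
qed

section \<open>Averages over all orders\<close>

text \<open>Every summand of an average is a product along some word, so h has to respect such
  products only. This applies to F, to the map taking the constant term, and to the coset map of
  T(V).\<close>

lemma sym_average_hom:
  assumes "linear_map A B h" and j: "\<And>x. j x \<in> carrier A"
    and h: "\<And>as. h (list_mult A (map j as)) = list_mult B (map k as)"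
  shows "h (sym_average A j as) = sym_average B k as"
proof -
  interpret h: linear_map A B h by fact
  have [simp]: "list_mult A (map (\<lambda>i. j (as ! p i)) [0..<n]) \<in> carrier A" for p n
    using j by (intro h.A.list_mult_closed) auto
  have "h (list_mult A (map (\<lambda>i. j (as ! p i)) [0..<n])) = list_mult B (map (\<lambda>i. k (as ! p i)) [0..<n])" for p n
    using h[of "map (\<lambda>i. as ! p i) [0..<n]"] by (simp add: comp_def)
  then show ?thesis
    by (simp add: sym_average_def h.smult h.finsum)
qed

lemma (in assoc_algebra) list_mult_commuting_insert:
  assumes q: "\<And>x. q x \<in> carrier A" and comm: "\<And>x y. q x \<otimes> q y = q y \<otimes> q x"
  shows "list_mult A (map q (as @ x # bs)) = q x \<otimes> list_mult A (map q (as @ bs))"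
proof (induction as)
  case (Cons a as)
  have [simp]: "list_mult A (map q cs) \<in> carrier A" for cs
    using q by (intro list_mult_closed) auto
  have "list_mult A (map q ((a # as) @ x # bs)) = (q a \<otimes> q x) \<otimes> list_mult A (map q (as @ bs))"
    using Cons q by (simp add: m_assoc del: map_append)
  also have "\<dots> = q x \<otimes> list_mult A (map q ((a # as) @ bs))"
    unfolding comm[of a x] using q by (simp add: m_assoc del: map_append)
  finally show ?case .
qed simp

lemma (in assoc_algebra) list_mult_commuting_mset:
  assumes "\<And>x. q x \<in> carrier A" "\<And>x y. q x \<otimes> q y = q y \<otimes> q x" "mset as = mset bs"
  shows "list_mult A (map q as) = list_mult A (map q bs)"
  using assms(3)
proof (induction as arbitrary: bs)
  case (Cons a as)
  then obtain us vs where bs: "bs = us @ a # vs"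
    by (metis list.set_intros(1) set_mset_mset split_list)
  then have "list_mult A (map q as) = list_mult A (map q (us @ vs))"
    using Cons.prems by (intro Cons.IH) simp
  then show ?case
    using list_mult_commuting_insert[of q us a vs, OF assms(1,2)] unfolding bs by simp
qed simp

text \<open>All summands coincide, and their number n! cancels against 1/n! in characteristic 0. B
  itself may be noncommutative as far as the lemma is concerned: only the letters must commute. It
  is used for S(V) and for a quotient of T(V).\<close>

lemma sym_average_commuting:
  assumes B: "assoc_algebra B" and q: "\<And>x. q x \<in> carrier B"
    and comm: "\<And>x y. q x \<otimes>\<^bsub>B\<^esub> q y = q y \<otimes>\<^bsub>B\<^esub> q x"
  shows "sym_average B q as = list_mult B (map q as)"
proof -
  interpret B: assoc_algebra B by fact
  let ?P = "{p. p permutes {..<length as}}"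
  have [simp]: "list_mult B (map q as) \<in> carrier B"
    using q by (intro B.list_mult_closed) auto
  have "(\<Oplus>\<^bsub>B\<^esub>p\<in>?P. list_mult B (map (\<lambda>i. q (as ! p i)) [0..<length as]))
      = (\<Oplus>\<^bsub>B\<^esub>p\<in>?P. 1 \<odot>\<^bsub>B\<^esub> list_mult B (map q as))"
  proof (intro B.finsum_cong' refl)
    fix p assume "p \<in> ?P"
    then have "mset (permute_list p as) = mset as" by simp
    then show "list_mult B (map (\<lambda>i. q (as ! p i)) [0..<length as]) = 1 \<odot>\<^bsub>B\<^esub> list_mult B (map q as)"
      using B.list_mult_commuting_mset[OF q comm, of "permute_list p as" as]
      by (simp add: permute_list_def comp_def)
  qed auto
  also have "\<dots> = of_nat (card ?P) \<odot>\<^bsub>B\<^esub> list_mult B (map q as)"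
    by (subst B.smult_sum_left[symmetric]) (auto simp: finite_permutations)
  also have "card ?P = fact (length as)"
    by (rule card_permutations) auto
  finally show ?thesis
    by (simp add: sym_average_def B.smult_smult)
qed

text \<open>Shows that the definite description in \<open>symmetrization\<close> denotes. The
  hypotheses \<open>same\<close> fit both targets: T(V)[[h]], and the star algebra, which differs
  from a series algebra only in multiplication and unit.\<close>

lemma symmetrization_properties:
  fixes scale :: "'f::field_char_0 \<Rightarrow> 'v::ab_group_add \<Rightarrow> 'v" and B :: "('f fps, nat \<Rightarrow> 'c) module"
  assumes N: "0 < N" and B: "assoc_algebra B" and C: "series_algebra C N"
    and same: "carrier B = carrier (pseries N C)" "add B = add (pseries N C)"
      "module.smult B = module.smult (pseries N C)"
    and j: "\<And>x. j x \<in> carrier B" "\<And>x y. j (x + y) = j x \<oplus>\<^bsub>B\<^esub> j y"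
      "\<And>c x. j (scale c x) = fps_const c \<odot>\<^bsub>B\<^esub> j x"
  shows "symmetrization scale N B j \<in> linear_maps (sym_series scale N) B"
    and "\<And>as. symmetrization scale N B j (const (sym_alg scale) (sym_word scale as))
      = sym_average (restrict_scalars B) j as"
proof -
  let ?S = "sym_alg scale"
  let ?Q = "\<lambda>\<phi>. \<phi> \<in> extensional (carrier (sym_series scale N)) \<and> \<phi> \<in> linear_maps (sym_series scale N) B
    \<and> (\<forall>as. \<phi> (const ?S (sym_word scale as)) = sym_average (restrict_scalars B) j as)"
  interpret S: series_algebra ?S N
    using N algebra_sym_alg by (intro series_algebra.intro series_algebra_axioms.intro)
  interpret C: series_algebra C N by fact
  have lin: "linear_maps X B = linear_maps X (pseries N C)" for X :: "('f fps, nat \<Rightarrow> ('f,'v) sym) module"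
    using same by (rule linear_maps_cong)
  have lin': "linear_maps X (restrict_scalars B) = linear_maps X (restrict_scalars (pseries N C))"
    for X :: "('f, ('f,'v) sym) module"
    using same by (intro linear_maps_cong) auto
  have word: "sym_word scale as \<in> carrier ?S" for as
    by (rule S.A.list_mult_closed) auto
  obtain \<psi> where \<psi>: "\<psi> \<in> linear_maps ?S (restrict_scalars B)"
    "\<And>as. \<psi> (sym_word scale as) = sym_average (restrict_scalars B) j as"
    using sym_average_ext[OF algebra_restrict_scalars[OF B], of j scale] j by auto
  \<comment> \<open>The restriction meets the extensionality clause of the description; without that
    clause values off the carrier would spoil uniqueness.\<close>
  define \<phi> where "\<phi> = restrict (series_ext N ?S C \<psi>) (carrier (sym_series scale N))"
  note ext = series_ext_linear[OF S.series_algebra_axioms C \<psi>(1)[unfolded lin']]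
  have "\<phi> \<in> linear_maps (sym_series scale N) (pseries N C)"
    using series_linear_map.linear[OF ext(1)] by (auto simp: \<phi>_def linear_maps_def)
  then have \<phi>: "?Q \<phi>"
    using ext(2) word \<psi>(2) by (auto simp: \<phi>_def lin)
  \<comment> \<open>Words determine the map on constants by linearity over the field, and constants
    determine it on series by \<open>coeff_formula\<close>.\<close>
  moreover have "\<phi>' = \<phi>" if \<phi>': "?Q \<phi>'" for \<phi>'
  proof (rule extensionalityI)
    fix x assume x: "x \<in> carrier (sym_series scale N)"
    have slm: "series_linear_map ?S C N \<chi>" if "?Q \<chi>" for \<chi>
      using that S.series_algebra_axioms C unfolding lin by (intro series_linear_mapI) blast+
    have eq: "(\<lambda>p. \<phi>' (const ?S p)) p = (\<lambda>p. \<phi> (const ?S p)) p" if "p \<in> carrier ?S" for p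
    proof (rule sym_linear_eqI[OF algebra_restrict_scalars[OF B] _ _ _ that])
      have "(\<lambda>p. \<chi> (const ?S p)) \<in> linear_maps ?S (restrict_scalars B)" if "?Q \<chi>" for \<chi>
        using that linear_maps_comp[OF S.const_linear linear_maps_restrict_scalars, of \<chi> B] by blast
      then show "(\<lambda>p. \<phi>' (const ?S p)) \<in> linear_maps ?S (restrict_scalars B)"
        "(\<lambda>p. \<phi> (const ?S p)) \<in> linear_maps ?S (restrict_scalars B)"
        using \<phi> \<phi>' by blast+
    qed (use \<phi> \<phi>' in simp)
    show "\<phi>' x = \<phi> x"
      using eq[OF S.coeff_closed[OF x]] x by (rule series_linear_map_eqI[OF slm[OF \<phi>'] slm[OF \<phi>]])
  qed (use \<phi> \<phi>' in auto)
  ultimately have "(THE \<phi>. ?Q \<phi>) = \<phi>" by (rule the_equality)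
  then have "symmetrization scale N B j = \<phi>"
    by (simp add: symmetrization_def sym_average_def)
  then show "symmetrization scale N B j \<in> linear_maps (sym_series scale N) B"
    "\<And>as. symmetrization scale N B j (const ?S (sym_word scale as)) = sym_average (restrict_scalars B) j as"
    using \<phi> by auto
qed

section \<open>The algebra of a deformation\<close>

lemma star_alg_sel:
  "carrier (star_alg scale N star) = carrier (sym_series scale N)"
  "monoid.mult (star_alg scale N star) = (\<lambda>x y. trunc N (sym_alg scale) (star x y))"
  "zero (star_alg scale N star) = zero (sym_series scale N)"
  "add (star_alg scale N star) = add (sym_series scale N)"
  "module.smult (star_alg scale N star) = module.smult (sym_series scale N)"
  by (simp_all add: star_alg_def)

lemma linear_maps_star_alg:
  "linear_maps A (star_alg scale N star) = linear_maps A (sym_series scale N)"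
  by (rule linear_maps_cong) (simp_all add: star_alg_sel)

locale star_deformation =
  fixes scale :: "'f::field_char_0 \<Rightarrow> 'v::ab_group_add \<Rightarrow> 'v"
    and star :: "('f, 'v) star"
    and N :: enat
  assumes N: "0 < N" and deformation: "deformation scale N star"
begin

abbreviation "SA \<equiv> sym_alg scale"
abbreviation "SB \<equiv> star_alg scale N star"
abbreviation "SP \<equiv> sym_series scale N"

sublocale S: series_algebra SA N
  using N by (intro series_algebra.intro series_algebra_axioms.intro algebra_sym_alg)

sublocale S_inf: series_algebra SA \<infinity>
  by (intro series_algebra.intro series_algebra_axioms.intro) (simp_all add: algebra_sym_alg)

lemma series_inf_closed: "x \<in> UNIV \<rightarrow> carrier SA \<Longrightarrow> x \<in> carrier (sym_series scale \<infinity>)"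
  by (rule S_inf.series_closedI) auto

lemma star_linear:
  assumes "y \<in> UNIV \<rightarrow> carrier SA"
  shows "series_linear_map SA SA \<infinity> (\<lambda>x. star x y)" "series_linear_map SA SA \<infinity> (\<lambda>x. star y x)"
  using deformation series_inf_closed[OF assms] S_inf.series_algebra_axioms
  by (auto intro!: series_linear_mapI simp: deformation_def)

lemma star_closed:
  assumes "x \<in> UNIV \<rightarrow> carrier SA" "y \<in> UNIV \<rightarrow> carrier SA"
  shows "star x y \<in> UNIV \<rightarrow> carrier SA"
proof -
  interpret l: series_linear_map SA SA \<infinity> "\<lambda>x. star x y" using assms(2) by (rule star_linear)
  show ?thesis using l.closed series_inf_closed[OF assms(1)] S_inf.coeffs_closed by blast
qed

text \<open>By bilinearity over \<open>F[[h]]\<close>, coefficient n of a star product depends only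
  on coefficients up to n of each factor (\<open>coeff_cong\<close>). Hence the product descends to
  series modulo h^N.\<close>

lemma star_trunc:
  assumes x: "x \<in> UNIV \<rightarrow> carrier SA" and y: "y \<in> UNIV \<rightarrow> carrier SA"
  shows "trunc N SA (star (trunc N SA x) y) = trunc N SA (star x y)"
    and "trunc N SA (star y (trunc N SA x)) = trunc N SA (star y x)"
proof -
  interpret l: series_linear_map SA SA \<infinity> "\<lambda>x. star x y" using y by (rule star_linear)
  interpret r: series_linear_map SA SA \<infinity> "\<lambda>x. star y x" using y by (rule star_linear)
  have t: "trunc N SA x \<in> carrier (sym_series scale \<infinity>)"
    using x by (intro series_inf_closed) (auto simp: trunc_nth)
  have tr: "trunc N SA x k = x k" if "enat n < N" "k \<le> n" for n k
    using that order.strict_trans1[of "enat k" "enat n" N] by (simp add: trunc_nth)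
  have "star (trunc N SA x) y n = star x y n" "star y (trunc N SA x) n = star y x n" if "enat n < N" for n
    using l.coeff_cong[OF t series_inf_closed[OF x], of n] r.coeff_cong[OF t series_inf_closed[OF x], of n]
      tr[OF that] by auto
  then have "trunc N SA (star (trunc N SA x) y) n = trunc N SA (star x y) n"
    "trunc N SA (star y (trunc N SA x)) n = trunc N SA (star y x) n" for n
    by (simp_all add: trunc_nth[of _ _ "star _ _"])
  then show "trunc N SA (star (trunc N SA x) y) = trunc N SA (star x y)"
    "trunc N SA (star y (trunc N SA x)) = trunc N SA (star y x)"
    by (simp_all only: fun_eq_iff simp_thms)
qed

lemma trunc_smult:
  assumes "x \<in> UNIV \<rightarrow> carrier SA"
  shows "trunc N SA (c \<odot>\<^bsub>sym_series scale \<infinity>\<^esub> x) = c \<odot>\<^bsub>SP\<^esub> trunc N SA x"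
proof
  fix n
  have tr: "trunc N SA x k = x k" if "enat n < N" "k \<le> n" for k
    using that order.strict_trans1[of "enat k" "enat n" N] by (simp add: trunc_nth)
  show "trunc N SA (c \<odot>\<^bsub>sym_series scale \<infinity>\<^esub> x) n = (c \<odot>\<^bsub>SP\<^esub> trunc N SA x) n"
    using assms by (auto simp: trunc_nth[of _ _ "c \<odot>\<^bsub>sym_series scale \<infinity>\<^esub> x"] S.smult_nth S_inf.smult_nth tr Pi_iff
      intro!: S.A.finsum_cong')
qed

lemma star_alg_mult_linear:
  assumes y: "y \<in> carrier SP"
  shows "series_linear_map SA SA N (\<lambda>x. x \<otimes>\<^bsub>SB\<^esub> y)" "series_linear_map SA SA N (\<lambda>x. y \<otimes>\<^bsub>SB\<^esub> x)"
proof -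
  have y' [simp]: "y \<in> UNIV \<rightarrow> carrier SA" using y by simp
  interpret l: series_linear_map SA SA \<infinity> "\<lambda>x. star x y" using y' by (rule star_linear)
  interpret r: series_linear_map SA SA \<infinity> "\<lambda>x. star y x" using y' by (rule star_linear)
  have inf: "x \<in> carrier (sym_series scale \<infinity>)" if "x \<in> carrier SP" for x
    using that by (intro series_inf_closed) simp
  have add: "x \<oplus>\<^bsub>SP\<^esub> z = x \<oplus>\<^bsub>sym_series scale \<infinity>\<^esub> z" for x z
    by (simp add: pseries_sel(5))
  have tadd: "trunc N SA (x \<oplus>\<^bsub>sym_series scale \<infinity>\<^esub> z) = trunc N SA x \<oplus>\<^bsub>SP\<^esub> trunc N SA z" for x z
    by (rule ext) (simp add: trunc_nth S.add_nth S_inf.add_nth)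
  \<comment> \<open>Truncated series are themselves untruncated ones with the same addition; only
    the scalar action differs, by a truncation.\<close>
  have smult: "c \<odot>\<^bsub>SP\<^esub> x = trunc N SA (c \<odot>\<^bsub>sym_series scale \<infinity>\<^esub> x)" if "x \<in> carrier SP" for c x
    using trunc_smult[of x c] that by simp
  have smult_inf: "c \<odot>\<^bsub>sym_series scale \<infinity>\<^esub> x \<in> UNIV \<rightarrow> carrier SA" if "x \<in> carrier SP" for c x
    using inf[OF that] by (intro S_inf.coeffs_closed S_inf.P.smult_closed)
  show "series_linear_map SA SA N (\<lambda>x. x \<otimes>\<^bsub>SB\<^esub> y)"
  proof (intro series_linear_mapI S.series_algebra_axioms linear_mapsI)
    fix x z c assume x [simp]: "x \<in> carrier SP"
    show "x \<otimes>\<^bsub>SB\<^esub> y \<in> carrier SP"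
      unfolding star_alg_sel(2) by (intro S.trunc_closed star_closed) simp_all
    show "(x \<oplus>\<^bsub>SP\<^esub> z) \<otimes>\<^bsub>SB\<^esub> y = x \<otimes>\<^bsub>SB\<^esub> y \<oplus>\<^bsub>SP\<^esub> z \<otimes>\<^bsub>SB\<^esub> y"
      if "z \<in> carrier SP"
      unfolding star_alg_sel(2) add[of x z] l.add[OF inf[OF x] inf[OF that]] by (rule tadd)
    show "(c \<odot>\<^bsub>SP\<^esub> x) \<otimes>\<^bsub>SB\<^esub> y = c \<odot>\<^bsub>SP\<^esub> (x \<otimes>\<^bsub>SB\<^esub> y)"
      unfolding star_alg_sel(2) smult[OF x] star_trunc(1)[OF smult_inf[OF x] y'] l.smult[OF inf[OF x]]
      by (intro trunc_smult star_closed) simp_all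
  qed
  show "series_linear_map SA SA N (\<lambda>x. y \<otimes>\<^bsub>SB\<^esub> x)"
  proof (intro series_linear_mapI S.series_algebra_axioms linear_mapsI)
    fix x z c assume x [simp]: "x \<in> carrier SP"
    show "y \<otimes>\<^bsub>SB\<^esub> x \<in> carrier SP"
      unfolding star_alg_sel(2) by (intro S.trunc_closed star_closed) simp_all
    show "y \<otimes>\<^bsub>SB\<^esub> (x \<oplus>\<^bsub>SP\<^esub> z) = y \<otimes>\<^bsub>SB\<^esub> x \<oplus>\<^bsub>SP\<^esub> y \<otimes>\<^bsub>SB\<^esub> z"
      if "z \<in> carrier SP"
      unfolding star_alg_sel(2) add[of x z] r.add[OF inf[OF x] inf[OF that]] by (rule tadd)
    show "y \<otimes>\<^bsub>SB\<^esub> (c \<odot>\<^bsub>SP\<^esub> x) = c \<odot>\<^bsub>SP\<^esub> (y \<otimes>\<^bsub>SB\<^esub> x)"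
      unfolding star_alg_sel(2) smult[OF x] star_trunc(2)[OF smult_inf[OF x] y'] r.smult[OF inf[OF x]]
      by (intro trunc_smult star_closed) simp_all
  qed
qed

text \<open>The deformation axiom speaks of constants only; linearity in each factor allows both to
  be replaced by their constant terms modulo h.\<close>

lemma star_alg_mult_0:
  assumes x: "x \<in> carrier SP" and y: "y \<in> carrier SP"
  shows "(x \<otimes>\<^bsub>SB\<^esub> y) 0 = x 0 \<otimes>\<^bsub>SA\<^esub> y 0"
proof -
  interpret l: series_linear_map SA SA N "\<lambda>x. x \<otimes>\<^bsub>SB\<^esub> y" using y by (rule star_alg_mult_linear)
  interpret r: series_linear_map SA SA N "\<lambda>y. const SA (x 0) \<otimes>\<^bsub>SB\<^esub> y"
    using x by (intro star_alg_mult_linear) auto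
  have "(x \<otimes>\<^bsub>SB\<^esub> y) 0 = (const SA (x 0) \<otimes>\<^bsub>SB\<^esub> const SA (y 0)) 0"
    using l.coeff_0[OF x] r.coeff_0[OF y] by simp
  also have "\<dots> = x 0 \<otimes>\<^bsub>SA\<^esub> y 0"
    using deformation x y N by (simp add: star_alg_sel trunc_nth deformation_def flip: zero_enat_def)
  finally show ?thesis .
qed

lemma star_alg_mult_closed: "x \<in> carrier SP \<Longrightarrow> y \<in> carrier SP \<Longrightarrow> x \<otimes>\<^bsub>SB\<^esub> y \<in> carrier SP"
  unfolding star_alg_sel(2) by (intro S.trunc_closed star_closed S.coeffs_closed)

lemma star_alg_mult_assoc:
  assumes "x \<in> carrier SP" "y \<in> carrier SP" "z \<in> carrier SP"
  shows "(x \<otimes>\<^bsub>SB\<^esub> y) \<otimes>\<^bsub>SB\<^esub> z = x \<otimes>\<^bsub>SB\<^esub> (y \<otimes>\<^bsub>SB\<^esub> z)"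
proof -
  note c = assms[THEN S.coeffs_closed]
  have "trunc N SA (star (star x y) z) = trunc N SA (star x (star y z))"
    using deformation c[THEN series_inf_closed] unfolding deformation_def by blast
  then show ?thesis
    unfolding star_alg_sel(2) star_trunc(1)[OF star_closed[OF c(1,2)] c(3)]
      star_trunc(2)[OF star_closed[OF c(2,3)] c(1)] .
qed

text \<open>Left and right star-multiplication by the constant 1 are the identity modulo h, hence
  surjective and injective. Solve 1 star e = 1; then 1 star (e star x) = 1 star x, and cancelling 1
  makes e a left unit. The mirrored argument gives a right unit e', and the two coincide.\<close>

lemma star_alg_unit_exists:
  obtains e where "e \<in> carrier SP" "\<And>x. x \<in> carrier SP \<Longrightarrow> e \<otimes>\<^bsub>SB\<^esub> x = x \<and> x \<otimes>\<^bsub>SB\<^esub> e = x"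
proof -
  let ?i = "const SA \<one>\<^bsub>SA\<^esub>"
  have i: "?i \<in> carrier SP" by auto
  interpret r: series_linear_map SA SA N "\<lambda>x. ?i \<otimes>\<^bsub>SB\<^esub> x" using i by (rule star_alg_mult_linear)
  interpret l: series_linear_map SA SA N "\<lambda>x. x \<otimes>\<^bsub>SB\<^esub> ?i" using i by (rule star_alg_mult_linear)
  have i0: "(?i \<otimes>\<^bsub>SB\<^esub> const SA a) 0 = a" "(const SA a \<otimes>\<^bsub>SB\<^esub> ?i) 0 = a" if "a \<in> carrier SA" for a
    using that i by (simp_all add: star_alg_mult_0)
  obtain e where e: "e \<in> carrier SP" "?i \<otimes>\<^bsub>SB\<^esub> e = ?i"
    using r.surjective[OF _ i] i0 by blast
  obtain e' where e': "e' \<in> carrier SP" "e' \<otimes>\<^bsub>SB\<^esub> ?i = ?i"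
    using l.surjective[OF _ i] i0 by blast
  have ex: "e \<otimes>\<^bsub>SB\<^esub> x = x" if x: "x \<in> carrier SP" for x
  proof -
    have "?i \<otimes>\<^bsub>SB\<^esub> (e \<otimes>\<^bsub>SB\<^esub> x) = ?i \<otimes>\<^bsub>SB\<^esub> x"
      using star_alg_mult_assoc[OF i e(1) x] e(2) by simp
    then have "?i \<otimes>\<^bsub>SB\<^esub> (e \<otimes>\<^bsub>SB\<^esub> x \<ominus>\<^bsub>SP\<^esub> x) = \<zero>\<^bsub>SP\<^esub>"
      using r.diff[of "e \<otimes>\<^bsub>SB\<^esub> x" x] x e(1) star_alg_mult_closed r.closed
      by (simp add: S.P.minus_eq_zero_iff)
    then have "e \<otimes>\<^bsub>SB\<^esub> x \<ominus>\<^bsub>SP\<^esub> x = \<zero>\<^bsub>SP\<^esub>"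
    proof (rule r.kernel_trivial[rotated 2])
      show "e \<otimes>\<^bsub>SB\<^esub> x \<ominus>\<^bsub>SP\<^esub> x \<in> carrier SP"
        using x e(1) star_alg_mult_closed by simp
    qed (simp add: i0)
    then show ?thesis
      using x e(1) star_alg_mult_closed by (simp add: S.P.minus_eq_zero_iff)
  qed
  have e'x: "x \<otimes>\<^bsub>SB\<^esub> e' = x" if x: "x \<in> carrier SP" for x
  proof -
    have "(x \<otimes>\<^bsub>SB\<^esub> e') \<otimes>\<^bsub>SB\<^esub> ?i = x \<otimes>\<^bsub>SB\<^esub> ?i"
      using star_alg_mult_assoc[OF x e'(1) i] e'(2) by simp
    then have "(x \<otimes>\<^bsub>SB\<^esub> e' \<ominus>\<^bsub>SP\<^esub> x) \<otimes>\<^bsub>SB\<^esub> ?i = \<zero>\<^bsub>SP\<^esub>"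
      using l.diff[of "x \<otimes>\<^bsub>SB\<^esub> e'" x] x e'(1) star_alg_mult_closed l.closed
      by (simp add: S.P.minus_eq_zero_iff)
    then have "x \<otimes>\<^bsub>SB\<^esub> e' \<ominus>\<^bsub>SP\<^esub> x = \<zero>\<^bsub>SP\<^esub>"
    proof (rule l.kernel_trivial[rotated 2])
      show "x \<otimes>\<^bsub>SB\<^esub> e' \<ominus>\<^bsub>SP\<^esub> x \<in> carrier SP"
        using x e'(1) star_alg_mult_closed by simp
    qed (simp add: i0)
    then show ?thesis
      using x e'(1) star_alg_mult_closed by (simp add: S.P.minus_eq_zero_iff)
  qed
  have "e = e'" using ex[OF e'(1)] e'x[OF e(1)] by simp
  then show thesis using that e(1) ex e'x by blast
qed

lemma star_alg_one:
  "\<one>\<^bsub>SB\<^esub> \<in> carrier SP" "x \<in> carrier SP \<Longrightarrow> \<one>\<^bsub>SB\<^esub> \<otimes>\<^bsub>SB\<^esub> x = x" "x \<in> carrier SP \<Longrightarrow> x \<otimes>\<^bsub>SB\<^esub> \<one>\<^bsub>SB\<^esub> = x"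
proof -
  let ?Q = "\<lambda>u. u \<in> carrier SP \<and> (\<forall>x\<in>carrier SP. u \<otimes>\<^bsub>SB\<^esub> x = x \<and> x \<otimes>\<^bsub>SB\<^esub> u = x)"
  obtain e where e: "?Q e" using star_alg_unit_exists by metis
  then have "\<And>u. ?Q u \<Longrightarrow> u = e" by metis
  with e have "?Q (THE u. ?Q u)" by (rule theI)
  moreover have "\<one>\<^bsub>SB\<^esub> = (THE u. ?Q u)" by (simp add: star_alg_def)
  ultimately have "?Q \<one>\<^bsub>SB\<^esub>" by simp
  then show "\<one>\<^bsub>SB\<^esub> \<in> carrier SP" "x \<in> carrier SP \<Longrightarrow> \<one>\<^bsub>SB\<^esub> \<otimes>\<^bsub>SB\<^esub> x = x" "x \<in> carrier SP \<Longrightarrow> x \<otimes>\<^bsub>SB\<^esub> \<one>\<^bsub>SB\<^esub> = x"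
    by auto
qed

text \<open>The unit may differ from the constant 1 in higher orders. Its constant term is needed
  for the empty word, which F sends to the unit.\<close>

lemma star_alg_one_0: "\<one>\<^bsub>SB\<^esub> 0 = \<one>\<^bsub>SA\<^esub>"
proof -
  have "(\<one>\<^bsub>SB\<^esub> \<otimes>\<^bsub>SB\<^esub> const SA \<one>\<^bsub>SA\<^esub>) 0 = \<one>\<^bsub>SB\<^esub> 0 \<otimes>\<^bsub>SA\<^esub> \<one>\<^bsub>SA\<^esub>"
    by (subst star_alg_mult_0) (auto simp: star_alg_one(1))
  moreover have "\<one>\<^bsub>SB\<^esub> \<otimes>\<^bsub>SB\<^esub> const SA \<one>\<^bsub>SA\<^esub> = const SA \<one>\<^bsub>SA\<^esub>"
    by (intro star_alg_one(2)) auto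
  ultimately show ?thesis using star_alg_one(1) by simp
qed

lemma algebra_star_alg: "assoc_algebra SB"
proof -
  have l: "(x \<oplus>\<^bsub>SP\<^esub> z) \<otimes>\<^bsub>SB\<^esub> y = x \<otimes>\<^bsub>SB\<^esub> y \<oplus>\<^bsub>SP\<^esub> z \<otimes>\<^bsub>SB\<^esub> y"
    "(c \<odot>\<^bsub>SP\<^esub> x) \<otimes>\<^bsub>SB\<^esub> y = c \<odot>\<^bsub>SP\<^esub> (x \<otimes>\<^bsub>SB\<^esub> y)"
    "y \<otimes>\<^bsub>SB\<^esub> (x \<oplus>\<^bsub>SP\<^esub> z) = y \<otimes>\<^bsub>SB\<^esub> x \<oplus>\<^bsub>SP\<^esub> y \<otimes>\<^bsub>SB\<^esub> z"
    "y \<otimes>\<^bsub>SB\<^esub> (c \<odot>\<^bsub>SP\<^esub> x) = c \<odot>\<^bsub>SP\<^esub> (y \<otimes>\<^bsub>SB\<^esub> x)"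
    if "x \<in> carrier SP" "y \<in> carrier SP" "z \<in> carrier SP" for x y z c
  proof -
    interpret l: series_linear_map SA SA N "\<lambda>x. x \<otimes>\<^bsub>SB\<^esub> y" using that(2) by (rule star_alg_mult_linear)
    interpret r: series_linear_map SA SA N "\<lambda>x. y \<otimes>\<^bsub>SB\<^esub> x" using that(2) by (rule star_alg_mult_linear)
    show "(x \<oplus>\<^bsub>SP\<^esub> z) \<otimes>\<^bsub>SB\<^esub> y = x \<otimes>\<^bsub>SB\<^esub> y \<oplus>\<^bsub>SP\<^esub> z \<otimes>\<^bsub>SB\<^esub> y"
      "(c \<odot>\<^bsub>SP\<^esub> x) \<otimes>\<^bsub>SB\<^esub> y = c \<odot>\<^bsub>SP\<^esub> (x \<otimes>\<^bsub>SB\<^esub> y)"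
      "y \<otimes>\<^bsub>SB\<^esub> (x \<oplus>\<^bsub>SP\<^esub> z) = y \<otimes>\<^bsub>SB\<^esub> x \<oplus>\<^bsub>SP\<^esub> y \<otimes>\<^bsub>SB\<^esub> z"
      "y \<otimes>\<^bsub>SB\<^esub> (c \<odot>\<^bsub>SP\<^esub> x) = c \<odot>\<^bsub>SP\<^esub> (y \<otimes>\<^bsub>SB\<^esub> x)"
      using that by (simp_all add: l.add l.smult r.add r.smult)
  qed
  have "ring SB"
  proof (rule ringI)
    show "abelian_group SB"
      by (rule abelian_groupI)
         (auto simp: star_alg_sel(1,3,4) S.P.a_ac intro: bexI[of _ "\<ominus>\<^bsub>SP\<^esub> _"] S.P.l_neg)
    show "monoid SB"
      by (rule monoidI)
         (auto simp: star_alg_sel(1) star_alg_mult_closed star_alg_one star_alg_mult_assoc)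
  qed (auto simp: star_alg_sel(1,4) l)
  then show ?thesis
    by (intro assoc_algebra.intro assoc_algebra_axioms.intro)
       (auto simp: star_alg_sel(1,4,5) l S.P.smult_l_distr S.P.smult_r_distr S.P.smult_smult)
qed

end

section \<open>The homomorphism from the tensor algebra\<close>

lemma ring_hom_list_mult:
  assumes "assoc_algebra A" "h \<in> ring_hom A B" "set xs \<subseteq> carrier A"
  shows "h (list_mult A xs) = list_mult B (map h xs)"
proof -
  interpret A: assoc_algebra A by fact
  show ?thesis
    using assms(3)
    by (induction xs) (auto simp: ring_hom_mult[OF assms(2)] ring_hom_one[OF assms(2)])
qed

context star_deformation
begin

abbreviation "TA \<equiv> tensor_alg scale"
abbreviation "TP \<equiv> tensor_series scale N"

sublocale T: series_algebra TA N
  using N by (intro series_algebra.intro series_algebra_axioms.intro algebra_tensor_alg)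

sublocale B: assoc_algebra SB
  by (rule algebra_star_alg)

lemma gen_closed [simp]: "tensor_gen scale x \<in> carrier TP" "sym_gen scale x \<in> carrier SP"
  by (auto simp: tensor_gen_def sym_gen_def)

lemma sym_gen_closed_star [simp]: "sym_gen scale x \<in> carrier SB"
  by (simp add: star_alg_sel(1))

lemma tensor_gen_add: "tensor_gen scale (x + y) = tensor_gen scale x \<oplus>\<^bsub>TP\<^esub> tensor_gen scale y"
  and tensor_gen_smult: "tensor_gen scale (scale c x) = fps_const c \<odot>\<^bsub>TP\<^esub> tensor_gen scale x"
  by (simp_all add: tensor_gen_def tensor_incl_add tensor_incl_smult T.const_add T.const_smult)

lemma sym_gen_add: "sym_gen scale (x + y) = sym_gen scale x \<oplus>\<^bsub>SB\<^esub> sym_gen scale y"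
  and sym_gen_smult: "sym_gen scale (scale c x) = fps_const c \<odot>\<^bsub>SB\<^esub> sym_gen scale x"
  by (simp_all add: sym_gen_def sym_incl_add sym_incl_smult S.const_add S.const_smult star_alg_sel(4,5))

lemma words_closed [simp]: "tensor_word scale as \<in> carrier TA" "sym_word scale as \<in> carrier SA"
  by (auto intro!: T.A.list_mult_closed S.A.list_mult_closed)

lemma tensor_gen_word: "list_mult TP (map (tensor_gen scale) as) = const TA (tensor_word scale as)"
  using T.list_mult_const[of "map (tensor_incl scale) as"] by (auto simp: comp_def tensor_gen_def[abs_def])

lemma tensor_symm_linear: "series_linear_map SA TA N (tensor_symm scale N)"
  and tensor_symm_word: "tensor_symm scale N (const SA (sym_word scale as))
    = sym_average (restrict_scalars TP) (tensor_gen scale) as"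
proof -
  note * = symmetrization_properties[OF N T.algebra_pseries T.series_algebra_axioms refl refl refl,
      of "tensor_gen scale" scale, OF gen_closed(1) tensor_gen_add tensor_gen_smult, folded tensor_symm_def]
  show "series_linear_map SA TA N (tensor_symm scale N)"
    using S.series_algebra_axioms T.series_algebra_axioms *(1) by (rule series_linear_mapI)
  show "tensor_symm scale N (const SA (sym_word scale as))
    = sym_average (restrict_scalars TP) (tensor_gen scale) as" by (rule *(2))
qed

lemma star_symm_linear: "series_linear_map SA SA N (star_symm scale N star)"
  and star_symm_word: "star_symm scale N star (const SA (sym_word scale as))
    = sym_average (restrict_scalars SB) (sym_gen scale) as"
proof -
  note * = symmetrization_properties[OF N algebra_star_alg S.series_algebra_axioms star_alg_sel(1,4,5),
      of "sym_gen scale" scale, OF sym_gen_closed_star sym_gen_add sym_gen_smult,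
      folded star_symm_def, unfolded linear_maps_star_alg]
  show "series_linear_map SA SA N (star_symm scale N star)"
    using S.series_algebra_axioms S.series_algebra_axioms *(1) by (rule series_linear_mapI)
  show "star_symm scale N star (const SA (sym_word scale as))
    = sym_average (restrict_scalars SB) (sym_gen scale) as" by (rule *(2))
qed

lemma star_alg_coeff_0_word: "list_mult SB (map (sym_gen scale) as) 0 = sym_word scale as"
proof (induction as)
  case (Cons a as)
  have "list_mult SB (map (sym_gen scale) as) \<in> carrier SP"
    using B.list_mult_closed[of "map (sym_gen scale) as"] by (auto simp: star_alg_sel(1) image_subset_iff)
  then show ?case
    using Cons by (simp add: star_alg_mult_0) (simp add: sym_gen_def)
qed (simp add: star_alg_one_0)

lemma restrict_star_alg_linear_maps:
  "linear_maps X (restrict_scalars SB) = linear_maps X (restrict_scalars SP)"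
  "linear_maps (restrict_scalars SB) Y = linear_maps (restrict_scalars SP) Y"
  by (rule linear_maps_cong; simp add: star_alg_sel)+

text \<open>This is F on constant series. The choice is harmless, since a linear map on T(V) is
  fixed by its values on words.\<close>

definition tensor_map :: "('f, 'v) tensor \<Rightarrow> nat \<Rightarrow> ('f, 'v) sym" where
  "tensor_map = (SOME g. g \<in> linear_maps TA (restrict_scalars SB) \<and>
     (\<forall>as. g (tensor_word scale as) = list_mult SB (map (sym_gen scale) as)))"

lemma tensor_map: "tensor_map \<in> linear_maps TA (restrict_scalars SB)"
  "tensor_map (tensor_word scale as) = list_mult SB (map (sym_gen scale) as)"
proof -
  obtain g where "g \<in> linear_maps TA (restrict_scalars SB)"
    "\<And>as. g (tensor_word scale as) = list_mult SB (map (sym_gen scale) as)"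
    using tensor_linear_ext[OF algebra_restrict_scalars[OF algebra_star_alg], of "sym_gen scale" scale]
      sym_gen_add sym_gen_smult by auto
  then have "\<exists>g. g \<in> linear_maps TA (restrict_scalars SB) \<and>
     (\<forall>as. g (tensor_word scale as) = list_mult SB (map (sym_gen scale) as))" by blast
  then have "tensor_map \<in> linear_maps TA (restrict_scalars SB) \<and>
     (\<forall>as. tensor_map (tensor_word scale as) = list_mult SB (map (sym_gen scale) as))"
    unfolding tensor_map_def by (rule someI_ex)
  then show "tensor_map \<in> linear_maps TA (restrict_scalars SB)"
    "tensor_map (tensor_word scale as) = list_mult SB (map (sym_gen scale) as)" by auto
qed

sublocale g: linear_map TA "restrict_scalars SB" tensor_map
  using algebra_tensor_alg algebra_restrict_scalars[OF algebra_star_alg] tensor_map(1)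
  by (rule linear_mapI)

text \<open>For two words the product is concatenation and the claim is associativity in the star
  algebra. Both sides are bilinear, so one argument at a time is extended from words to all
  tensors.\<close>

lemma tensor_map_mult:
  assumes a: "a \<in> carrier TA" and b: "b \<in> carrier TA"
  shows "tensor_map (a \<otimes>\<^bsub>TA\<^esub> b) = tensor_map a \<otimes>\<^bsub>SB\<^esub> tensor_map b"
proof -
  have gc: "tensor_map a \<in> carrier SB" if "a \<in> carrier TA" for a
    using g.closed[OF that] by simp
  have g_add: "tensor_map (x \<oplus>\<^bsub>TA\<^esub> y) = tensor_map x \<oplus>\<^bsub>SB\<^esub> tensor_map y"
    if "x \<in> carrier TA" "y \<in> carrier TA" for x y using g.add[OF that] by simp
  have g_smult: "tensor_map (c \<odot>\<^bsub>TA\<^esub> x) = fps_const c \<odot>\<^bsub>SB\<^esub> tensor_map x"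
    if "x \<in> carrier TA" for c x using g.smult[OF that] by simp
  note tensor_eqI = tensor_linear_eqI[OF algebra_restrict_scalars[OF algebra_star_alg]]
  have words: "tensor_map (tensor_word scale as \<otimes>\<^bsub>TA\<^esub> tensor_word scale bs)
      = tensor_map (tensor_word scale as) \<otimes>\<^bsub>SB\<^esub> tensor_map (tensor_word scale bs)" for as bs
  proof -
    have "tensor_word scale as \<otimes>\<^bsub>TA\<^esub> tensor_word scale bs = tensor_word scale (as @ bs)"
      unfolding map_append by (rule T.A.list_mult_append[symmetric]) auto
    moreover have "list_mult SB (map (sym_gen scale) (as @ bs)) =
        list_mult SB (map (sym_gen scale) as) \<otimes>\<^bsub>SB\<^esub> list_mult SB (map (sym_gen scale) bs)"
      unfolding map_append by (rule B.list_mult_append) auto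
    ultimately show ?thesis by (simp only: tensor_map(2))
  qed
  have lin: "(\<lambda>x. tensor_map (z \<otimes>\<^bsub>TA\<^esub> x)) \<in> linear_maps TA (restrict_scalars SB)"
    "(\<lambda>x. tensor_map (x \<otimes>\<^bsub>TA\<^esub> z)) \<in> linear_maps TA (restrict_scalars SB)"
    "(\<lambda>x. tensor_map z \<otimes>\<^bsub>SB\<^esub> tensor_map x) \<in> linear_maps TA (restrict_scalars SB)"
    "(\<lambda>x. tensor_map x \<otimes>\<^bsub>SB\<^esub> tensor_map z) \<in> linear_maps TA (restrict_scalars SB)"
    if "z \<in> carrier TA" for z
    using that by (intro linear_mapsI; simp add: gc g_add g_smult T.A.r_distr T.A.smult_mult_r
      T.A.l_distr T.A.smult_mult_l B.l_distr B.smult_mult_l B.r_distr B.smult_mult_r)+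
  have "tensor_map (tensor_word scale as \<otimes>\<^bsub>TA\<^esub> b) = tensor_map (tensor_word scale as) \<otimes>\<^bsub>SB\<^esub> tensor_map b" for as
    by (rule tensor_eqI[OF lin(1) lin(3) _ b]) (simp_all add: words)
  then show ?thesis
    by (intro tensor_eqI[OF lin(2)[OF b] lin(4)[OF b] _ a])
qed

section \<open>The homomorphism F on series: construction and uniqueness\<close>

definition F :: "(nat \<Rightarrow> ('f, 'v) tensor) \<Rightarrow> nat \<Rightarrow> ('f, 'v) sym" where
  "F = series_ext N TA SA tensor_map"

lemma F_linear: "series_linear_map TA SA N F"
  and F_const: "a \<in> carrier TA \<Longrightarrow> F (const TA a) = tensor_map a"
  unfolding F_def
  by (intro series_ext_linear[OF T.series_algebra_axioms S.series_algebra_axioms]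
        tensor_map(1)[unfolded restrict_star_alg_linear_maps])+

sublocale F: series_linear_map TA SA N F
  by (rule F_linear)

lemma F_word: "F (const TA (tensor_word scale as)) = list_mult SB (map (sym_gen scale) as)"
  by (simp add: F_const tensor_map(2))

text \<open>Both sides are linear over \<open>F[[h]]\<close> in each argument, which reduces the
  claim to constants, first in one factor and then in the other.\<close>

lemma F_mult:
  assumes x: "x \<in> carrier TP" and y: "y \<in> carrier TP"
  shows "F (x \<otimes>\<^bsub>TP\<^esub> y) = F x \<otimes>\<^bsub>SB\<^esub> F y"
proof -
  have left: "series_linear_map TA SA N (\<lambda>x. F (x \<otimes>\<^bsub>TP\<^esub> y))"
    "series_linear_map TA SA N (\<lambda>x. F (y \<otimes>\<^bsub>TP\<^esub> x))" if y: "y \<in> carrier TP" for y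
    using y by (intro series_linear_mapI T.series_algebra_axioms S.series_algebra_axioms linear_mapsI;
      simp add: F.add F.smult T.P.l_distr T.P.r_distr T.P.smult_mult_l T.P.smult_mult_r)+
  have right: "series_linear_map TA SA N (\<lambda>x. F x \<otimes>\<^bsub>SB\<^esub> z)"
    "series_linear_map TA SA N (\<lambda>x. z \<otimes>\<^bsub>SB\<^esub> F x)" if z: "z \<in> carrier SP" for z
    using series_linear_mapI[OF T.series_algebra_axioms S.series_algebra_axioms
        linear_maps_comp[OF F.linear series_linear_map.linear[OF star_alg_mult_linear(1)[OF z]]]]
      series_linear_mapI[OF T.series_algebra_axioms S.series_algebra_axioms
        linear_maps_comp[OF F.linear series_linear_map.linear[OF star_alg_mult_linear(2)[OF z]]]]
    by (simp_all only: simp_thms)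
  have const: "F (const TA a \<otimes>\<^bsub>TP\<^esub> const TA b) = F (const TA a) \<otimes>\<^bsub>SB\<^esub> F (const TA b)"
    if "a \<in> carrier TA" "b \<in> carrier TA" for a b
    using that by (simp add: F_const tensor_map_mult flip: T.const_mult)
  have const': "F (const TA a \<otimes>\<^bsub>TP\<^esub> y) = F (const TA a) \<otimes>\<^bsub>SB\<^esub> F y" if a: "a \<in> carrier TA" for a
    by (rule series_linear_map_eqI[OF left(2)[OF T.const_closed[OF a]] right(2)[OF F.closed[OF T.const_closed[OF a]]]
          const[OF a T.coeff_closed[OF y]] y])
  show ?thesis
    by (rule series_linear_map_eqI[OF left(1)[OF y] right(1)[OF F.closed[OF y]]
          const'[OF T.coeff_closed[OF x]] x])
qed

lemma F_one: "F \<one>\<^bsub>TP\<^esub> = \<one>\<^bsub>SB\<^esub>"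
  using F_word[of "[]"] by (simp add: pseries_sel(3))

lemma F_hom: "F \<in> alg_hom TP SB"
  unfolding alg_hom_def
proof
  show "F \<in> ring_hom TP SB"
    by (rule ring_hom_memI) (simp_all add: star_alg_sel(1,4) F_mult F_one F.add)
  show "F \<in> linear_maps TP SB"
    using F.linear by (simp add: linear_maps_star_alg)
qed

lemma F_gen: "F (tensor_gen scale v) = sym_gen scale v"
  using F_word[of "[v]"] by (simp add: tensor_gen_def)

text \<open>The generators fix G on words, linearity extends this to constants, and
  \<open>coeff_formula\<close> to all series; continuity of G is not assumed but follows.\<close>

lemma F_unique:
  assumes G: "G \<in> alg_hom TP SB" "\<And>v. G (tensor_gen scale v) = sym_gen scale v"
    and t: "t \<in> carrier TP"
  shows "G t = F t"
proof -
  have lin: "G \<in> linear_maps TP SB" and hom: "G \<in> ring_hom TP SB"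
    using G(1) by (auto simp: alg_hom_def)
  have lin': "(\<lambda>a. G (const TA a)) \<in> linear_maps TA (restrict_scalars SB)"
    using T.const_linear linear_maps_restrict_scalars[OF lin] by (rule linear_maps_comp)
  have "(\<lambda>a. G (const TA a)) a = tensor_map a" if a: "a \<in> carrier TA" for a
  proof (rule tensor_linear_eqI[OF algebra_restrict_scalars[OF algebra_star_alg] lin' tensor_map(1) _ a])
    fix as
    have "G (list_mult TP (map (tensor_gen scale) as)) = list_mult SB (map G (map (tensor_gen scale) as))"
      by (rule ring_hom_list_mult[OF T.algebra_pseries hom]) auto
    then show "G (const TA (tensor_word scale as)) = tensor_map (tensor_word scale as)"
      by (simp add: tensor_gen_word tensor_map(2) comp_def G(2))
  qed
  then have eq: "G (const TA a) = F (const TA a)" if "a \<in> carrier TA" for a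
    using that F_const by simp
  have "series_linear_map TA SA N G"
    using T.series_algebra_axioms S.series_algebra_axioms lin[unfolded linear_maps_star_alg]
    by (rule series_linear_mapI)
  then show ?thesis
    using F_linear eq[OF T.coeff_closed[OF t]] t by (rule series_linear_map_eqI)
qed

text \<open>F carries a tensor word to the star product of its letters and hence an average over
  orders to the corresponding average. Linearity extends this from words to all of
  S(V)[[h]].\<close>

lemma F_tensor_symm:
  assumes p: "p \<in> carrier SP"
  shows "F (tensor_symm scale N p) = star_symm scale N star p"
proof -
  interpret ts: series_linear_map SA TA N "tensor_symm scale N" by (rule tensor_symm_linear)
  interpret ss: series_linear_map SA SA N "star_symm scale N star" by (rule star_symm_linear)
  have lin: "(\<lambda>p. F (tensor_symm scale N p)) \<in> linear_maps SP SP"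
    using ts.linear F.linear by (rule linear_maps_comp)
  have lin_F: "linear_map (restrict_scalars TP) (restrict_scalars SB) F"
    using algebra_restrict_scalars[OF T.algebra_pseries] algebra_restrict_scalars[OF algebra_star_alg]
      linear_maps_restrict_scalars[OF F.linear, folded restrict_star_alg_linear_maps]
    by (rule linear_mapI)
  have "(\<lambda>q. F (tensor_symm scale N (const SA q))) q = (\<lambda>q. star_symm scale N star (const SA q)) q"
    if q: "q \<in> carrier SA" for q
  proof (rule sym_linear_eqI[OF algebra_restrict_scalars[OF S.algebra_pseries] _ _ _ q])
    show "(\<lambda>q. F (tensor_symm scale N (const SA q))) \<in> linear_maps SA (restrict_scalars SP)"
      using S.const_linear linear_maps_restrict_scalars[OF lin] by (rule linear_maps_comp)
    show "(\<lambda>q. star_symm scale N star (const SA q)) \<in> linear_maps SA (restrict_scalars SP)"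
      using S.const_linear linear_maps_restrict_scalars[OF ss.linear] by (rule linear_maps_comp)
    show "F (tensor_symm scale N (const SA (sym_word scale as))) = star_symm scale N star (const SA (sym_word scale as))" for as
      unfolding tensor_symm_word star_symm_word
      by (rule sym_average_hom[OF lin_F]) (simp_all add: tensor_gen_word F_word)
  qed
  then have eq: "F (tensor_symm scale N (const SA q)) = star_symm scale N star (const SA q)"
    if "q \<in> carrier SA" for q using that by simp
  show ?thesis
    using series_linear_mapI[OF S.series_algebra_axioms S.series_algebra_axioms lin] star_symm_linear
      eq[OF S.coeff_closed[OF p]] p
    by (rule series_linear_map_eqI)
qed

text \<open>Modulo h the star product of letters is their commutative product, and averaging equal
  products changes nothing.\<close>

lemma star_symm_coeff_0:
  assumes q: "q \<in> carrier SA"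
  shows "star_symm scale N star (const SA q) 0 = q"
proof -
  interpret ss: series_linear_map SA SA N "star_symm scale N star" by (rule star_symm_linear)
  have lin0: "(\<lambda>x. x 0) \<in> linear_maps (restrict_scalars SB) SA"
    unfolding restrict_star_alg_linear_maps by (rule S.coeff_linear)
  have "(\<lambda>q. star_symm scale N star (const SA q) 0) q = (\<lambda>q. q) q"
  proof (rule sym_linear_eqI[OF algebra_sym_alg _ _ _ q])
    show "(\<lambda>q. star_symm scale N star (const SA q) 0) \<in> linear_maps SA SA"
      using linear_maps_comp[OF S.const_linear linear_maps_restrict_scalars[OF ss.linear]] S.coeff_linear
      by (rule linear_maps_comp)
    show "(\<lambda>q. q) \<in> linear_maps SA SA" by (intro linear_mapsI) auto
    fix as
    have "sym_average (restrict_scalars SB) (sym_gen scale) as 0 = sym_average SA (sym_incl scale) as"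
      by (rule sym_average_hom[OF linear_mapI[OF algebra_restrict_scalars[OF algebra_star_alg] algebra_sym_alg lin0]])
         (simp_all add: star_alg_coeff_0_word)
    also have "\<dots> = sym_word scale as"
      by (rule sym_average_commuting[OF algebra_sym_alg]) (simp_all add: sym_alg_commute)
    finally show "star_symm scale N star (const SA (sym_word scale as)) 0 = sym_word scale as"
      by (simp only: star_symm_word)
  qed
  then show ?thesis .
qed

lemma F_surjective: "F ` carrier TP = carrier SB"
proof -
  interpret ts: series_linear_map SA TA N "tensor_symm scale N" by (rule tensor_symm_linear)
  have "\<exists>a\<in>carrier TA. F (const TA a) 0 = c" if c: "c \<in> carrier SA" for c
  proof
    \<comment> \<open>The witness is the symmetrized tensor of c modulo h: F turns it into the
      star-symmetrization of c, whose constant term is c.\<close>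
    show "tensor_symm scale N (const SA c) 0 \<in> carrier TA"
      using c by (intro T.coeff_closed ts.closed S.const_closed)
    have "F (const TA (tensor_symm scale N (const SA c) 0)) 0 = F (tensor_symm scale N (const SA c)) 0"
      using c by (intro F.coeff_0[symmetric] ts.closed S.const_closed)
    then show "F (const TA (tensor_symm scale N (const SA c) 0)) 0 = c"
      using c by (simp add: F_tensor_symm star_symm_coeff_0)
  qed
  then have "\<exists>x\<in>carrier TP. F x = y" if "y \<in> carrier SP" for y
    using that by (rule F.surjective)
  then show ?thesis
    unfolding star_alg_sel(1) using F.closed by blast
qed

end

section \<open>The kernel\<close>

lemma (in series_algebra) mult_0:
  "x \<in> carrier P \<Longrightarrow> y \<in> carrier P \<Longrightarrow> (x \<otimes>\<^bsub>P\<^esub> y) 0 = x 0 \<otimes> y 0"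
  using N_pos[unfolded zero_enat_def] by (simp add: mult_nth convolution_def)

text \<open>Taking the constant term is a surjective ring homomorphism: a factor from A is lifted to
  a constant series, multiplied there and projected back.\<close>

lemma (in series_algebra) ideal_coeff_0:
  assumes "ideal I P"
  shows "ideal ((\<lambda>x. x 0) ` I) A"
proof -
  interpret I: ideal I P by fact
  show ?thesis
  proof (rule idealI)
    show "subgroup ((\<lambda>x. x 0) ` I) (add_monoid A)"
    proof (rule A.add.subgroupI)
      fix a b assume a: "a \<in> (\<lambda>x. x 0) ` I" and b: "b \<in> (\<lambda>x. x 0) ` I"
      obtain j where j: "j \<in> I" "a = j 0" using a by blast
      obtain k where k: "k \<in> I" "b = k 0" using b by blast
      show "a \<oplus> b \<in> (\<lambda>x. x 0) ` I"
        unfolding j(2) k(2) add_nth[symmetric] by (rule imageI[OF I.a_closed[OF j(1) k(1)]])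
    next
      fix a assume a: "a \<in> (\<lambda>x. x 0) ` I"
      obtain j where j: "j \<in> I" "a = j 0" using a by blast
      show "\<ominus> a \<in> (\<lambda>x. x 0) ` I"
        unfolding j(2) a_inv_nth[OF I.a_Hcarr[OF j(1)], symmetric] by (rule imageI[OF I.a_inv_closed[OF j(1)]])
    next
      show "(\<lambda>x. x 0) ` I \<subseteq> carrier A" using coeff_closed[OF I.a_Hcarr] by blast
      show "(\<lambda>x. x 0) ` I \<noteq> {}" using I.zero_closed by blast
    qed
  next
    fix a x assume ax: "a \<in> (\<lambda>x. x 0) ` I" "x \<in> carrier A"
    then obtain j where j: "j \<in> I" "a = j 0" by auto
    have "x \<otimes> a = (const A x \<otimes>\<^bsub>P\<^esub> j) 0" "a \<otimes> x = (j \<otimes>\<^bsub>P\<^esub> const A x) 0"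
      using ax j I.a_Hcarr by (simp_all add: mult_0)
    moreover have "const A x \<otimes>\<^bsub>P\<^esub> j \<in> I" "j \<otimes>\<^bsub>P\<^esub> const A x \<in> I"
      using I.I_l_closed[OF j(1)] I.I_r_closed[OF j(1)] const_closed[OF ax(2)] by auto
    ultimately show "x \<otimes> a \<in> (\<lambda>x. x 0) ` I" "a \<otimes> x \<in> (\<lambda>x. x 0) ` I"
      by (auto intro: rev_image_eqI)
  qed (rule A.ring_axioms)
qed

locale balanced_deformation = star_deformation +
  assumes balanced: "balanced scale N star"
begin

definition relator :: "'b \<Rightarrow> 'b \<Rightarrow> nat \<Rightarrow> ('a, 'b) tensor" where
  "relator a b = commutator TP (tensor_gen scale a) (tensor_gen scale b)
     \<ominus>\<^bsub>TP\<^esub> tensor_symm scale N (star_bracket scale N star a b)"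

definition I where "I = Idl\<^bsub>TP\<^esub> {relator a b | a b. True}"

lemma J_star_eq: "J_star scale N star = hadic_closure TP I"
  by (simp add: J_star_def I_def relator_def)

lemma star_bracket_closed [simp]: "star_bracket scale N star a b \<in> carrier SP"
  using B.commutator_closed[of "sym_gen scale a" "sym_gen scale b"]
  by (simp add: star_bracket_def star_alg_sel(1))

lemma star_alg_minus: "x \<ominus>\<^bsub>SB\<^esub> y = x \<ominus>\<^bsub>SP\<^esub> y"
  by (simp add: a_minus_def a_inv_def star_alg_sel)

lemma star_bracket_0: "star_bracket scale N star a b 0 = \<zero>\<^bsub>SA\<^esub>"
proof -
  have "star_bracket scale N star a b 0 =
      sym_gen scale a 0 \<otimes>\<^bsub>SA\<^esub> sym_gen scale b 0 \<ominus>\<^bsub>SA\<^esub> sym_gen scale b 0 \<otimes>\<^bsub>SA\<^esub> sym_gen scale a 0"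
    unfolding star_bracket_def commutator_def star_alg_minus
    using star_alg_mult_closed gen_closed(2) by (simp add: S.minus_nth star_alg_mult_0)
  also have "\<dots> = \<zero>\<^bsub>SA\<^esub>"
    using sym_alg_commute[of "sym_gen scale a 0" scale "sym_gen scale b 0"]
    by (simp add: S.A.minus_eq_zero_iff)
  finally show ?thesis .
qed

text \<open>The bound in \<open>balanced\<close> is a supremum over all coefficients of all brackets
  of letters, so each coefficient of this bracket is fixed. Linearity over \<open>F[[h]]\<close>
  passes from the coefficients to the series.\<close>

lemma star_symm_star_bracket:
  "star_symm scale N star (star_bracket scale N star a b) = star_bracket scale N star a b"
proof -
  let ?b = "star_bracket scale N star a b"
  have "enat (sym_degree (?b n)) \<le>
      (SUP (x, y, n)\<in>UNIV. enat (sym_degree (star_bracket scale N star x y n)))" for n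
    by (rule SUP_upper2[of "(a, b, n)"]) simp_all
  then have eq: "star_symm scale N star (const SA (?b n)) = const SA (?b n)" for n
    using balanced S.coeff_closed[OF star_bracket_closed]
    unfolding balanced_def s_balanced_def by blast
  have id: "series_linear_map SA SA N (\<lambda>x. x)"
    by (intro series_linear_mapI S.series_algebra_axioms linear_mapsI refl)
  show ?thesis
    by (rule series_linear_map_eqI[OF star_symm_linear id eq star_bracket_closed])
qed

lemma tensor_symm_closed [simp]: "p \<in> carrier SP \<Longrightarrow> tensor_symm scale N p \<in> carrier TP"
proof -
  interpret ts: series_linear_map SA TA N "tensor_symm scale N" by (rule tensor_symm_linear)
  show "p \<in> carrier SP \<Longrightarrow> tensor_symm scale N p \<in> carrier TP" by (rule ts.closed)
qed

lemma relator_closed [simp]: "relator a b \<in> carrier TP"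
  unfolding relator_def by (intro T.P.minus_closed T.P.commutator_closed tensor_symm_closed) simp_all

lemma F_relator: "F (relator a b) = \<zero>\<^bsub>SP\<^esub>"
proof -
  have "F (commutator TP (tensor_gen scale a) (tensor_gen scale b)) = star_bracket scale N star a b"
    unfolding commutator_def star_bracket_def star_alg_minus
    by (subst F.diff) (simp_all add: F_mult F_gen)
  moreover have "F (tensor_symm scale N (star_bracket scale N star a b)) = star_bracket scale N star a b"
    by (simp add: F_tensor_symm star_symm_star_bracket)
  ultimately show ?thesis
    unfolding relator_def
    by (subst F.diff) (simp_all add: T.P.commutator_closed S.P.minus_eq_zero_iff)
qed

lemma relator_0:
  "relator a b 0 = commutator TA (tensor_incl scale a) (tensor_incl scale b)"
proof -
  interpret ts: series_linear_map SA TA N "tensor_symm scale N" by (rule tensor_symm_linear)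
  have "tensor_symm scale N (star_bracket scale N star a b) 0 = tensor_symm scale N (const SA \<zero>\<^bsub>SA\<^esub>) 0"
    using ts.coeff_0[OF star_bracket_closed[of a b]] by (simp add: star_bracket_0)
  also have "const SA \<zero>\<^bsub>SA\<^esub> = \<zero>\<^bsub>SP\<^esub>" by (auto simp: const_def S.zero_nth)
  finally have "tensor_symm scale N (star_bracket scale N star a b) 0 = \<zero>\<^bsub>TA\<^esub>"
    by (simp add: T.zero_nth)
  then show ?thesis
    unfolding relator_def
    by (subst T.minus_nth)
       (simp_all add: T.P.commutator_closed, simp add: commutator_def T.minus_nth T.mult_0 tensor_gen_def
          T.A.minus_eq T.A.r_zero)
qed

sublocale I: ideal I TP
  unfolding I_def by (rule T.P.genideal_ideal) auto

lemma relator_in_I: "relator a b \<in> I"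
proof -
  have "{relator a b | a b. True} \<subseteq> I"
    unfolding I_def by (rule T.P.genideal_self) auto
  then show ?thesis by blast
qed

lemma F_kernel_ideal: "ideal {t \<in> carrier TP. F t = \<zero>\<^bsub>SP\<^esub>} TP"
proof -
  have "ring_hom_ring TP SB F"
    using F_hom T.P.ring_axioms B.ring_axioms by (intro ring_hom_ringI2) (auto simp: alg_hom_def)
  then have "ideal (a_kernel TP SB F) TP" by (rule ring_hom_ring.kernel_is_ideal)
  then show ?thesis unfolding a_kernel_def' star_alg_sel(3) .
qed

lemma F_I: "t \<in> I \<Longrightarrow> F t = \<zero>\<^bsub>SP\<^esub>"
proof -
  have "I \<subseteq> {t \<in> carrier TP. F t = \<zero>\<^bsub>SP\<^esub>}"
    unfolding I_def by (rule T.P.genideal_minimal[OF F_kernel_ideal]) (auto simp: F_relator)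
  then show "t \<in> I \<Longrightarrow> F t = \<zero>\<^bsub>SP\<^esub>" by blast
qed

text \<open>Modulo \<open>h\<close> the relators are commutators, and modulo commutators each tensor is the
  symmetrization of its image in \<open>S(V)\<close>.\<close>

lemma coeff_0_in_I:
  assumes a: "a \<in> carrier TA" and zero: "F (const TA a) 0 = \<zero>\<^bsub>SA\<^esub>"
  obtains j where "j \<in> I" "j 0 = a"
proof -
  \<comment> \<open>The ideal of constant terms of elements of I. By \<open>relator_0\<close> it
    contains all commutators of letters, so letters commute in the quotient by K.\<close>
  define K where "K = (\<lambda>x. x 0) ` I"
  interpret K: algebra_ideal TA K
    using T.ideal_coeff_0[OF I.ideal_axioms] algebra_tensor_alg unfolding K_def by (intro algebra_ideal.intro)
  let ?Q = "alg_quot TA K"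
  interpret Q: assoc_algebra ?Q by (rule K.algebra_alg_quot)
  interpret ts: series_linear_map SA TA N "tensor_symm scale N" by (rule tensor_symm_linear)
  define q where "q x = K +>\<^bsub>TA\<^esub> tensor_incl scale x" for x
  have q: "q x \<in> carrier ?Q" for x unfolding q_def by (rule K.coset_closed) simp
  have comm: "q x \<otimes>\<^bsub>?Q\<^esub> q y = q y \<otimes>\<^bsub>?Q\<^esub> q x" for x y
  proof -
    have "commutator TA (tensor_incl scale x) (tensor_incl scale y) \<in> K"
      unfolding K_def relator_0[symmetric] using relator_in_I by (rule imageI)
    then show ?thesis
      unfolding q_def commutator_def by (simp add: K.coset_mult K.coset_eq_iff)
  qed
  have coset_word: "K +>\<^bsub>TA\<^esub> tensor_word scale as = list_mult ?Q (map q as)" for as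
    by (induction as) (simp_all add: K.coset_one q_def[abs_def] flip: K.coset_mult)
  have coset: "linear_map TA ?Q (\<lambda>x. K +>\<^bsub>TA\<^esub> x)"
    using algebra_tensor_alg K.algebra_alg_quot K.coset_linear by (rule linear_mapI)
  have coeff: "linear_map (restrict_scalars TP) TA (\<lambda>x. x 0)"
    using algebra_restrict_scalars[OF T.algebra_pseries] algebra_tensor_alg T.coeff_linear by (rule linear_mapI)
  define \<sigma> where "\<sigma> p = tensor_symm scale N (const SA p) 0" for p
  define \<pi> where "\<pi> t = F (const TA t) 0" for t
  have \<sigma>: "\<sigma> \<in> linear_maps SA TA"
    unfolding \<sigma>_def using linear_maps_comp[OF S.const_linear linear_maps_restrict_scalars[OF ts.linear]] T.coeff_linear
    by (rule linear_maps_comp)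
  have \<pi>: "\<pi> \<in> linear_maps TA SA"
    unfolding \<pi>_def using linear_maps_comp[OF T.const_linear linear_maps_restrict_scalars[OF F.linear]] S.coeff_linear
    by (rule linear_maps_comp)
  have \<sigma>_word: "\<sigma> (sym_word scale as) = sym_average TA (tensor_incl scale) as" for as
    unfolding \<sigma>_def tensor_symm_word
    by (rule sym_average_hom[OF coeff]) (simp_all add: tensor_gen_word)
  have \<pi>_word: "\<pi> (tensor_word scale as) = sym_word scale as" for as
    by (simp add: \<pi>_def F_word star_alg_coeff_0_word)
  \<comment> \<open>Both sides are linear in t, so words suffice. The symmetrization of a word
    averages its reorderings, and all of these have the same class modulo K.\<close>
  have "(\<lambda>t. K +>\<^bsub>TA\<^esub> t) a = (\<lambda>t. K +>\<^bsub>TA\<^esub> \<sigma> (\<pi> t)) a"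
  proof (rule tensor_linear_eqI[OF K.algebra_alg_quot K.coset_linear _ _ a])
    show "(\<lambda>t. K +>\<^bsub>TA\<^esub> \<sigma> (\<pi> t)) \<in> linear_maps TA ?Q"
      by (rule linear_maps_comp[OF linear_maps_comp[OF \<pi> \<sigma>] K.coset_linear])
    fix as
    have "K +>\<^bsub>TA\<^esub> \<sigma> (\<pi> (tensor_word scale as)) = sym_average ?Q q as"
      unfolding \<pi>_word \<sigma>_word by (rule sym_average_hom[OF coset]) (simp_all add: coset_word)
    also have "\<dots> = K +>\<^bsub>TA\<^esub> tensor_word scale as"
      unfolding coset_word by (rule sym_average_commuting[OF K.algebra_alg_quot q comm])
    finally show "K +>\<^bsub>TA\<^esub> tensor_word scale as = K +>\<^bsub>TA\<^esub> \<sigma> (\<pi> (tensor_word scale as))" by simp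
  qed
  also have "\<sigma> (\<pi> a) = \<zero>\<^bsub>TA\<^esub>"
    using linear_map.zero[OF linear_mapI[OF algebra_sym_alg algebra_tensor_alg \<sigma>]] zero
    by (simp add: \<pi>_def)
  finally have "a \<in> K"
    using K.coset_eq_iff[OF a T.A.zero_closed] a by (simp add: T.A.minus_eq T.A.r_zero)
  then show thesis using that unfolding K_def by blast
qed

text \<open>Asking for F t = 0 only modulo h^m keeps the induction going: subtract j in I with the
  constant term of t, write t - j = h v, and F v vanishes modulo one power of h less. An
  approximation y of v then yields j + h y for t.\<close>

lemma approximate_by_I:
  assumes "t \<in> carrier TP" "\<And>n. n < m \<Longrightarrow> F t n = \<zero>\<^bsub>SA\<^esub>" "enat m \<le> N"
  shows "\<exists>y\<in>I. \<forall>n<m. t n = y n"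
  using assms
proof (induction m arbitrary: t)
  case 0
  then show ?case using I.zero_closed by blast
next
  case (Suc m)
  have "F (const TA (t 0)) 0 = \<zero>\<^bsub>SA\<^esub>"
    using F.coeff_0[OF Suc.prems(1)] Suc.prems(2)[of 0] by simp
  then obtain j where j: "j \<in> I" "j 0 = t 0"
    using coeff_0_in_I[OF T.coeff_closed[OF Suc.prems(1)]] by blast
  have jc: "j \<in> carrier TP" using j(1) by (rule I.a_Hcarr)
  define u where "u = t \<ominus>\<^bsub>TP\<^esub> j"
  define v where "v = series_shift u"
  have uc: "u \<in> carrier TP" using Suc.prems(1) jc by (simp add: u_def)
  have vc: "v \<in> carrier TP" unfolding v_def by (rule T.shift_closed[OF uc])
  have "u 0 = \<zero>\<^bsub>TA\<^esub>"
    using Suc.prems(1) jc j(2) by (simp add: u_def T.minus_nth T.A.minus_eq_zero_iff)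
  moreover have "const TA \<zero>\<^bsub>TA\<^esub> = \<zero>\<^bsub>TP\<^esub>" by (auto simp: const_def T.zero_nth)
  ultimately have u: "u = fps_X \<odot>\<^bsub>TP\<^esub> v"
    using T.decompose[OF uc] vc by (simp add: v_def)
  have Fu: "F u = F t"
    using Suc.prems(1) jc F_I[OF j(1)] by (simp add: u_def F.diff S.P.minus_eq S.P.r_zero)
  \<comment> \<open>At index Suc n \<ge> N the truncation would erase coefficient n of F v, and h
    could not be cancelled; this is where the bound of m by N is used.\<close>
  have lt: "enat (Suc n) < N" if "n < m" for n
    using that Suc.prems(3) by (metis Suc_less_eq enat_ord_simps(2) order_less_le_trans)
  have "F v n = \<zero>\<^bsub>SA\<^esub>" if n: "n < m" for n
  proof -
    have "F u (Suc n) = F v n"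
      unfolding u F.smult[OF vc] using lt[OF n] F.closed[OF vc] by (simp add: S.smult_X_nth)
    then show ?thesis using Suc.prems(2)[of "Suc n"] n by (simp add: Fu)
  qed
  moreover have "enat m \<le> N"
    using Suc.prems(3) by (meson Suc_ile_eq order_less_imp_le)
  ultimately obtain y where y: "y \<in> I" "\<And>n. n < m \<Longrightarrow> v n = y n"
    using Suc.IH[OF vc] by blast
  have yc: "y \<in> carrier TP" using y(1) by (rule I.a_Hcarr)
  \<comment> \<open>I is given only as a ring ideal, so the scalar h acts through the ring element h
    1.\<close>
  have Xy: "fps_X \<odot>\<^bsub>TP\<^esub> y \<in> I"
    using I.I_l_closed[OF y(1), of "fps_X \<odot>\<^bsub>TP\<^esub> \<one>\<^bsub>TP\<^esub>"] yc
    by (simp add: T.P.smult_mult_l)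
  show ?case
  proof (intro bexI[of _ "j \<oplus>\<^bsub>TP\<^esub> (fps_X \<odot>\<^bsub>TP\<^esub> y)"] allI impI)
    show "j \<oplus>\<^bsub>TP\<^esub> (fps_X \<odot>\<^bsub>TP\<^esub> y) \<in> I" using j(1) Xy by (rule I.a_closed)
    fix n assume n: "n < Suc m"
    have "t = j \<oplus>\<^bsub>TP\<^esub> u"
      unfolding u_def using Suc.prems(1) jc by (simp add: T.P.add_minus_cancel)
    then have "t n = j n \<oplus>\<^bsub>TA\<^esub> (fps_X \<odot>\<^bsub>TP\<^esub> v) n"
      unfolding u by (simp only: T.add_nth)
    also have "(fps_X \<odot>\<^bsub>TP\<^esub> v) n = (fps_X \<odot>\<^bsub>TP\<^esub> y) n"
      using y(2)[of "n - 1"] n by (cases n) (simp_all add: T.smult_X_nth[OF vc] T.smult_X_nth[OF yc])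
    finally show "t n = (j \<oplus>\<^bsub>TP\<^esub> (fps_X \<odot>\<^bsub>TP\<^esub> y)) n"
      by (simp only: T.add_nth)
  qed
qed

lemma J_star_eq_kernel: "J_star scale N star = {t \<in> carrier TP. F t = \<zero>\<^bsub>SP\<^esub>}"
proof (intro equalityI subsetI)
  fix t assume t: "t \<in> J_star scale N star"
  then have tc: "t \<in> carrier TP" by (simp add: J_star_eq hadic_closure_def)
  have "F t n = \<zero>\<^bsub>SP\<^esub> n" for n
  proof -
    \<comment> \<open>Agreement up to order n is enough to control F t n by
      \<open>coeff_cong\<close>; in other words, the kernel of F is h-adically closed.\<close>
    obtain y where y: "y \<in> I" "\<And>k. k < Suc n \<Longrightarrow> t k = y k"
      using t unfolding J_star_eq hadic_closure_def by blast
    have "F t n = F y n"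
      using tc I.a_Hcarr[OF y(1)] y(2) by (intro F.coeff_cong) auto
    then show ?thesis using F_I[OF y(1)] by simp
  qed
  then show "t \<in> {t \<in> carrier TP. F t = \<zero>\<^bsub>SP\<^esub>}" using tc by blast
next
  fix t assume "t \<in> {t \<in> carrier TP. F t = \<zero>\<^bsub>SP\<^esub>}"
  then have tc: "t \<in> carrier TP" and Ft: "\<And>n. F t n = \<zero>\<^bsub>SA\<^esub>" by (auto simp: S.zero_nth)
  have "\<exists>y\<in>I. \<forall>n<m. t n = y n" for m
  proof (cases "enat m \<le> N")
    case True
    then show ?thesis using approximate_by_I[OF tc Ft] by blast
  next
    case False
    then obtain k where k: "N = enat k" by (cases N) auto
    \<comment> \<open>When m exceeds N = k, an approximation of order k is already an equality,
      because both series vanish from index k on.\<close>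
    then obtain y where y: "y \<in> I" "\<And>n. n < k \<Longrightarrow> t n = y n"
      using approximate_by_I[OF tc Ft, of k] by auto
    have "t n = y n" for n
      using y(2)[of n] T.coeff_eq_zero[OF tc, of n] T.coeff_eq_zero[OF I.a_Hcarr[OF y(1)], of n] k
      by (cases "n < k") auto
    then show ?thesis using y(1) by blast
  qed
  then show "t \<in> J_star scale N star" using tc by (simp add: J_star_eq hadic_closure_def)
qed

text \<open>The generators coincide one by one: bracket-exactness rewrites the star bracket as h
  times the Poisson bracket, and symmetrization commutes with h.\<close>

lemma J_bracket_eq:
  assumes "poisson_bracket SA br" "bracket_exact scale N star br"
  shows "J_star scale N star = J_bracket scale N br"
proof -
  interpret ts: series_linear_map SA TA N "tensor_symm scale N" by (rule tensor_symm_linear)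
  have "br (sym_incl scale x) (sym_incl scale y) \<in> carrier SA" for x y
  proof -
    have "br (sym_incl scale x) \<in> linear_maps SA SA"
      using assms(1) sym_incl_closed[of scale x] unfolding poisson_bracket_def by blast
    then show ?thesis using sym_incl_closed[of scale y] by (auto simp: linear_maps_def)
  qed
  then have "tensor_symm scale N (star_bracket scale N star x y) =
      fps_X \<odot>\<^bsub>TP\<^esub> tensor_symm scale N (const SA (br (sym_incl scale x) (sym_incl scale y)))" for x y
    using assms(2) unfolding bracket_exact_def by (simp add: ts.smult)
  then show ?thesis by (simp only: J_star_def J_bracket_def)
qed

lemma F_induces_iso:
  "\<exists>f\<in>alg_iso (U_star scale N star) SB.
     \<forall>t\<in>carrier TP. f (J_star scale N star +>\<^bsub>TP\<^esub> t) = F t"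
  unfolding U_star_def
  by (rule alg_iso_quotient[OF T.algebra_pseries algebra_star_alg F_hom F_surjective])
     (simp add: J_star_eq_kernel star_alg_sel(3))

end

theorem theorem7p8:
  fixes scale :: "'f::field_char_0 \<Rightarrow> 'v::ab_group_add \<Rightarrow> 'v"
    and star :: "('f, 'v) star"
    and N :: enat
  assumes "vector_space scale"
    and "N = \<infinity> \<or> (\<exists>n. N = enat (n + 1))"
    and "deformation scale N star"
    and "balanced scale N star"
  shows "\<exists>F\<in>alg_hom (tensor_series scale N) (star_alg scale N star).
      (\<forall>v. F (tensor_gen scale v) = sym_gen scale v)
    \<and> (\<forall>G\<in>alg_hom (tensor_series scale N) (star_alg scale N star).
         (\<forall>v. G (tensor_gen scale v) = sym_gen scale v) \<longrightarrow>
         (\<forall>t\<in>carrier (tensor_series scale N). G t = F t))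
    \<and> (\<exists>f\<in>alg_iso (U_star scale N star) (star_alg scale N star).
         \<forall>t\<in>carrier (tensor_series scale N).
           f (J_star scale N star +>\<^bsub>tensor_series scale N\<^esub> t) = F t)
    \<and> (\<forall>br. poisson_bracket (sym_alg scale) br \<and> deforms_bracket scale N star br
           \<and> bracket_exact scale N star br \<longrightarrow>
         U_star scale N star = U_bracket scale N br
       \<and> (\<exists>f\<in>alg_iso (U_bracket scale N br) (star_alg scale N star).
            \<forall>t\<in>carrier (tensor_series scale N).
              f (J_bracket scale N br +>\<^bsub>tensor_series scale N\<^esub> t) = F t))"
proof -
  have "0 < N" using assms(2) by (auto simp: zero_enat_def)
  then interpret balanced_deformation scale star N
    using assms(3,4) by unfold_locales
  show ?thesis
  proof (intro bexI[of _ F] conjI allI impI ballI F_gen F_hom F_unique F_induces_iso)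
    fix br assume br: "poisson_bracket (sym_alg scale) br \<and> deforms_bracket scale N star br
      \<and> bracket_exact scale N star br"
    then have J: "J_star scale N star = J_bracket scale N br" using J_bracket_eq by blast
    then show U: "U_star scale N star = U_bracket scale N br"
      by (simp add: U_star_def U_bracket_def)
    show "\<exists>f\<in>alg_iso (U_bracket scale N br) (star_alg scale N star).
        \<forall>t\<in>carrier (tensor_series scale N).
          f (J_bracket scale N br +>\<^bsub>tensor_series scale N\<^esub> t) = F t"
      using F_induces_iso unfolding U J .
  qed auto
qed

end
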